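(* Let $\mathfrak{g}_n$ be the affine symplectic Lie algebra and $\omega_n=\sum_{i=1}^n\frac{\partial}{\partial x^i}\wedge\frac{\partial}{\partial y^i}$. There is an isomorphism of vector spaces $$HL_*(\mathfrak{g}_n;\mathbb{R})\cong\Lambda^*(\omega_n)$$ and an algebra isomorphism $$HL^*(\mathfrak{g}_n;\mathbb{R})\cong\Lambda^*(\omega_n^* ),\qquad \omega_n^*=\sum_{i=1}^n dx^i\wedge dy^i,$$ where $HL^*$ is given the shuffle algebra structure.
   Context: Give $\mathbb{R}^{2n}$ coordinates $x_1,\dots,x_n,y_1,\dots,y_n$; brackets are Lie brackets of vector fields. $\mathfrak{sp}_n$ is the real Lie algebra of vector fields with basis $\mathcal{B}_1$: $x_k\frac{\partial}{\partial y^k}$; $y_k\frac{\partial}{\partial x^k}$; $x_i\frac{\partial}{\partial y^j}+x_j\frac{\partial}{\partial y^i}$ ($i\neq j$); $y_i\frac{\partial}{\partial x^j}+y_j\frac{\partial}{\partial x^i}$ ($i\ne j$); $y_j\frac{\partial}{\partial y^i}-x_i\frac{\partial}{\partial x^j}$ ($i=j$ allowed). $I_n$ is spanned by $\mathcal{B}_2=\{\frac{\partial}{\partial x^i},\frac{\partial}{\partial y^i}\}_{i=1}^n$. The affine symplectic Lie algebra $\mathfrak{g}_n$ is the Lie algebra of vector fields with basis $\mathcal{B}_1\cup\mathcal{B}_2$ (the Lie algebra of the affine symplectic group). For a Lie algebra $\mathfrak{g}$, the Leibniz homology $HL_*(\mathfrak{g};\mathbb{R})$ is the homology of the complex $T(\mathfrak{g})$: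 $\mathfrak{g}^{\otimes m}$ in degree $m$ with $d(g_1,\dots,g_m)=\sum_{1\le i<j\le m}(-1)^j(g_1,\dots,g_{i-1},[g_i,g_j],g_{i+1},\dots,\widehat{g_j},\dots,g_m)$ (so $d=[\,,\,]$ in degree 2 and $d=0$ in degree 1). $HL^*(\mathfrak{g};\mathbb{R})$ is the cohomology of the dual complex $\mathrm{Hom}(\mathfrak{g}^{\otimes m},\mathbb{R})$, with product induced by the shuffle product of cochains. $dx^i,dy^i$ denote the dual basis elements to $\frac{\partial}{\partial x^i},\frac{\partial}{\partial y^i}$ with respect to the basis $\mathcal{B}_1\cup\mathcal{B}_2$. $\Lambda^*(\omega_n)$ (resp. $\Lambda^*(\omega_n^* )$) denotes the exterior algebra generated by $\omega_n$ (resp. $\omega_n^*$), spanned by the powers $\omega_n^{\wedge k}$, $k\ge0$. *)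

theory Defs
  imports Complex_Main
begin

datatype crd = Cx nat | Cy nat

definition coords :: "nat \<Rightarrow> crd set" where
  "coords n = {Cx i | i. 1 \<le> i \<and> i \<le> n} \<union> {Cy i | i. 1 \<le> i \<and> i \<le> n}"

text \<open>Affine vector fields on R^{2n}.  A field V is encoded by its coefficients:
  the k-th component is  V^k(p) = (sum over j of V k (Some j) * p_j) + V k None.
  So V k (Some j) is the partial derivative of V^k in direction j.\<close>
type_synonym avf = "crd \<Rightarrow> crd option \<Rightarrow> real"

text \<open>Lie bracket of vector fields  [X,Y]^k = sum_j (X^j d_j Y^k - Y^j d_j X^k),
  written out on the coefficients of affine fields.\<close>
definition vf_bracket :: "nat \<Rightarrow> avf \<Rightarrow> avf \<Rightarrow> avf" where
  "vf_bracket n X Y = (\<lambda>k v. \<Sum>j\<in>coords n. X j v * Y k (Some j) - Y j v * X k (Some j))"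

text \<open>Labels of the basis B_1 \<union> B_2.
  XdY k = x_k d/dy^k;  YdX k = y_k d/dx^k;
  XXdY i j = x_i d/dy^j + x_j d/dy^i (i<j);  YYdX i j = y_i d/dx^j + y_j d/dx^i (i<j);
  S i j = y_j d/dy^i - x_i d/dx^j;  DX i = d/dx^i;  DY i = d/dy^i.\<close>
datatype bl = XdY nat | YdX nat | XXdY nat nat | YYdX nat nat | S nat nat | DX nat | DY nat

definition basis :: "nat \<Rightarrow> bl set" where
  "basis n =
     {XdY k | k. 1 \<le> k \<and> k \<le> n} \<union> {YdX k | k. 1 \<le> k \<and> k \<le> n}
   \<union> {XXdY i j | i j. 1 \<le> i \<and> i < j \<and> j \<le> n} \<union> {YYdX i j | i j. 1 \<le> i \<and> i < j \<and> j \<le> n}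
   \<union> {S i j | i j. 1 \<le> i \<and> i \<le> n \<and> 1 \<le> j \<and> j \<le> n}
   \<union> {DX i | i. 1 \<le> i \<and> i \<le> n} \<union> {DY i | i. 1 \<le> i \<and> i \<le> n}"

definition ind :: "bool \<Rightarrow> real" where "ind b = (if b then 1 else 0)"

fun field :: "bl \<Rightarrow> avf" where
  "field (XdY k) = (\<lambda>c v. ind (c = Cy k \<and> v = Some (Cx k)))"
| "field (YdX k) = (\<lambda>c v. ind (c = Cx k \<and> v = Some (Cy k)))"
| "field (XXdY i j) = (\<lambda>c v. ind (c = Cy j \<and> v = Some (Cx i)) + ind (c = Cy i \<and> v = Some (Cx j)))"
| "field (YYdX i j) = (\<lambda>c v. ind (c = Cx j \<and> v = Some (Cy i)) + ind (c = Cx i \<and> v = Some (Cy j)))"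
| "field (S i j) = (\<lambda>c v. ind (c = Cy i \<and> v = Some (Cy j)) - ind (c = Cx j \<and> v = Some (Cx i)))"
| "field (DX i) = (\<lambda>c v. ind (c = Cx i \<and> v = None))"
| "field (DY i) = (\<lambda>c v. ind (c = Cy i \<and> v = None))"

definition coord :: "nat \<Rightarrow> avf \<Rightarrow> bl \<Rightarrow> real" where
  "coord n V = (THE a. (\<forall>l. l \<notin> basis n \<longrightarrow> a l = 0) \<and>
                        (\<forall>k v. V k v = (\<Sum>l\<in>basis n. a l * field l k v)))"

definition br :: "nat \<Rightarrow> bl \<Rightarrow> bl \<Rightarrow> bl \<Rightarrow> real" where
  "br n a b = coord n (vf_bracket n (field a) (field b))"

text \<open>A tensor in g_n^{\<otimes>m} is given by its coefficients on the basis tensors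
  e_{l_1} \<otimes> ... \<otimes> e_{l_m}, i.e. a function on lists of labels, supported on
  the lists of length m with entries in the basis.  Dually, an m-cochain is given
  by its values on the basis tensors.\<close>
definition tuples :: "nat \<Rightarrow> nat \<Rightarrow> bl list set" where
  "tuples n m = {ls. length ls = m \<and> set ls \<subseteq> basis n}"

definition chains :: "nat \<Rightarrow> nat \<Rightarrow> (bl list \<Rightarrow> real) set" where
  "chains n m = {t. \<forall>ls. ls \<notin> tuples n m \<longrightarrow> t ls = 0}"

definition zf :: "bl list \<Rightarrow> real" where "zf = (\<lambda>_. 0)"

definition remove_at :: "nat \<Rightarrow> 'a list \<Rightarrow> 'a list" where
  "remove_at j xs = take j xs @ drop (Suc j) xs"

text \<open>Coefficient of the basis tensor gs in d(e_{ls}), where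
  d(g_1,...,g_m) = sum_{1<=i<j<=m} (-1)^j (g_1,...,g_{i-1},[g_i,g_j],g_{i+1},...,^g_j,...,g_m).
  Positions i, j are 0-based here, so the sign (-1)^j becomes (-1)^(j+1).\<close>
definition dbasis :: "nat \<Rightarrow> bl list \<Rightarrow> bl list \<Rightarrow> real" where
  "dbasis n ls gs =
     (\<Sum>j<length ls. \<Sum>i<j. (-1) ^ (j + 1) *
        (if length gs + 1 = length ls \<and>
            (\<forall>p<length gs. p \<noteq> i \<longrightarrow> gs ! p = remove_at j ls ! p)
         then br n (ls ! i) (ls ! j) (gs ! i) else 0))"

definition bd :: "nat \<Rightarrow> nat \<Rightarrow> (bl list \<Rightarrow> real) \<Rightarrow> (bl list \<Rightarrow> real)" where
  "bd n m t = (\<lambda>gs. \<Sum>ls\<in>tuples n m. t ls * dbasis n ls gs)"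

definition cycles :: "nat \<Rightarrow> nat \<Rightarrow> (bl list \<Rightarrow> real) set" where
  "cycles n m = {t \<in> chains n m. bd n m t = zf}"

definition boundaries :: "nat \<Rightarrow> nat \<Rightarrow> (bl list \<Rightarrow> real) set" where
  "boundaries n m = bd n (Suc m) ` chains n (Suc m)"

definition cod :: "nat \<Rightarrow> nat \<Rightarrow> (bl list \<Rightarrow> real) \<Rightarrow> (bl list \<Rightarrow> real)" where
  "cod n m f = (\<lambda>ls. if ls \<in> tuples n (Suc m)
                     then (\<Sum>gs\<in>tuples n m. f gs * dbasis n ls gs) else 0)"

definition cocycles :: "nat \<Rightarrow> nat \<Rightarrow> (bl list \<Rightarrow> real) set" where
  "cocycles n m = {f \<in> chains n m. cod n m f = zf}"

fun coboundaries :: "nat \<Rightarrow> nat \<Rightarrow> (bl list \<Rightarrow> real) set" where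
  "coboundaries n 0 = {zf}"
| "coboundaries n (Suc m) = cod n m ` chains n m"

text \<open>Signed (p,q)-shuffle product of tensors (of cochains): positions S of size p go
  to the first factor, the rest to the second, with the sign of the shuffle permutation
  (number of inversions).  On antisymmetric tensors this is the wedge product.\<close>
definition shuffle_sign :: "nat \<Rightarrow> nat set \<Rightarrow> real" where
  "shuffle_sign N A = (-1) ^ card {(s, t). s \<in> A \<and> t \<in> {0..<N} - A \<and> t < s}"

definition shuf :: "nat \<Rightarrow> nat \<Rightarrow> (bl list \<Rightarrow> real) \<Rightarrow> (bl list \<Rightarrow> real) \<Rightarrow> (bl list \<Rightarrow> real)" where
  "shuf p q f g = (\<lambda>ls. if length ls = p + q then
      (\<Sum>A\<in>{A. A \<subseteq> {0..<p+q} \<and> card A = p}.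
          shuffle_sign (p + q) A * f (nths ls A) * g (nths ls ({0..<p+q} - A)))
      else 0)"

text \<open>\<omega>_n = sum_i d/dx^i \<wedge> d/dy^i, as the antisymmetric 2-tensor
  sum_i (d/dx^i \<otimes> d/dy^i - d/dy^i \<otimes> d/dx^i).\<close>
definition omega :: "nat \<Rightarrow> bl list \<Rightarrow> real" where
  "omega n = (\<lambda>ls. \<Sum>i\<in>{1..n}. ind (ls = [DX i, DY i]) - ind (ls = [DY i, DX i]))"

text \<open>\<omega>_n^* = sum_i dx^i \<wedge> dy^i as the alternating 2-cochain
  sum_i (dx^i \<otimes> dy^i - dy^i \<otimes> dx^i) (values on basis tensors).\<close>
definition omega_star :: "nat \<Rightarrow> bl list \<Rightarrow> real" where
  "omega_star n = (\<lambda>ls. \<Sum>i\<in>{1..n}. ind (ls = [DX i, DY i]) - ind (ls = [DY i, DX i]))"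

definition unit_t :: "bl list \<Rightarrow> real" where "unit_t = (\<lambda>ls. ind (ls = []))"

fun wpow :: "(bl list \<Rightarrow> real) \<Rightarrow> nat \<Rightarrow> bl list \<Rightarrow> real" where
  "wpow w 0 = unit_t"
| "wpow w (Suc k) = shuf 2 (2 * k) w (wpow w k)"

definition Lam :: "(bl list \<Rightarrow> real) \<Rightarrow> nat \<Rightarrow> (bl list \<Rightarrow> real) set" where
  "Lam w m = {(\<lambda>ls. c * wpow w k ls) | c k. 2 * k = m} \<union> {zf}"

definition iso_onto_quot ::
  "(bl list \<Rightarrow> real) set \<Rightarrow> (bl list \<Rightarrow> real) set \<Rightarrow> (bl list \<Rightarrow> real) set
   \<Rightarrow> ((bl list \<Rightarrow> real) \<Rightarrow> (bl list \<Rightarrow> real)) \<Rightarrow> bool" where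
  "iso_onto_quot A Z B f \<longleftrightarrow>
     (\<forall>x\<in>A. \<forall>y\<in>A. \<forall>c::real. f (\<lambda>l. x l + y l) = (\<lambda>l. f x l + f y l)
                          \<and> f (\<lambda>l. c * x l) = (\<lambda>l. c * f x l))
   \<and> f ` A \<subseteq> Z
   \<and> (\<forall>z\<in>Z. \<exists>a\<in>A. (\<lambda>l. z l - f a l) \<in> B)
   \<and> (\<forall>a\<in>A. f a \<in> B \<longrightarrow> a = zf)"

end

theory Submission
  imports Defs
begin

text \<open>
  Write \<open>\<g> = \<s> \<oplus> I\<close> with \<open>I\<close> the translations, and let \<open>D(r)\<close> be the complex with the cochains of
  \<open>T(\<g>)\<close> in which the first \<open>r\<close> slots form a coefficient module on which \<open>I\<close> acts by zero, so that
  \<open>D(0)\<close> is the Leibniz complex.  Inserting the Casimir element of \<open>\<s>\<close> behind the coefficient slots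
  is a null homotopy of the Casimir operator \<open>\<Omega>\<close> of the coefficients on the cochains vanishing when
  slot \<open>r\<close> is in \<open>I\<close>; the remaining cochains live in \<open>D(r + 1)\<close>.  As \<open>\<s>\<close> is split, \<open>-\<Omega>\<close> has the form
  \<open>\<Sum> X\<^sup>T X\<close>, hence a cocycle is, up to a coboundary, killed by \<open>\<s>\<close> on the
  coefficients, and then it is a cocycle of \<open>D(r + 1)\<close> as well.  Downward induction on \<open>r\<close> shows that
  cocycles vanishing on \<open>I\<^sup>\<otimes>\<^sup>p\<close> are coboundaries; the base of this step is that \<open>\<s> \<otimes> \<Lambda>\<^sup>p I\<close> has no
  invariant linear form.  A cocycle supported on \<open>I\<^sup>\<otimes>\<^sup>p\<close> is alternating and \<open>\<s>\<close>-invariant, hence a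
  multiple of a power of \<open>\<omega>\<close>.  Both isomorphisms are thus induced by the inclusions.
  Nontriviality of the powers, and homology, follow from the duality pairing, since a power of
  \<open>\<omega>\<close> is a cycle and a cocycle at once.
\<close>

section \<open>The Leibniz algebra of letters and the coboundary\<close>

text \<open>With no coefficient slots the Casimir operator is zero, and in general it kills the
  invariants of the coefficients, so at \<open>r = 0\<close> the homotopy alone proves nothing. What
  it leaves over is passed on to \<open>D(r + 1)\<close>, where one more slot has become a
  coefficient; this is why exactness is proved for all \<open>r\<close> together. Letting
  translations act by zero on the new coefficient slot changes nothing in the cases that occur: if
  the slot holds a translation, they act trivially because \<open>I\<close> is abelian; if the
  cochain vanishes whenever the slot holds a translation, their action on an entry of
  \<open>sp_n\<close> yields only vanishing values. The two coboundaries then differ only in the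
  term that removes slot \<open>r\<close>, an action of \<open>sp_n\<close> on the coefficients, and
  invariance kills it. The primitive found in \<open>D(r + 1)\<close> need not be invariant, so the
  Casimir splitting is applied a second time, to the primitive. The splitting rests on orthogonality
  in a finite-dimensional space of cochains, without eigenvalues or complete reducibility.\<close>

fun dual :: "crd \<Rightarrow> crd" where
  "dual (Cx i) = Cy i"
| "dual (Cy i) = Cx i"

fun sg :: "crd \<Rightarrow> real" where
  "sg (Cx i) = 1"
| "sg (Cy i) = -1"

definition om :: "crd \<Rightarrow> crd \<Rightarrow> real" where
  "om a b = (if b = dual a then sg a else 0)"

lemma dual_dual [simp]: "dual (dual a) = a"
  by (cases a) auto

lemma dual_neq [simp]: "dual a \<noteq> a" "a \<noteq> dual a"
  by (cases a; simp)+

lemma dual_inj [simp]: "dual a = dual b \<longleftrightarrow> a = b"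
  using dual_dual by metis

lemma sg_dual [simp]: "sg (dual a) = - sg a"
  by (cases a) auto

lemma sg_sq [simp]: "sg a * sg a = 1"
  by (cases a) auto

lemma sg_sq_left [simp]: "sg a * (sg a * x) = x"
  by (cases a) auto

lemma sg_nz [simp]: "sg a \<noteq> 0"
  by (cases a) auto

lemma om_antisym: "om a b = - om b a"
  by (auto simp: om_def)

lemma om_self [simp]: "om a a = 0"
  by (simp add: om_def)

lemma om_dual [simp]: "om a (dual a) = sg a" "om (dual a) a = - sg a"
  by (auto simp: om_def)

lemma dual_coords [simp]: "dual a \<in> coords n \<longleftrightarrow> a \<in> coords n"
  by (cases a) (auto simp: coords_def)

lemma finite_coords [simp]: "finite (coords n)"
proof -
  have "coords n \<subseteq> Cx ` {1..n} \<union> Cy ` {1..n}" by (auto simp: coords_def)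
  thus ?thesis by (rule finite_subset) auto
qed

text \<open>\<open>Quad a b\<close> stands for the linear field \<open>c \<mapsto> om b c \<cdot> a + om a c \<cdot> b\<close> (the product
  of two linear Hamiltonians); every label of \<open>\<B>\<^sub>1\<close> is a nonzero multiple of such a field.\<close>
datatype ltr = Lin crd | Quad crd crd

fun isQ :: "ltr \<Rightarrow> bool" where
  "isQ (Lin c) = False"
| "isQ (Quad a b) = True"

text \<open>The linear form \<open>F\<close> at \<open>[y, x]\<close>, for the second argument \<open>x\<close> acting from the right.  Linear forms
  need not identify \<open>Quad a b\<close> with \<open>Quad b a\<close>: already on ordered letters this is a Leibniz algebra.\<close>
fun brk :: "ltr \<Rightarrow> ltr \<Rightarrow> (ltr \<Rightarrow> real) \<Rightarrow> real" where
  "brk (Lin c) (Lin d) F = 0"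
| "brk (Lin c) (Quad a b) F = om b c * F (Lin a) + om a c * F (Lin b)"
| "brk (Quad c d) (Quad a b) F =
     om b c * F (Quad a d) + om a c * F (Quad b d) + om b d * F (Quad c a) + om a d * F (Quad c b)"
| "brk (Quad a b) (Lin c) F = - (om b c * F (Lin a) + om a c * F (Lin b))"

lemma bre_add: "brk y x (\<lambda>z. F z + G z) = brk y x F + brk y x G"
  by (cases y; cases x) (auto simp: algebra_simps)

lemma bre_scale: "brk y x (\<lambda>z. c * F z) = c * brk y x F"
  by (cases y; cases x) (auto simp: algebra_simps)

lemma bre_zero [simp]: "brk y x (\<lambda>z. 0) = 0"
  by (cases y; cases x) auto

lemma bre_sum: "brk y x (\<lambda>z. \<Sum>i\<in>I. F i z) = (\<Sum>i\<in>I. brk y x (F i))"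
  by (induction I rule: infinite_finite_induct) (auto simp: bre_add)

lemma bre_cong: "(\<And>z. isQ z = (isQ y \<and> isQ x) \<Longrightarrow> F z = G z) \<Longrightarrow> brk y x F = brk y x G"
  by (cases y; cases x) auto

text \<open>This is the right Leibniz identity \<open>[[y,x],x'] - [[y,x'],x] = [y,[x,x']]\<close>,
  paired with \<open>F\<close>. On ordered letters the bracket is antisymmetric only up to
  exchanging the entries of a quadratic letter, so the one-sided form is the one to use.\<close>

lemma bre_jacobi:
  "brk y x (\<lambda>z. brk z x' F) - brk y x' (\<lambda>z. brk z x F) = brk x x' (\<lambda>z. brk y z F)"
proof (cases x)
  case (Lin a)
  show ?thesis
  proof (cases x')
    case (Lin c)
    show ?thesis unfolding Lin \<open>x = Lin a\<close> by (cases y) auto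
  next
    case (Quad c d)
    show ?thesis unfolding Quad Lin
    proof (cases y)
      case (Quad e f)
      show "brk y (Lin a) (\<lambda>z. brk z (Quad c d) F) - brk y (Quad c d) (\<lambda>z. brk z (Lin a) F) =
        brk (Lin a) (Quad c d) (\<lambda>z. brk y z F)" unfolding Quad
        by (simp add: algebra_simps om_antisym[of a c] om_antisym[of a d] om_antisym[of f c]
           om_antisym[of f d] om_antisym[of e c] om_antisym[of e d])
    qed auto
  qed
next
  case (Quad a b)
  show ?thesis
  proof (cases x')
    case (Lin c)
    show ?thesis unfolding Lin Quad
    proof (cases y)
      case (Quad e f)
      show "brk y (Quad a b) (\<lambda>z. brk z (Lin c) F) - brk y (Lin c) (\<lambda>z. brk z (Quad a b) F) =
        brk (Quad a b) (Lin c) (\<lambda>z. brk y z F)" unfolding Quad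
        by (simp add: algebra_simps om_antisym[of c a] om_antisym[of c b] om_antisym[of f a]
           om_antisym[of f b] om_antisym[of e a] om_antisym[of e b])
    qed auto
  next
    case Q: (Quad c d)
    show ?thesis unfolding Q Quad
      by (cases y) (simp_all add: algebra_simps om_antisym[of a c] om_antisym[of a d] om_antisym[of b c] om_antisym[of b d])
  qed
qed

section \<open>Pointwise linear operators\<close>

definition linop :: "(('a \<Rightarrow> real) \<Rightarrow> 'b \<Rightarrow> real) \<Rightarrow> bool" where
  "linop T \<longleftrightarrow> (\<forall>f g w. T (\<lambda>v. f v + g v) w = T f w + T g w) \<and> (\<forall>c f w. T (\<lambda>v. c * f v) w = c * T f w)"

lemma linopI:
  "(\<And>f g w. T (\<lambda>v. f v + g v) w = T f w + T g w) \<Longrightarrow> (\<And>c f w. T (\<lambda>v. c * f v) w = c * T f w) \<Longrightarrow> linop T"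
  by (simp add: linop_def)

lemma linop_add: "linop T \<Longrightarrow> T (\<lambda>v. f v + g v) w = T f w + T g w"
  and linop_scale: "linop T \<Longrightarrow> T (\<lambda>v. c * f v) w = c * T f w"
  by (simp_all add: linop_def)

lemma linop_zero: "linop T \<Longrightarrow> T (\<lambda>v. 0) w = 0"
  using linop_scale[of T 0 "\<lambda>v. 0" w] by simp

lemma linop_minus: "linop T \<Longrightarrow> T (\<lambda>v. - f v) w = - T f w"
  using linop_scale[of T "-1" f w] by simp

lemma linop_diff: "linop T \<Longrightarrow> T (\<lambda>v. f v - g v) w = T f w - T g w"
  using linop_add[of T f "\<lambda>v. - g v" w] linop_minus[of T g w] by simp

lemma linop_sum:
  assumes T: "linop T"
  shows "T (\<lambda>v. \<Sum>i\<in>I. f i v) w = (\<Sum>i\<in>I. T (f i) w)"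
  by (induction I rule: infinite_finite_induct) (auto simp: linop_add[OF T] linop_zero[OF T])

lemma linop_bre:
  assumes T: "linop T"
  shows "T (\<lambda>v. brk y x (\<lambda>z. f z v)) w = brk y x (\<lambda>z. T (f z) w)"
  by (cases y; cases x) (auto simp: linop_add[OF T] linop_scale[OF T] linop_zero[OF T] linop_minus[OF T] linop_diff[OF T])

text \<open>Words list the slots in reverse order: the head is the last slot, and a slot is numbered by
  the number of letters behind it.  \<open>sel i x\<close> says whether \<open>x\<close> acts on slot \<open>i\<close>.\<close>
primrec act :: "(nat \<Rightarrow> ltr \<Rightarrow> bool) \<Rightarrow> ltr \<Rightarrow> (ltr list \<Rightarrow> real) \<Rightarrow> ltr list \<Rightarrow> real" where
  "act sel x f [] = 0"
| "act sel x f (y # w) = act sel x (\<lambda>v. f (y # v)) w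
     + (if sel (length w) x then brk y x (\<lambda>z. f (z # w)) else 0)"

lemma act_cong: "(\<And>v. length v = length w \<Longrightarrow> f v = g v) \<Longrightarrow> act sel x f w = act sel x g w"
proof (induction w arbitrary: f g)
  case (Cons y w)
  have "act sel x (\<lambda>v. f (y # v)) w = act sel x (\<lambda>v. g (y # v)) w"
    by (rule Cons.IH) (simp add: Cons.prems)
  moreover have "brk y x (\<lambda>z. f (z # w)) = brk y x (\<lambda>z. g (z # w))"
    by (rule bre_cong) (simp add: Cons.prems)
  ultimately show ?case by simp
qed simp

lemma act_sel_cong: "(\<And>i. i < length w \<Longrightarrow> sel i x = sel' i x) \<Longrightarrow> act sel x f w = act sel' x f w"
  by (induction w arbitrary: f) auto

lemma act_add: "act sel x (\<lambda>v. f v + g v) w = act sel x f w + act sel x g w"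
  by (induction w arbitrary: f g) (auto simp: bre_add)

lemma act_scale: "act sel x (\<lambda>v. c * f v) w = c * act sel x f w"
  by (induction w arbitrary: f) (auto simp: bre_scale algebra_simps)

lemma linop_act: "linop (act sel x)"
  by (rule linopI) (auto simp: act_add act_scale)

lemmas act_bre = linop_bre[OF linop_act]

text \<open>The three choices turn a slot into the adjoint module, the pullback of a module along
  the projection onto \<open>sp_n\<close>, or a trivial module; in each case the action is a
  representation.\<close>

definition admissible :: "(nat \<Rightarrow> ltr \<Rightarrow> bool) \<Rightarrow> bool" where
  "admissible sel \<longleftrightarrow> (\<forall>i. sel i = (\<lambda>_. True) \<or> sel i = isQ \<or> sel i = (\<lambda>_. False))"

text \<open>Actions on two different slots commute, so their cross terms cancel; what remains are
  the terms with both letters acting on the same slot, where \<open>bre_jacobi\<close>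
  applies.\<close>

lemma act_commutator:
  assumes "admissible sel"
  shows "act sel x (act sel x' f) w - act sel x' (act sel x f) w = brk x x' (\<lambda>z. act sel z f w)"
proof (induction w arbitrary: f)
  case (Cons y w)
  define s where "s = sel (length w)"
  let ?d = "\<lambda>x F. if s x then brk y x F else 0"
  have E: "act sel x (act sel x' f) (y # w) =
      act sel x (act sel x' (\<lambda>v. f (y # v))) w
    + act sel x (\<lambda>v. ?d x' (\<lambda>z. f (z # v))) w
    + ?d x (\<lambda>z. act sel x' (\<lambda>v. f (z # v)) w)
    + ?d x (\<lambda>z. if s x' then brk z x' (\<lambda>z'. f (z' # w)) else 0)" for x x'
  proof -
    have 1: "act sel x (\<lambda>v. act sel x' f (y # v)) w =
        act sel x (\<lambda>v. act sel x' (\<lambda>v. f (y # v)) v + ?d x' (\<lambda>z. f (z # v))) w"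
      by (rule act_cong) (simp add: s_def)
    have 2: "?d x (\<lambda>z. act sel x' f (z # w)) = ?d x (\<lambda>z. act sel x' (\<lambda>v. f (z # v)) w)
      + ?d x (\<lambda>z. if s x' then brk z x' (\<lambda>z'. f (z' # w)) else 0)"
      by (simp add: s_def bre_add)
    have 3: "act sel x (act sel x' f) (y # w) = act sel x (\<lambda>v. act sel x' f (y # v)) w
      + ?d x (\<lambda>z. act sel x' f (z # w))"
      by (simp only: act.simps(2) s_def)
    show ?thesis unfolding 3 1 2 act_add by simp
  qed
  have S: "act sel x (\<lambda>v. ?d x' (\<lambda>z. f (z # v))) w = ?d x' (\<lambda>z. act sel x (\<lambda>v. f (z # v)) w)" for x x'
    by (simp add: act_bre linop_zero[OF linop_act])
  have T: "?d x (\<lambda>z. if s x' then brk z x' F else 0) - ?d x' (\<lambda>z. if s x then brk z x F else 0)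
     = brk x x' (\<lambda>z. ?d z F)" for F
  proof -
    consider "s = (\<lambda>_. True)" | "s = isQ" | "s = (\<lambda>_. False)"
      using assms unfolding admissible_def s_def by blast
    thus ?thesis
    proof cases
      case 1 thus ?thesis by (simp add: bre_jacobi)
    next
      case 2
      show ?thesis
      \<comment> \<open>Dropping the translations is compatible with the bracket because they form
        an ideal: the bracket of \<open>x\<close> and \<open>x'\<close> consists of quadratic
        letters exactly when both are quadratic.\<close>
      proof (cases "isQ x \<and> isQ x'")
        case True
        have "brk x x' (\<lambda>z. brk y z F) = brk x x' (\<lambda>z. ?d z F)"
          by (rule bre_cong) (use True 2 in auto)
        thus ?thesis using True 2 bre_jacobi[of y x x' F] by simp
      next
        case False
        have "brk x x' (\<lambda>z. ?d z F) = brk x x' (\<lambda>z. 0)"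
          by (rule bre_cong) (use False 2 in auto)
        thus ?thesis using False 2 by auto
      qed
    qed auto
  qed
  have "brk x x' (\<lambda>z. act sel z f (y # w)) = brk x x' (\<lambda>z. act sel z (\<lambda>v. f (y # v)) w) + brk x x' (\<lambda>z. ?d z (\<lambda>z. f (z # w)))"
    by (simp add: s_def bre_add)
  hence F: "brk x x' (\<lambda>z. act sel z f (y # w)) = act sel x (act sel x' (\<lambda>v. f (y # v))) w
      - act sel x' (act sel x (\<lambda>v. f (y # v))) w + brk x x' (\<lambda>z. ?d z (\<lambda>z. f (z # w)))"
    using Cons.IH[of "\<lambda>v. f (y # v)"] by linarith
  show ?case unfolding E S F T[symmetric] by simp
qed simp

text \<open>\<open>lie r\<close> and the coboundary \<open>del r\<close> below belong to \<open>D(r)\<close>: translations act by zero on the slots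
  below \<open>r\<close>, and these slots are never removed.  The overall sign of \<open>del\<close> matches \<open>(-1)\<^sup>j\<close> for 1-based \<open>j\<close>.\<close>
definition lie :: "nat \<Rightarrow> ltr \<Rightarrow> (ltr list \<Rightarrow> real) \<Rightarrow> ltr list \<Rightarrow> real" where
  "lie r = act (\<lambda>i x. r \<le> i \<or> isQ x)"

text \<open>The action on the coefficient module alone, from which both the homotopy and the Casimir
  operator are built.\<close>

definition pact :: "nat \<Rightarrow> ltr \<Rightarrow> (ltr list \<Rightarrow> real) \<Rightarrow> ltr list \<Rightarrow> real" where
  "pact r = act (\<lambda>i x. i < r \<and> isQ x)"

lemma admissible_lie: "admissible (\<lambda>i x. r \<le> i \<or> isQ x)"
  by (auto simp: admissible_def)

lemma admissible_pact: "admissible (\<lambda>i x. i < r \<and> isQ x)"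
  by (auto simp: admissible_def)

lemma linop_lie: "linop (lie r x)" and linop_pact: "linop (pact r x)"
  by (simp_all add: lie_def pact_def linop_act)

lemmas lie_commutator = act_commutator[OF admissible_lie, folded lie_def]
lemmas pact_commutator = act_commutator[OF admissible_pact, folded pact_def]

lemma lie_Nil [simp]: "lie r x f [] = 0"
  by (simp add: lie_def)

lemma lie_Cons: "lie r x f (y # w) = lie r x (\<lambda>v. f (y # v)) w
     + (if r \<le> length w \<or> isQ x then brk y x (\<lambda>z. f (z # w)) else 0)"
  by (simp add: lie_def)

primrec del :: "nat \<Rightarrow> (ltr list \<Rightarrow> real) \<Rightarrow> ltr list \<Rightarrow> real" where
  "del r f [] = 0"
| "del r f (x # w) = (if length w < r then 0
     else del r (\<lambda>v. f (x # v)) w + (-1) ^ (length w + 1) * lie r x f w)"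

lemma del_cong: "(\<And>v. length v + 1 = length w \<Longrightarrow> f v = g v) \<Longrightarrow> del r f w = del r g w"
proof (induction w arbitrary: f g)
  case (Cons y w)
  have "del r (\<lambda>v. f (y # v)) w = del r (\<lambda>v. g (y # v)) w"
    by (rule Cons.IH) (simp add: Cons.prems)
  moreover have "lie r y f w = lie r y g w"
    unfolding lie_def by (rule act_cong) (simp add: Cons.prems)
  ultimately show ?case by simp
qed simp

lemma del_short [simp]: "length w \<le> r \<Longrightarrow> del r f w = 0"
  by (cases w) auto

lemma del_add: "del r (\<lambda>v. f v + g v) w = del r f w + del r g w"
  by (induction w arbitrary: f g) (auto simp: lie_def act_add algebra_simps)

lemma del_scale: "del r (\<lambda>v. c * f v) w = c * del r f w"
  by (induction w arbitrary: f) (auto simp: lie_def act_scale algebra_simps)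

lemma linop_del: "linop (del r)"
  by (rule linopI) (auto simp: del_add del_scale)

lemmas del_bre = linop_bre[OF linop_del]

text \<open>The coboundary is assembled from brackets, and \<open>x\<close> acts on these as a
  derivation. Moving \<open>x\<close> past the action of a removed letter \<open>y\<close> costs the
  action of \<open>[y, x]\<close>, which is exactly what the derivation does to that letter.\<close>

lemma lie_del: "lie r x (del r f) w = del r (lie r x f) w"
proof (induction w arbitrary: f)
  case (Cons y w)
  show ?case
  proof (cases "length w < r")
    case True
    have "lie r x (del r f) (y # w) = lie r x (\<lambda>v. 0) (y # w)"
      unfolding lie_def by (rule act_cong) (use True in simp)
    also have "\<dots> = 0" by (simp add: linop_zero[OF linop_lie])
    finally show ?thesis using True by simp
  next
    case False
    let ?s = "(-1::real) ^ (length w + 1)"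
    have "lie r x (\<lambda>v. del r f (y # v)) w = lie r x (\<lambda>v. del r (\<lambda>v. f (y # v)) v + ?s * lie r y f v) w"
      unfolding lie_def by (rule act_cong) (use False in \<open>simp add: lie_def\<close>)
    also have "\<dots> = lie r x (del r (\<lambda>v. f (y # v))) w + ?s * lie r x (lie r y f) w"
      by (simp only: lie_def act_add act_scale)
    finally have 1: "lie r x (\<lambda>v. del r f (y # v)) w
      = lie r x (del r (\<lambda>v. f (y # v))) w + ?s * lie r x (lie r y f) w" .
    have 2: "brk y x (\<lambda>z. del r f (z # w)) = brk y x (\<lambda>z. del r (\<lambda>v. f (z # v)) w) + ?s * brk y x (\<lambda>z. lie r z f w)"
      using False by (simp only: del.simps if_False bre_add bre_scale)
    have 3: "del r (\<lambda>v. lie r x f (y # v)) w = del r (\<lambda>v. lie r x (\<lambda>v. f (y # v)) v + brk y x (\<lambda>z. f (z # v))) w"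
    proof (cases "length w = r")
      case True
      thus ?thesis by simp
    next
      case 2: False
      show ?thesis by (rule del_cong) (use False 2 in \<open>auto simp: lie_Cons\<close>)
    qed
    have "lie r x (del r f) (y # w) = lie r x (del r (\<lambda>v. f (y # v))) w + ?s * lie r x (lie r y f) w
       + brk y x (\<lambda>z. del r (\<lambda>v. f (z # v)) w) + ?s * brk y x (\<lambda>z. lie r z f w)"
      using False by (subst lie_Cons) (simp only: 1 2, simp)
    moreover have "del r (lie r x f) (y # w) = del r (lie r x (\<lambda>v. f (y # v))) w
       + brk y x (\<lambda>z. del r (\<lambda>v. f (z # v)) w) + ?s * lie r y (lie r x f) w"
      using False by (simp only: del.simps if_False 3 del_add del_bre)
    moreover have "lie r y (lie r x f) w = lie r x (lie r y f) w + brk y x (\<lambda>z. lie r z f w)"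
      using lie_commutator[of r y x f w] by simp
    ultimately show ?thesis using Cons.IH[of "\<lambda>v. f (y # v)"] by (simp only: distrib_left)
  qed
qed simp

text \<open>Terms that remove the last letter and one further letter arise in two orders. Their
  values agree by \<open>lie_del\<close>; their signs differ, since in one order the position of the
  last letter has already dropped by one.\<close>

lemma del_del: "del r (del r f) w = 0"
proof (induction w arbitrary: f)
  case (Cons x w)
  show ?case
  proof (cases "length w \<le> r")
    case True
    have "lie r x (del r f) w = lie r x (\<lambda>v. 0) w"
      unfolding lie_def by (rule act_cong) (use True in simp)
    hence "lie r x (del r f) w = 0" by (simp add: linop_zero[OF linop_lie])
    thus ?thesis using True by simp
  next
    case False
    let ?s = "(-1::real) ^ (length w + 1)"
    have "del r (\<lambda>v. del r f (x # v)) w = del r (\<lambda>v. del r (\<lambda>v. f (x # v)) v + (- ?s) * lie r x f v) w"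
    proof (rule del_cong)
      fix v :: "ltr list" assume "length v + 1 = length w"
      moreover from this have "?s = - ((-1) ^ (length v + 1))"
        by (metis mult_minus1 power_Suc Suc_eq_plus1)
      ultimately show "del r f (x # v) = del r (\<lambda>v. f (x # v)) v + (- ?s) * lie r x f v"
        using False by simp
    qed
    also have "\<dots> = - ?s * del r (lie r x f) w"
      by (simp only: del_add del_scale Cons.IH)
    finally show ?thesis using False lie_del[of r x f w] by simp
  qed
qed simp

section \<open>The Casimir homotopy\<close>

definition ltrs :: "nat \<Rightarrow> ltr set" where
  "ltrs n = Lin ` coords n \<union> (\<lambda>(a, b). Quad a b) ` (coords n \<times> coords n)"

lemma ltrs_simps [simp]: "Lin a \<in> ltrs n \<longleftrightarrow> a \<in> coords n"
  "Quad a b \<in> ltrs n \<longleftrightarrow> a \<in> coords n \<and> b \<in> coords n"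
  by (auto simp: ltrs_def)

lemma finite_ltrs [simp]: "finite (ltrs n)"
  by (simp add: ltrs_def)

text \<open>For \<open>om\<close>, the basis dual to the coordinates \<open>a\<close> is
  \<open>sg a * dual a\<close>. The sum is therefore the invariant tensor in two copies of the
  quadratic letters, a multiple of the Casimir element, written as a functional in the style of
  \<open>brk\<close>.\<close>

definition casimir :: "nat \<Rightarrow> (ltr \<Rightarrow> ltr \<Rightarrow> real) \<Rightarrow> real" where
  "casimir n G = (\<Sum>a\<in>coords n. \<Sum>b\<in>coords n. sg a * (sg b * G (Quad a b) (Quad (dual a) (dual b))))"

lemma cas_add: "casimir n (\<lambda>x x'. F x x' + G x x') = casimir n F + casimir n G"
  by (simp add: casimir_def distrib_left sum.distrib)

lemma cas_scale: "casimir n (\<lambda>x x'. c * G x x') = c * casimir n G"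
  by (simp add: casimir_def sum_distrib_left algebra_simps)

lemma cas_diff: "casimir n (\<lambda>x x'. F x x' - G x x') = casimir n F - casimir n G"
  using cas_add[of n F "\<lambda>x x'. - G x x'"] cas_scale[of n "-1" G] by simp

lemma cas_zero: "casimir n (\<lambda>x x'. 0) = 0"
  by (simp add: casimir_def)

lemma cas_cong:
  "(\<And>a b. a \<in> coords n \<Longrightarrow> b \<in> coords n \<Longrightarrow> F (Quad a b) (Quad (dual a) (dual b)) = G (Quad a b) (Quad (dual a) (dual b)))
    \<Longrightarrow> casimir n F = casimir n G"
  by (simp add: casimir_def)

lemma linop_cas:
  assumes T: "linop T"
  shows "T (\<lambda>v. casimir n (\<lambda>x x'. f x x' v)) w = casimir n (\<lambda>x x'. T (f x x') w)"
  unfolding casimir_def linop_sum[OF T] linop_scale[OF T] by simp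

lemma sum_om1: "d \<in> coords n \<Longrightarrow> (\<Sum>a\<in>coords n. sg a * (om d a * X a)) = - X (dual d)"
proof -
  assume d: "d \<in> coords n"
  have "(\<Sum>a\<in>coords n. sg a * (om d a * X a)) = (\<Sum>a\<in>coords n. if a = dual d then - X (dual d) else 0)"
    by (rule sum.cong) (auto simp: om_def algebra_simps simp flip: mult.assoc)
  thus ?thesis using d by simp
qed

lemma sum_om2: "d \<in> coords n \<Longrightarrow> (\<Sum>a\<in>coords n. sg a * (om d (dual a) * X a)) = X d"
proof -
  assume d: "d \<in> coords n"
  have "(\<Sum>a\<in>coords n. sg a * (om d (dual a) * X a)) = (\<Sum>a\<in>coords n. if a = d then X d else 0)"
    by (rule sum.cong) (auto simp: om_def algebra_simps simp flip: mult.assoc)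
  thus ?thesis using d by simp
qed

text \<open>The action on a quadratic letter changes one entry at a time. Hence it is enough to know
  that the bivector \<open>sum sg a * (a \<otimes> dual a)\<close> is invariant under
  \<open>Quad c d\<close>, which is \<open>half\<close>, and to use it once for the first entries
  and once for the second entries.\<close>

lemma cas_invariant:
  assumes c: "c \<in> coords n" and d: "d \<in> coords n"
  shows "casimir n (\<lambda>x x'. brk x (Quad c d) (\<lambda>z. G z x') + brk x' (Quad c d) (\<lambda>z. G x z)) = 0"
proof -
  have half: "(\<Sum>a\<in>coords n. sg a * (om d a * H c (dual a) + om c a * H d (dual a)
      + om d (dual a) * H a c + om c (dual a) * H a d)) = 0" for H :: "crd \<Rightarrow> crd \<Rightarrow> real"
    by (simp add: distrib_left sum.distrib sum_om1[OF c] sum_om1[OF d] sum_om2[OF c] sum_om2[OF d])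
  let ?h = "\<lambda>H a. om d a * H c (dual a) + om c a * H d (dual a) + om d (dual a) * H a c + om c (dual a) * H a d"
  have "casimir n (\<lambda>x x'. brk x (Quad c d) (\<lambda>z. G z x') + brk x' (Quad c d) (\<lambda>z. G x z))
    = (\<Sum>a\<in>coords n. \<Sum>b\<in>coords n.
         sg b * (sg a * ?h (\<lambda>p q. G (Quad p b) (Quad q (dual b))) a)
       + sg a * (sg b * ?h (\<lambda>p q. G (Quad a p) (Quad (dual a) q)) b))"
    unfolding casimir_def by (intro sum.cong refl) (simp add: algebra_simps)
  also have "\<dots> = (\<Sum>b\<in>coords n. sg b * (\<Sum>a\<in>coords n. sg a * ?h (\<lambda>p q. G (Quad p b) (Quad q (dual b))) a))
     + (\<Sum>a\<in>coords n. sg a * (\<Sum>b\<in>coords n. sg b * ?h (\<lambda>p q. G (Quad a p) (Quad (dual a) q)) b))"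
    unfolding sum.distrib sum_distrib_left by (subst sum.swap) simp
  also have "\<dots> = 0"
    using half[of "\<lambda>p q. G (Quad p b) (Quad q (dual b))" for b]
      half[of "\<lambda>p q. G (Quad a p) (Quad (dual a) q)" for a] by simp
  finally show ?thesis .
qed

lemma pact_Cons: "pact r x f (y # w) = pact r x (\<lambda>v. f (y # v)) w
     + (if length w < r \<and> isQ x then brk y x (\<lambda>z. f (z # w)) else 0)"
  by (simp add: pact_def)

lemma pact_Nil [simp]: "pact r x f [] = 0"
  by (simp add: pact_def)

lemma pact_cong: "(\<And>v. length v = length w \<Longrightarrow> f v = g v) \<Longrightarrow> pact r x f w = pact r x g w"
  unfolding pact_def by (rule act_cong)

lemma lie_cong: "(\<And>v. length v = length w \<Longrightarrow> f v = g v) \<Longrightarrow> lie r x f w = lie r x g w"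
  unfolding lie_def by (rule act_cong)

lemma lie_eq_pact: "length w \<le> j \<Longrightarrow> isQ x \<Longrightarrow> lie r x f w = pact j x f w"
  unfolding lie_def pact_def by (rule act_sel_cong) simp

lemma lie_Lin_short: "length w \<le> r \<Longrightarrow> lie r (Lin c) f w = 0"
  by (induction w arbitrary: f) (auto simp: lie_Cons)

text \<open>The recursion stops when exactly \<open>r\<close> letters are left, so that the new
  letter lands in slot \<open>r\<close>; on words shorter than \<open>r\<close> it is simply put at
  the end.\<close>

primrec ins :: "nat \<Rightarrow> ltr \<Rightarrow> (ltr list \<Rightarrow> real) \<Rightarrow> ltr list \<Rightarrow> real" where
  "ins r x f [] = f [x]"
| "ins r x f (y # w) = (if r \<le> length w then ins r x (\<lambda>v. f (y # v)) w else f (x # y # w))"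

lemma linop_ins: "linop (ins r x)"
proof (rule linopI)
  show "ins r x (\<lambda>v. f v + g v) w = ins r x f w + ins r x g w" for f g w
    by (induction w arbitrary: f g) auto
  show "ins r x (\<lambda>v. c * f v) w = c * ins r x f w" for f c w
    by (induction w arbitrary: f) auto
qed

lemma ins_base: "length w = r \<Longrightarrow> ins r x f w = f (x # w)"
  by (cases w) auto

lemma ins_cong: "(\<And>v. length v = Suc (length w) \<Longrightarrow> f v = g v) \<Longrightarrow> ins r x f w = ins r x g w"
proof (induction w arbitrary: f g)
  case (Cons y w)
  have "ins r x (\<lambda>v. f (y # v)) w = ins r x (\<lambda>v. g (y # v)) w"
    by (rule Cons.IH) (simp add: Cons.prems)
  thus ?case using Cons.prems[of "x # y # w"] by simp
qed simp

text \<open>One leg of the Casimir element acts on the coefficients, the other becomes a new letter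
  in slot \<open>r\<close>. When the coboundary removes that letter again, it acts on the
  coefficients too, and the Casimir operator appears.\<close>

definition homot :: "nat \<Rightarrow> nat \<Rightarrow> (ltr list \<Rightarrow> real) \<Rightarrow> ltr list \<Rightarrow> real" where
  "homot n r f w = casimir n (\<lambda>x x'. pact r x (ins r x' f) w)"

definition cas_op :: "nat \<Rightarrow> nat \<Rightarrow> (ltr list \<Rightarrow> real) \<Rightarrow> ltr list \<Rightarrow> real" where
  "cas_op n r f w = casimir n (\<lambda>x x'. pact r x (pact r x' f) w)"

lemma linop_comp:
  assumes T: "linop T" and U: "linop U"
  shows "linop (\<lambda>f. U (T f))"
proof (rule linopI)
  show "U (T (\<lambda>v. f v + g v)) w = U (T f) w + U (T g) w" for f g w
  proof -
    have "T (\<lambda>v. f v + g v) = (\<lambda>w. T f w + T g w)" using linop_add[OF T] by blast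
    thus ?thesis by (simp add: linop_add[OF U])
  qed
  show "U (T (\<lambda>v. c * f v)) w = c * U (T f) w" for c f w
  proof -
    have "T (\<lambda>v. c * f v) = (\<lambda>w. c * T f w)" using linop_scale[OF T] by blast
    thus ?thesis by (simp add: linop_scale[OF U])
  qed
qed

lemma linop_cas_op: "(\<And>x x'. linop (T x x')) \<Longrightarrow> linop (\<lambda>f w. casimir n (\<lambda>x x'. T x x' f w))"
  by (rule linopI) (simp_all add: linop_def cas_add cas_scale)

lemma linop_hom: "linop (homot n r)"
proof -
  have "homot n r = (\<lambda>f w. casimir n (\<lambda>x x'. pact r x (ins r x' f) w))" by (intro ext) (simp add: homot_def)
  thus ?thesis by (simp add: linop_cas_op linop_comp[OF linop_ins linop_pact])
qed

lemma linop_Omg: "linop (cas_op n r)"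
proof -
  have "cas_op n r = (\<lambda>f w. casimir n (\<lambda>x x'. pact r x (pact r x' f) w))" by (intro ext) (simp add: cas_op_def)
  thus ?thesis by (simp add: linop_cas_op linop_comp[OF linop_pact linop_pact])
qed

lemma hom_cong: "(\<And>v. length v = Suc (length w) \<Longrightarrow> f v = g v) \<Longrightarrow> homot n r f w = homot n r g w"
  unfolding homot_def by (intro cas_cong pact_cong ins_cong) simp

lemma Omg_cong: "(\<And>v. length v = length w \<Longrightarrow> f v = g v) \<Longrightarrow> cas_op n r f w = cas_op n r g w"
  unfolding cas_op_def by (intro cas_cong pact_cong) simp

lemma hom_Cons: "r \<le> length w \<Longrightarrow> homot n r f (y # w) = homot n r (\<lambda>v. f (y # v)) w"
proof -
  assume r: "r \<le> length w"
  have "pact r x (ins r x' f) (y # w) = pact r x (ins r x' (\<lambda>v. f (y # v))) w" for x x'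
  proof -
    have "pact r x (\<lambda>v. ins r x' f (y # v)) w = pact r x (ins r x' (\<lambda>v. f (y # v))) w"
      by (rule pact_cong) (use r in simp)
    thus ?thesis using r by (simp add: pact_Cons)
  qed
  thus ?thesis by (simp add: homot_def)
qed

lemma Omg_Cons: "r \<le> length w \<Longrightarrow> cas_op n r f (y # w) = cas_op n r (\<lambda>v. f (y # v)) w"
proof -
  assume r: "r \<le> length w"
  have "pact r x (pact r x' f) (y # w) = pact r x (pact r x' (\<lambda>v. f (y # v))) w" for x x'
  proof -
    have "pact r x (\<lambda>v. pact r x' f (y # v)) w = pact r x (pact r x' (\<lambda>v. f (y # v))) w"
      by (rule pact_cong) (use r in \<open>simp add: pact_Cons\<close>)
    thus ?thesis using r by (simp add: pact_Cons)
  qed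
  thus ?thesis by (simp add: cas_op_def)
qed

lemma hom_base: "length w = r \<Longrightarrow> homot n r f w = casimir n (\<lambda>x x'. pact r x (\<lambda>v. f (x' # v)) w)"
  unfolding homot_def by (intro cas_cong pact_cong ins_base) simp

definition vanL :: "nat \<Rightarrow> (ltr list \<Rightarrow> real) \<Rightarrow> bool" where
  "vanL r f \<longleftrightarrow> (\<forall>u a v. length v = r \<longrightarrow> f (u @ Lin a # v) = 0)"

lemma vanL_Cons: "vanL r f \<Longrightarrow> vanL r (\<lambda>v. f (y # v))"
  unfolding vanL_def by (metis append_Cons)

text \<open>For a quadratic \<open>y\<close> this is the invariance of the Casimir element. A
  translation \<open>y\<close> turns the inserted quadratic letter into a translation in slot
  \<open>r\<close>, where \<open>f\<close> vanishes; this is what \<open>vanL r f\<close> is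
  for.\<close>

lemma lie_hom:
  assumes "r \<le> length w" "y \<in> ltrs n" "isQ y \<or> vanL r f"
  shows "lie r y (homot n r f) w = homot n r (lie r y f) w"
  using assms
proof (induction w arbitrary: f)
  have base: "lie r y (homot n r f) w = homot n r (lie r y f) w"
    if r: "length w = r" and y: "y \<in> ltrs n" "isQ y \<or> vanL r f" for w f
  proof (cases y)
    case (Lin c)
    have "pact r x (\<lambda>v. lie r y f (Quad a b # v)) w = pact r x (\<lambda>v. 0) w" for x a b
    proof (rule pact_cong)
      fix v :: "ltr list" assume v: "length v = length w"
      have "f (Lin e # v) = 0" for e
        using y v r Lin unfolding vanL_def by (metis append_Nil isQ.simps(1))
      thus "lie r y f (Quad a b # v) = 0"
        using v r by (simp add: lie_Cons Lin lie_Lin_short)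
    qed
    hence "homot n r (lie r y f) w = casimir n (\<lambda>x x'. 0)"
      unfolding hom_base[OF r] by (intro cas_cong) (simp add: linop_zero[OF linop_pact])
    thus ?thesis using r by (simp add: Lin lie_Lin_short cas_zero)
  next
    case (Quad c d)
    have cd: "c \<in> coords n" "d \<in> coords n" using y Quad by auto
    have "lie r y (homot n r f) w = pact r y (\<lambda>v. casimir n (\<lambda>x x'. pact r x (\<lambda>v. f (x' # v)) v)) w"
      using r by (subst lie_eq_pact[of _ r]) (auto simp: Quad intro!: pact_cong hom_base)
    also have "\<dots> = casimir n (\<lambda>x x'. pact r y (pact r x (\<lambda>v. f (x' # v))) w)"
      by (rule linop_cas[OF linop_pact])
    finally have 1: "lie r y (homot n r f) w = casimir n (\<lambda>x x'. pact r y (pact r x (\<lambda>v. f (x' # v))) w)" .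
    have "pact r x (\<lambda>v. lie r y f (x' # v)) w
       = pact r x (\<lambda>v. pact r y (\<lambda>v. f (x' # v)) v + brk x' y (\<lambda>z. f (z # v))) w" for x x'
      by (rule pact_cong) (use r in \<open>auto simp: lie_Cons Quad intro!: lie_eq_pact\<close>)
    hence 2: "homot n r (lie r y f) w = casimir n (\<lambda>x x'. pact r x (pact r y (\<lambda>v. f (x' # v))) w
        + brk x' y (\<lambda>z. pact r x (\<lambda>v. f (z # v)) w))"
      unfolding hom_base[OF r] by (simp add: linop_add[OF linop_pact] linop_bre[OF linop_pact])
    have "homot n r (lie r y f) w - lie r y (homot n r f) w
      = casimir n (\<lambda>x x'. brk x y (\<lambda>z. pact r z (\<lambda>v. f (x' # v)) w) + brk x' y (\<lambda>z. pact r x (\<lambda>v. f (z # v)) w))"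
      unfolding 1 2 cas_diff[symmetric] pact_commutator[symmetric] by (rule cas_cong) simp
    also have "\<dots> = 0" unfolding Quad by (rule cas_invariant[OF cd])
    finally show ?thesis by simp
  qed
  { case Nil thus ?case using base[of "[]"] by simp }
  case (Cons z w)
  show ?case
  proof (cases "r \<le> length w")
    case False
    thus ?thesis using Cons.prems base[of "z # w"] by simp
  next
    case True
    have "lie r y (homot n r f) (z # w) = lie r y (\<lambda>v. homot n r f (z # v)) w + brk z y (\<lambda>z'. homot n r f (z' # w))"
      using True by (simp add: lie_Cons)
    also have "lie r y (\<lambda>v. homot n r f (z # v)) w = lie r y (homot n r (\<lambda>v. f (z # v))) w"
      by (rule lie_cong) (use True in \<open>simp add: hom_Cons\<close>)
    also have "\<dots> = homot n r (lie r y (\<lambda>v. f (z # v))) w"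
      using Cons True by (auto simp: vanL_Cons)
    finally have 1: "lie r y (homot n r f) (z # w) = homot n r (lie r y (\<lambda>v. f (z # v))) w + brk z y (\<lambda>z'. homot n r (\<lambda>v. f (z' # v)) w)"
      using True by (simp add: hom_Cons)
    have "homot n r (lie r y f) (z # w) = homot n r (\<lambda>v. lie r y f (z # v)) w"
      using True by (rule hom_Cons)
    also have "\<dots> = homot n r (\<lambda>v. lie r y (\<lambda>v. f (z # v)) v + brk z y (\<lambda>z'. f (z' # v))) w"
      by (rule hom_cong) (use True in \<open>simp add: lie_Cons\<close>)
    finally show ?thesis using 1 by (simp add: linop_add[OF linop_hom] linop_bre[OF linop_hom])
  qed
qed

text \<open>The action of a letter behind slot \<open>r\<close> commutes with \<open>homot\<close>,
  while the insertion shifts its position by one and flips its sign; these terms cancel. Only the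
  removal of the inserted letter survives, with the sign of position \<open>r + 1\<close>.\<close>

lemma hom_homotopy:
  assumes "r \<le> length w" "set w \<subseteq> ltrs n" "vanL r f"
  shows "del r (homot n r f) w + homot n r (del r f) w = (-1) ^ (r + 1) * cas_op n r f w"
  using assms
proof (induction w arbitrary: f)
  have base: "del r (homot n r f) w + homot n r (del r f) w = (-1) ^ (r + 1) * cas_op n r f w"
    if r: "length w = r" for w f
  proof -
    have "pact r x (\<lambda>v. del r f (Quad a b # v)) w = pact r x (\<lambda>v. (-1) ^ (r + 1) * pact r (Quad a b) f v) w" for x a b
      by (rule pact_cong) (use r in \<open>auto simp: intro!: lie_eq_pact\<close>)
    hence "homot n r (del r f) w = casimir n (\<lambda>x x'. (-1) ^ (r + 1) * pact r x (pact r x' f) w)"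
      unfolding hom_base[OF r] linop_scale[OF linop_pact] by (intro cas_cong) (simp add: linop_minus[OF linop_pact] linop_scale[OF linop_pact])
    also have "\<dots> = (-1) ^ (r + 1) * cas_op n r f w" unfolding cas_op_def by (rule cas_scale)
    finally show ?thesis using r by simp
  qed
  { case Nil thus ?case using base[of "[]"] by simp }
  case (Cons y w)
  show ?case
  proof (cases "r \<le> length w")
    case False
    thus ?thesis using Cons.prems base[of "y # w"] by simp
  next
    case True
    let ?s = "(-1::real) ^ (length w + 1)"
    have a: "del r (\<lambda>v. homot n r f (y # v)) w = del r (homot n r (\<lambda>v. f (y # v))) w"
    proof (cases "length w = r")
      case False
      show ?thesis by (rule del_cong) (use False True in \<open>auto simp: hom_Cons\<close>)
    qed simp
    have 1: "del r (homot n r f) (y # w) = del r (homot n r (\<lambda>v. f (y # v))) w + ?s * lie r y (homot n r f) w"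
      using True a by simp
    have "homot n r (del r f) (y # w) = homot n r (\<lambda>v. del r (\<lambda>v. f (y # v)) v + (- ?s) * lie r y f v) w"
      unfolding hom_Cons[OF True] by (rule hom_cong) (use True in auto)
    hence 2: "homot n r (del r f) (y # w) = homot n r (del r (\<lambda>v. f (y # v))) w - ?s * homot n r (lie r y f) w"
      by (simp only: linop_add[OF linop_hom] linop_scale[OF linop_hom])
    have "lie r y (homot n r f) w = homot n r (lie r y f) w"
      by (rule lie_hom) (use True Cons.prems in auto)
    moreover have "del r (homot n r (\<lambda>v. f (y # v))) w + homot n r (del r (\<lambda>v. f (y # v))) w
      = (-1) ^ (r + 1) * cas_op n r (\<lambda>v. f (y # v)) w"
      by (rule Cons.IH) (use True Cons.prems in \<open>auto simp: vanL_Cons\<close>)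
    ultimately show ?thesis unfolding 1 2 Omg_Cons[OF True] by simp
  qed
qed

text \<open>Because of \<open>j \<le> r\<close>, translations act by zero on every slot that
  \<open>cas_op n j\<close> touches; for quadratic letters the Casimir element is invariant.\<close>

lemma lie_Omg:
  assumes "j \<le> length w" "j \<le> r" "y \<in> ltrs n"
  shows "lie r y (cas_op n j f) w = cas_op n j (lie r y f) w"
  using assms
proof (induction w arbitrary: f)
  have base: "lie r y (cas_op n j f) w = cas_op n j (lie r y f) w"
    if j: "length w = j" "j \<le> r" and y: "y \<in> ltrs n" for w f
  proof (cases y)
    case (Lin c)
    have "cas_op n j (lie r y f) w = cas_op n j (\<lambda>v. 0) w"
      by (rule Omg_cong) (use j in \<open>simp add: Lin lie_Lin_short\<close>)
    thus ?thesis using j by (simp add: Lin lie_Lin_short linop_zero[OF linop_Omg])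
  next
    case (Quad c d)
    have cd: "c \<in> coords n" "d \<in> coords n" using y Quad by auto
    have "lie r y (cas_op n j f) w = pact j y (\<lambda>v. casimir n (\<lambda>x x'. pact j x (pact j x' f) v)) w"
      using j by (subst lie_eq_pact[of _ j]) (auto simp: Quad cas_op_def intro!: pact_cong)
    also have "\<dots> = casimir n (\<lambda>x x'. pact j y (pact j x (pact j x' f)) w)"
      by (rule linop_cas[OF linop_pact])
    finally have 1: "lie r y (cas_op n j f) w = casimir n (\<lambda>x x'. pact j y (pact j x (pact j x' f)) w)" .
    have 2: "cas_op n j (lie r y f) w = cas_op n j (pact j y f) w"
      by (rule Omg_cong) (use j in \<open>auto simp: Quad intro!: lie_eq_pact\<close>)
    have 3: "pact j x (pact j x' (pact j y f)) w = pact j x (pact j y (pact j x' f)) w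
       + brk x' y (\<lambda>z. pact j x (pact j z f) w)" for x x'
    proof -
      have "pact j x (pact j x' (pact j y f)) w
        = pact j x (\<lambda>v. pact j y (pact j x' f) v + brk x' y (\<lambda>z. pact j z f v)) w"
        by (rule pact_cong) (use pact_commutator[of j x' y f] in \<open>simp add: algebra_simps\<close>)
      thus ?thesis by (simp add: linop_add[OF linop_pact] linop_bre[OF linop_pact])
    qed
    have "cas_op n j (lie r y f) w - lie r y (cas_op n j f) w
      = casimir n (\<lambda>x x'. brk x y (\<lambda>z. pact j z (pact j x' f) w) + brk x' y (\<lambda>z. pact j x (pact j z f) w))"
      unfolding 1 2 unfolding cas_op_def 3 cas_diff[symmetric] pact_commutator[symmetric] by (rule cas_cong) simp
    also have "\<dots> = 0" unfolding Quad by (rule cas_invariant[OF cd])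
    finally show ?thesis by simp
  qed
  { case Nil thus ?case using base[of "[]"] by simp }
  case (Cons z w)
  show ?case
  proof (cases "j \<le> length w")
    case False
    thus ?thesis using Cons.prems base[of "z # w"] by simp
  next
    case True
    let ?b = "\<lambda>F. if r \<le> length w \<or> isQ y then brk z y F else 0"
    have "lie r y (cas_op n j f) (z # w) = lie r y (\<lambda>v. cas_op n j f (z # v)) w + ?b (\<lambda>z'. cas_op n j f (z' # w))"
      by (simp add: lie_Cons)
    also have "lie r y (\<lambda>v. cas_op n j f (z # v)) w = lie r y (cas_op n j (\<lambda>v. f (z # v))) w"
      by (rule lie_cong) (use True in \<open>simp add: Omg_Cons\<close>)
    also have "\<dots> = cas_op n j (lie r y (\<lambda>v. f (z # v))) w"
      using Cons True by auto
    finally have 1: "lie r y (cas_op n j f) (z # w) = cas_op n j (lie r y (\<lambda>v. f (z # v))) w + ?b (\<lambda>z'. cas_op n j (\<lambda>v. f (z' # v)) w)"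
      using True by (simp add: Omg_Cons)
    have "cas_op n j (lie r y f) (z # w) = cas_op n j (\<lambda>v. lie r y f (z # v)) w"
      using True by (rule Omg_Cons)
    also have "\<dots> = cas_op n j (\<lambda>v. lie r y (\<lambda>v. f (z # v)) v + ?b (\<lambda>z'. f (z' # v))) w"
      by (rule Omg_cong) (auto simp: lie_Cons)
    finally show ?thesis using 1
      by (simp add: linop_add[OF linop_Omg] linop_bre[OF linop_Omg] linop_zero[OF linop_Omg])
  qed
qed

lemma del_Omg:
  assumes "j \<le> r" "set w \<subseteq> ltrs n"
  shows "del r (cas_op n j f) w = cas_op n j (del r f) w"
  using assms(2)
proof (induction w arbitrary: f)
  case Nil
  show ?case by (simp add: cas_op_def cas_zero)
next
  case (Cons y w)
  show ?case
  proof (cases "r \<le> length w")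
    case False
    have "cas_op n j (del r f) (y # w) = cas_op n j (\<lambda>v. 0) (y # w)"
      by (rule Omg_cong) (use False in auto)
    thus ?thesis using False by (simp add: linop_zero[OF linop_Omg])
  next
    case True
    let ?s = "(-1::real) ^ (length w + 1)"
    have a: "del r (\<lambda>v. cas_op n j f (y # v)) w = del r (cas_op n j (\<lambda>v. f (y # v))) w"
    proof (cases "length w = r")
      case False
      show ?thesis by (rule del_cong) (use False True assms(1) in \<open>auto simp: Omg_Cons\<close>)
    qed simp
    have 1: "del r (cas_op n j f) (y # w) = del r (cas_op n j (\<lambda>v. f (y # v))) w + ?s * lie r y (cas_op n j f) w"
      using True a by simp
    have jw: "j \<le> length w" using True assms(1) by simp
    have "cas_op n j (del r f) (y # w) = cas_op n j (\<lambda>v. del r (\<lambda>v. f (y # v)) v + ?s * lie r y f v) w"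
      unfolding Omg_Cons[OF jw] by (rule Omg_cong) (use True in auto)
    hence 2: "cas_op n j (del r f) (y # w) = cas_op n j (del r (\<lambda>v. f (y # v))) w + ?s * cas_op n j (lie r y f) w"
      by (simp only: linop_add[OF linop_Omg] linop_scale[OF linop_Omg])
    show ?thesis unfolding 1 2 using Cons lie_Omg[OF jw assms(1), of y n f] by simp
  qed
qed

section \<open>Decomposition along the Casimir operator\<close>

definition words :: "nat \<Rightarrow> nat \<Rightarrow> ltr list set" where
  "words n m = {w. length w = m \<and> set w \<subseteq> ltrs n}"

lemma finite_words [simp]: "finite (words n m)"
  using finite_lists_length_eq[OF finite_ltrs, of n m] by (simp add: words_def conj_commute)

lemma sum_words_Suc: "(\<Sum>w\<in>words n (Suc m). F w) = (\<Sum>y\<in>ltrs n. \<Sum>w\<in>words n m. F (y # w))"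
proof -
  have "words n (Suc m) = (\<lambda>p. fst p # snd p) ` (ltrs n \<times> words n m)"
    by (auto simp: words_def length_Suc_conv image_iff)
  moreover have "inj_on (\<lambda>p. fst p # snd p) (ltrs n \<times> words n m)"
    by (auto simp: inj_on_def)
  ultimately show ?thesis
    by (simp add: sum.reindex sum.cartesian_product comp_def split_def)
qed

lemma sum_ltrs: "(\<Sum>y\<in>ltrs n. F y) = (\<Sum>c\<in>coords n. F (Lin c)) + (\<Sum>c\<in>coords n. \<Sum>d\<in>coords n. F (Quad c d))"
proof -
  have "(\<Sum>y\<in>ltrs n. F y) = (\<Sum>y\<in>Lin ` coords n. F y) + (\<Sum>y\<in>(\<lambda>(a, b). Quad a b) ` (coords n \<times> coords n). F y)"
    unfolding ltrs_def by (rule sum.union_disjoint) auto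
  also have "\<dots> = (\<Sum>c\<in>coords n. F (Lin c)) + (\<Sum>c\<in>coords n. \<Sum>d\<in>coords n. F (Quad c d))"
    by (subst (1 2) sum.reindex) (auto simp: inj_on_def sum.cartesian_product case_prod_beta comp_def)
  finally show ?thesis .
qed

lemma sum_om3: "b \<in> coords n \<Longrightarrow> (\<Sum>c\<in>coords n. om b c * X c) = sg b * X (dual b)"
proof -
  assume d: "b \<in> coords n"
  have "(\<Sum>c\<in>coords n. om b c * X c) = (\<Sum>c\<in>coords n. if c = dual b then sg b * X (dual b) else 0)"
    by (rule sum.cong) (auto simp: om_def)
  thus ?thesis using d by simp
qed

lemma om_adjoint:
  assumes a: "a \<in> coords n" and b: "b \<in> coords n"
  shows "(\<Sum>c\<in>coords n. (om b c * F a + om a c * F b) * G c)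
    = - (sg a * sg b) * (\<Sum>c\<in>coords n. F c * (om (dual b) c * G (dual a) + om (dual a) c * G (dual b)))"
proof -
  have "(\<Sum>c\<in>coords n. (om b c * F a + om a c * F b) * G c)
     = (\<Sum>c\<in>coords n. om b c * (F a * G c)) + (\<Sum>c\<in>coords n. om a c * (F b * G c))"
    by (simp add: sum.distrib[symmetric] algebra_simps)
  moreover have "(\<Sum>c\<in>coords n. F c * (om (dual b) c * G (dual a) + om (dual a) c * G (dual b)))
     = (\<Sum>c\<in>coords n. om (dual b) c * (F c * G (dual a))) + (\<Sum>c\<in>coords n. om (dual a) c * (F c * G (dual b)))"
    by (simp add: sum.distrib[symmetric] algebra_simps)
  ultimately show ?thesis using a b
    by (simp add: sum_om3) (simp add: algebra_simps)
qed

text \<open>With the letters as an orthonormal basis, the quadratic letters are closed under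
  transposition up to sign; this is the form in which splitness enters. Ordered pairs spare the
  weights that diagonal letters would need in a basis of unordered pairs.\<close>

lemma bre_adjoint:
  assumes ab: "a \<in> coords n" "b \<in> coords n"
  shows "(\<Sum>y\<in>ltrs n. brk y (Quad a b) F * G y)
    = - (sg a * sg b) * (\<Sum>y\<in>ltrs n. F y * brk y (Quad (dual a) (dual b)) G)"
proof -
  let ?k = "- (sg a * sg b)"
  let ?A = "\<lambda>F G. \<Sum>c\<in>coords n. (om b c * F a + om a c * F b) * G c"
  let ?B = "\<lambda>F G. \<Sum>c\<in>coords n. F c * (om (dual b) c * G (dual a) + om (dual a) c * G (dual b))"
  have AB: "?A F G = ?k * ?B F G" for F G :: "crd \<Rightarrow> real" using om_adjoint[OF ab] .
  have A1: "?A (\<lambda>c. F (Quad c d)) (\<lambda>c. G (Quad c d)) = ?k * ?B (\<lambda>c. F (Quad c d)) (\<lambda>c. G (Quad c d))" for d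
    by (rule AB)
  have A2: "?A (\<lambda>d. F (Quad c d)) (\<lambda>d. G (Quad c d)) = ?k * ?B (\<lambda>d. F (Quad c d)) (\<lambda>d. G (Quad c d))" for c
    by (rule AB)
  have X: "(\<Sum>d\<in>coords n. ?k * P d) + (\<Sum>c\<in>coords n. ?k * R c) = ?k * ((\<Sum>d\<in>coords n. P d) + (\<Sum>c\<in>coords n. R c))"
    for P R :: "crd \<Rightarrow> real" by (simp only: sum_distrib_left distrib_left)
  have "(\<Sum>c\<in>coords n. \<Sum>d\<in>coords n. brk (Quad c d) (Quad a b) F * G (Quad c d))
    = (\<Sum>d\<in>coords n. ?A (\<lambda>c. F (Quad c d)) (\<lambda>c. G (Quad c d)))
      + (\<Sum>c\<in>coords n. ?A (\<lambda>d. F (Quad c d)) (\<lambda>d. G (Quad c d)))"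
    by (subst sum.swap) (simp add: sum.distrib[symmetric] algebra_simps)
  also have "\<dots> = ?k * ((\<Sum>d\<in>coords n. ?B (\<lambda>c. F (Quad c d)) (\<lambda>c. G (Quad c d)))
      + (\<Sum>c\<in>coords n. ?B (\<lambda>d. F (Quad c d)) (\<lambda>d. G (Quad c d))))"
    unfolding A1 A2 by (rule X)
  also have "(\<Sum>d\<in>coords n. ?B (\<lambda>c. F (Quad c d)) (\<lambda>c. G (Quad c d)))
      + (\<Sum>c\<in>coords n. ?B (\<lambda>d. F (Quad c d)) (\<lambda>d. G (Quad c d)))
    = (\<Sum>c\<in>coords n. \<Sum>d\<in>coords n. F (Quad c d) * brk (Quad c d) (Quad (dual a) (dual b)) G)"
    by (subst sum.swap) (simp add: sum.distrib[symmetric] algebra_simps)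
  finally show ?thesis unfolding sum_ltrs
    using AB[of "\<lambda>c. F (Lin c)" "\<lambda>c. G (Lin c)"] by (simp add: distrib_left)
qed

lemma pact_adjoint:
  assumes ab: "a \<in> coords n" "b \<in> coords n"
  shows "(\<Sum>w\<in>words n m. pact r (Quad a b) f w * g w)
    = - (sg a * sg b) * (\<Sum>w\<in>words n m. f w * pact r (Quad (dual a) (dual b)) g w)"
proof (induction m arbitrary: f g)
  case 0
  have "words n 0 = {[]}" by (auto simp: words_def)
  thus ?case by simp
next
  case (Suc m)
  let ?k = "- (sg a * sg b)" and ?x = "Quad a b" and ?x' = "Quad (dual a) (dual b)"
  have sw: "(\<Sum>y\<in>ltrs n. \<Sum>w\<in>words n m. if m < r then F y w else 0)
     = (\<Sum>w\<in>words n m. if m < r then (\<Sum>y\<in>ltrs n. F y w) else 0)" for F :: "ltr \<Rightarrow> ltr list \<Rightarrow> real"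
    by (subst sum.swap) (auto intro!: sum.cong)
  have 1: "(\<Sum>w\<in>words n (Suc m). pact r ?x f w * g w)
    = (\<Sum>y\<in>ltrs n. \<Sum>w\<in>words n m. pact r ?x (\<lambda>v. f (y # v)) w * g (y # w))
     + (\<Sum>w\<in>words n m. if m < r then (\<Sum>y\<in>ltrs n. brk y ?x (\<lambda>z. f (z # w)) * g (y # w)) else 0)"
    unfolding sum_words_Suc sw[symmetric] sum.distrib[symmetric]
    by (intro sum.cong refl) (simp add: pact_Cons words_def algebra_simps)
  have 2: "(\<Sum>w\<in>words n (Suc m). f w * pact r ?x' g w)
    = (\<Sum>y\<in>ltrs n. \<Sum>w\<in>words n m. f (y # w) * pact r ?x' (\<lambda>v. g (y # v)) w)
     + (\<Sum>w\<in>words n m. if m < r then (\<Sum>y\<in>ltrs n. f (y # w) * brk y ?x' (\<lambda>z. g (z # w))) else 0)"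
    unfolding sum_words_Suc sw[symmetric] sum.distrib[symmetric]
    by (intro sum.cong refl) (simp add: pact_Cons words_def algebra_simps)
  have 3: "(\<Sum>w\<in>words n m. if m < r then (\<Sum>y\<in>ltrs n. brk y ?x (\<lambda>z. f (z # w)) * g (y # w)) else 0)
    = ?k * (\<Sum>w\<in>words n m. if m < r then (\<Sum>y\<in>ltrs n. f (y # w) * brk y ?x' (\<lambda>z. g (z # w))) else 0)"
    unfolding bre_adjoint[OF ab] sum_distrib_left by (intro sum.cong refl) (auto simp: sum_distrib_left sum_negf)
  show ?case unfolding 1 2 Suc 3 by (simp only: sum_distrib_left distrib_left)
qed

text \<open>The signs of the transposes cancel those in the Casimir element, which leaves a
  symmetric, negative semidefinite form. The final reindexing by \<open>dual\<close> only replaces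
  each letter by its partner.\<close>

lemma Omg_form:
  "(\<Sum>w\<in>words n m. cas_op n r f w * g w)
    = - (\<Sum>a\<in>coords n. \<Sum>b\<in>coords n. \<Sum>w\<in>words n m. pact r (Quad a b) f w * pact r (Quad a b) g w)"
proof -
  have "(\<Sum>w\<in>words n m. cas_op n r f w * g w)
    = (\<Sum>w\<in>words n m. \<Sum>a\<in>coords n. \<Sum>b\<in>coords n. sg a * sg b * (pact r (Quad a b) (pact r (Quad (dual a) (dual b)) f) w * g w))"
    by (simp add: cas_op_def casimir_def sum_distrib_right mult.assoc)
  also have "\<dots> = (\<Sum>a\<in>coords n. \<Sum>b\<in>coords n. \<Sum>w\<in>words n m. sg a * sg b * (pact r (Quad a b) (pact r (Quad (dual a) (dual b)) f) w * g w))"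
    by (subst sum.swap) (intro sum.cong refl sum.swap)
  also have "\<dots> = (\<Sum>a\<in>coords n. \<Sum>b\<in>coords n. - (\<Sum>w\<in>words n m. pact r (Quad (dual a) (dual b)) f w * pact r (Quad (dual a) (dual b)) g w))"
  proof (intro sum.cong refl)
    fix a b assume ab: "a \<in> coords n" "b \<in> coords n"
    have "(sg a * sg b) * (sg a * sg b) = (sg a * sg a) * (sg b * sg b)" by (simp only: ac_simps)
    hence sq: "(sg a * sg b) * (sg a * sg b) = 1" by simp
    show "(\<Sum>w\<in>words n m. sg a * sg b * (pact r (Quad a b) (pact r (Quad (dual a) (dual b)) f) w * g w))
      = - (\<Sum>w\<in>words n m. pact r (Quad (dual a) (dual b)) f w * pact r (Quad (dual a) (dual b)) g w)"
      unfolding sum_distrib_left[symmetric] pact_adjoint[OF ab] using sq by (simp flip: mult.assoc)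
  qed
  also have "\<dots> = (\<Sum>a\<in>coords n. \<Sum>b\<in>coords n. - (\<Sum>w\<in>words n m. pact r (Quad a b) f w * pact r (Quad a b) g w))"
  proof -
    have b: "bij_betw dual (coords n) (coords n)"
      by (rule bij_betw_byWitness[of _ dual]) auto
    show ?thesis
      by (subst sum.reindex_bij_betw[OF b, of "\<lambda>a. \<Sum>b\<in>coords n. - (\<Sum>w\<in>words n m. pact r (Quad a (dual b)) f w * pact r (Quad a (dual b)) g w)"])
         (intro sum.cong refl sum.reindex_bij_betw[OF b])
  qed
  finally show ?thesis by (simp add: sum_negf)
qed

section \<open>Orthogonal splitting of finite-dimensional spaces of cochains\<close>

definition subsp :: "('a \<Rightarrow> real) set \<Rightarrow> bool" where
  "subsp U \<longleftrightarrow> (\<lambda>_. 0) \<in> U \<and> (\<forall>f\<in>U. \<forall>g\<in>U. \<forall>a b. (\<lambda>w. a * f w + b * g w) \<in> U)"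

lemma subsp_zero: "subsp U \<Longrightarrow> (\<lambda>_. 0) \<in> U"
  and subsp_comb: "subsp U \<Longrightarrow> f \<in> U \<Longrightarrow> g \<in> U \<Longrightarrow> (\<lambda>w. a * f w + b * g w) \<in> U"
  by (auto simp: subsp_def)

lemma subsp_diff: "subsp U \<Longrightarrow> f \<in> U \<Longrightarrow> g \<in> U \<Longrightarrow> (\<lambda>w. f w - g w) \<in> U"
  using subsp_comb[of U f g 1 "-1"] by simp

text \<open>Induction on the coordinates: requiring a zero at the new coordinate \<open>s\<close>
  lowers the dimension of the subspace by at most one, and one Gram-Schmidt vector makes up for
  it.\<close>

lemma orthogonal_projection:
  assumes "finite W" "subsp U" "\<And>u w. u \<in> U \<Longrightarrow> w \<notin> W \<Longrightarrow> u w = 0"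
  shows "\<exists>u\<in>U. \<forall>v\<in>U. (\<Sum>w\<in>W. (f w - u w) * v w) = 0"
  using assms
proof (induction W arbitrary: U f rule: finite_induct)
  case empty
  thus ?case by (auto dest: subsp_zero)
next
  case (insert s W)
  define U' where "U' = {u \<in> U. u s = 0}"
  have U': "subsp U'" using insert.prems(1) by (auto simp: U'_def subsp_def)
  have "\<exists>u\<in>U'. \<forall>v\<in>U'. (\<Sum>w\<in>W. (f w - u w) * v w) = 0" for f
  proof (rule insert.IH[OF U'])
    fix u w assume "u \<in> U'" "w \<notin> W"
    thus "u w = 0" using insert.prems(2)[of u w] by (cases "w = s") (auto simp: U'_def)
  qed
  hence P: "\<exists>u\<in>U'. \<forall>v\<in>U'. (\<Sum>w\<in>insert s W. (f w - u w) * v w) = 0" for f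
    using insert.hyps by (auto simp: U'_def)
  show ?case
  proof (cases "U' = U")
    case True
    thus ?thesis using P by simp
  next
    case False
    then obtain k where k: "k \<in> U" "k s \<noteq> 0" by (auto simp: U'_def)
    obtain u0 where u0: "u0 \<in> U'" "\<And>v. v \<in> U' \<Longrightarrow> (\<Sum>w\<in>insert s W. (k w - u0 w) * v w) = 0"
      using P[of k] by auto
    obtain u1 where u1: "u1 \<in> U'" "\<And>v. v \<in> U' \<Longrightarrow> (\<Sum>w\<in>insert s W. (f w - u1 w) * v w) = 0"
      using P[of f] by auto
    \<comment> \<open>The component of \<open>k\<close> orthogonal to \<open>U'\<close>. It is still
      nonzero at \<open>s\<close>, because \<open>u0\<close> vanishes there, so every
      \<open>v\<close> in \<open>U\<close> is a multiple of \<open>e\<close> plus an element of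
      \<open>U'\<close>.\<close>
    define e where "e = (\<lambda>w. k w - u0 w)"
    have eU: "e \<in> U" using k u0 subsp_diff[OF insert.prems(1)] by (auto simp: e_def U'_def)
    have es: "e s \<noteq> 0" using k u0 by (auto simp: e_def U'_def)
    let ?ip = "\<lambda>f g. \<Sum>w\<in>insert s W. f w * g w"
    have ee: "?ip e e > 0"
      using insert.hyps es by (subst sum.insert) (auto intro!: add_pos_nonneg sum_nonneg simp: zero_less_mult_iff)
    define c where "c = ?ip (\<lambda>w. f w - u1 w) e / ?ip e e"
    define u where "u = (\<lambda>w. 1 * u1 w + c * e w)"
    have "u1 \<in> U" using u1(1) by (simp add: U'_def)
    hence uU: "u \<in> U" unfolding u_def by (rule subsp_comb[OF insert.prems(1) _ eU])
    have "?ip (\<lambda>w. f w - u w) v = 0" if v: "v \<in> U" for v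
    proof -
      obtain t where t: "t * e s = v s" using es by (metis nonzero_eq_divide_eq)
      define v' where "v' = (\<lambda>w. 1 * v w + (- t) * e w)"
      have "v' \<in> U" unfolding v'_def by (rule subsp_comb[OF insert.prems(1) v eU])
      hence v': "v' \<in> U'" using t by (simp add: U'_def v'_def)
      have "?ip (\<lambda>w. f w - u w) v' = ?ip (\<lambda>w. f w - u1 w) v' - c * ?ip e v'"
        by (simp add: u_def algebra_simps sum_subtractf sum.distrib sum_distrib_left)
      hence 1: "?ip (\<lambda>w. f w - u w) v' = 0" using u0(2)[OF v'] u1(2)[OF v'] by (simp add: e_def)
      have "?ip (\<lambda>w. f w - u w) e = ?ip (\<lambda>w. f w - u1 w) e - c * ?ip e e"
        by (simp add: u_def algebra_simps sum_subtractf sum.distrib sum_distrib_left)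
      hence 2: "?ip (\<lambda>w. f w - u w) e = 0" using ee by (simp add: c_def)
      have "?ip (\<lambda>w. f w - u w) v = ?ip (\<lambda>w. f w - u w) v' + t * ?ip (\<lambda>w. f w - u w) e"
        unfolding sum_distrib_left sum.distrib[symmetric] by (intro sum.cong refl) (simp add: v'_def algebra_simps)
      thus ?thesis using 1 2 by simp
    qed
    thus ?thesis using uU by blast
  qed
qed

definition supp_words :: "nat \<Rightarrow> nat \<Rightarrow> (ltr list \<Rightarrow> real) \<Rightarrow> bool" where
  "supp_words n m f \<longleftrightarrow> (\<forall>w. w \<notin> words n m \<longrightarrow> f w = 0)"

text \<open>The projection of \<open>f\<close> to the image of \<open>K\<close> under the Casimir
  operator leaves a remainder orthogonal to that image. Stability of \<open>K\<close> under the
  Casimir operator alone is assumed, so that \<open>K\<close> can be a space of cocycles with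
  prescribed zeros.\<close>

lemma Omg_decomposition:
  assumes K: "subsp K" "\<And>f. f \<in> K \<Longrightarrow> supp_words n m f" "\<And>f. f \<in> K \<Longrightarrow> cas_op n r f \<in> K" and f: "f \<in> K"
  obtains g where "g \<in> K" "(\<lambda>w. f w - cas_op n r g w) \<in> K"
    "\<And>a b w. a \<in> coords n \<Longrightarrow> b \<in> coords n \<Longrightarrow> w \<in> words n m \<Longrightarrow> pact r (Quad a b) (\<lambda>w. f w - cas_op n r g w) w = 0"
proof -
  let ?U = "cas_op n r ` K"
  have "subsp ?U"
    unfolding subsp_def
  proof (intro conjI ballI allI)
    show "(\<lambda>_. 0) \<in> ?U"
      by (rule image_eqI[OF _ subsp_zero[OF K(1)]]) (simp add: linop_zero[OF linop_Omg] fun_eq_iff)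
    fix f g a b assume "f \<in> ?U" "g \<in> ?U"
    then obtain f' g' where "f' \<in> K" "f = cas_op n r f'" "g' \<in> K" "g = cas_op n r g'" by auto
    moreover have "(\<lambda>w. a * cas_op n r f' w + b * cas_op n r g' w) = cas_op n r (\<lambda>w. a * f' w + b * g' w)"
      by (rule ext) (simp only: linop_add[OF linop_Omg] linop_scale[OF linop_Omg])
    ultimately show "(\<lambda>w. a * f w + b * g w) \<in> ?U"
      using subsp_comb[OF K(1), of f' g' a b] by auto
  qed
  moreover have "u w = 0" if "u \<in> ?U" "w \<notin> words n m" for u w
    using that K(2,3) by (auto simp: supp_words_def)
  ultimately obtain u where u: "u \<in> ?U" "\<And>v. v \<in> ?U \<Longrightarrow> (\<Sum>w\<in>words n m. (f w - u w) * v w) = 0"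
    using orthogonal_projection[of "words n m" ?U f] finite_words[of n m] by blast
  then obtain g where g: "g \<in> K" "u = cas_op n r g" by auto
  define f0 where "f0 = (\<lambda>w. f w - cas_op n r g w)"
  have f0: "f0 \<in> K" unfolding f0_def using subsp_diff[OF K(1) f K(3)[OF g(1)]] .
  let ?s = "\<lambda>a b. \<Sum>w\<in>words n m. pact r (Quad a b) f0 w * pact r (Quad a b) f0 w"
  \<comment> \<open>The remainder \<open>f0\<close> lies in \<open>K\<close>, so its own Casimir
    image is among the vectors it is orthogonal to. By \<open>Omg_form\<close> a sum of squares
    vanishes, and with it every single action on \<open>f0\<close>.\<close>
  have "(\<Sum>w\<in>words n m. cas_op n r f0 w * f0 w) = 0"
    using u(2)[of "cas_op n r f0"] f0 g by (simp add: f0_def mult.commute)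
  hence "(\<Sum>a\<in>coords n. \<Sum>b\<in>coords n. ?s a b) = 0" unfolding Omg_form by simp
  hence "\<forall>a\<in>coords n. (\<Sum>b\<in>coords n. ?s a b) = 0"
    by (subst (asm) sum_nonneg_eq_0_iff) (auto intro!: sum_nonneg)
  hence "\<forall>a\<in>coords n. \<forall>b\<in>coords n. ?s a b = 0"
    by (subst (asm) sum_nonneg_eq_0_iff) (auto intro!: sum_nonneg)
  hence "\<forall>a\<in>coords n. \<forall>b\<in>coords n. \<forall>w\<in>words n m. pact r (Quad a b) f0 w = 0"
    by (subst (asm) sum_nonneg_eq_0_iff) auto
  thus ?thesis using that[OF g(1)] f0 by (simp add: f0_def)
qed

text \<open>A symmetric operator has the same kernel as its square.\<close>

lemma Omg_Omg_zero:
  assumes "\<And>w. w \<in> words n m \<Longrightarrow> cas_op n r (cas_op n r f) w = 0" "w \<in> words n m"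
  shows "cas_op n r f w = 0"
proof -
  have "(\<Sum>w\<in>words n m. cas_op n r f w * cas_op n r f w) = (\<Sum>w\<in>words n m. cas_op n r (cas_op n r f) w * f w)"
    unfolding Omg_form[of n r f] Omg_form[of n r "cas_op n r f"] by (simp add: mult.commute)
  also have "\<dots> = 0" using assms(1) by simp
  finally show ?thesis using assms(2) by (subst (asm) sum_nonneg_eq_0_iff) auto
qed

section \<open>Supports\<close>

text \<open>\<open>reach y x z\<close>: the letter \<open>z\<close> may occur in the bracket of \<open>y\<close> and \<open>x\<close>.\<close>
definition reach :: "ltr \<Rightarrow> ltr \<Rightarrow> ltr \<Rightarrow> bool" where
  "reach y x z \<longleftrightarrow> isQ z = (isQ y \<and> isQ x) \<and> (isQ y \<or> isQ x)
     \<and> (\<forall>n. x \<in> ltrs n \<longrightarrow> (z \<in> ltrs n \<longleftrightarrow> y \<in> ltrs n))"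

lemma om_neq_0: "om a b \<noteq> 0 \<Longrightarrow> b = dual a"
  by (auto simp: om_def split: if_splits)

lemma bre_witness:
  assumes "brk y x F \<noteq> 0"
  shows "\<exists>z. reach y x z \<and> F z \<noteq> 0"
proof (cases x)
  case (Lin c)
  show ?thesis
  proof (cases y)
    case (Quad a b)
    from assms have "om b c \<noteq> 0 \<and> F (Lin a) \<noteq> 0 \<or> om a c \<noteq> 0 \<and> F (Lin b) \<noteq> 0"
      unfolding Lin Quad by auto
    then consider "c = dual b" "F (Lin a) \<noteq> 0" | "c = dual a" "F (Lin b) \<noteq> 0"
      by (auto dest!: om_neq_0)
    thus ?thesis unfolding Lin Quad
    proof cases
      case 1 thus "\<exists>z. reach (Quad a b) (Lin c) z \<and> F z \<noteq> 0" by (intro exI[of _ "Lin a"]) (simp add: reach_def)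
    next
      case 2 thus "\<exists>z. reach (Quad a b) (Lin c) z \<and> F z \<noteq> 0" by (intro exI[of _ "Lin b"]) (simp add: reach_def)
    qed
  qed (use assms Lin in auto)
next
  case (Quad a b)
  show ?thesis
  proof (cases y)
    case (Lin c)
    from assms have "om b c \<noteq> 0 \<and> F (Lin a) \<noteq> 0 \<or> om a c \<noteq> 0 \<and> F (Lin b) \<noteq> 0"
      unfolding Lin Quad by auto
    then consider "c = dual b" "F (Lin a) \<noteq> 0" | "c = dual a" "F (Lin b) \<noteq> 0"
      by (auto dest!: om_neq_0)
    thus ?thesis unfolding Lin Quad
    proof cases
      case 1 thus "\<exists>z. reach (Lin c) (Quad a b) z \<and> F z \<noteq> 0" by (intro exI[of _ "Lin a"]) (simp add: reach_def)
    next
      case 2 thus "\<exists>z. reach (Lin c) (Quad a b) z \<and> F z \<noteq> 0" by (intro exI[of _ "Lin b"]) (simp add: reach_def)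
    qed
  next
    case Q: (Quad c d)
    from assms have "om b c \<noteq> 0 \<and> F (Quad a d) \<noteq> 0 \<or> om a c \<noteq> 0 \<and> F (Quad b d) \<noteq> 0
       \<or> om b d \<noteq> 0 \<and> F (Quad c a) \<noteq> 0 \<or> om a d \<noteq> 0 \<and> F (Quad c b) \<noteq> 0"
      unfolding Q Quad by auto
    then consider "c = dual b" "F (Quad a d) \<noteq> 0" | "c = dual a" "F (Quad b d) \<noteq> 0"
       | "d = dual b" "F (Quad c a) \<noteq> 0" | "d = dual a" "F (Quad c b) \<noteq> 0"
      by (auto dest!: om_neq_0)
    thus ?thesis unfolding Q Quad
    proof cases
      case 1 thus "\<exists>z. reach (Quad c d) (Quad a b) z \<and> F z \<noteq> 0" by (intro exI[of _ "Quad a d"]) (simp add: reach_def)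
    next
      case 2 thus "\<exists>z. reach (Quad c d) (Quad a b) z \<and> F z \<noteq> 0" by (intro exI[of _ "Quad b d"]) (simp add: reach_def)
    next
      case 3 thus "\<exists>z. reach (Quad c d) (Quad a b) z \<and> F z \<noteq> 0" by (intro exI[of _ "Quad c a"]) (simp add: reach_def)
    next
      case 4 thus "\<exists>z. reach (Quad c d) (Quad a b) z \<and> F z \<noteq> 0" by (intro exI[of _ "Quad c b"]) (simp add: reach_def)
    qed
  qed
qed

text \<open>Statements on supports are proved by contraposition: a nonzero value comes with a slot,
  a letter in it, and a replacement at which \<open>f\<close> is nonzero. Finite supports, slot
  kinds and the grading are all read off from such witnesses.\<close>

lemma act_witness:
  "act sel x f w \<noteq> 0 \<Longrightarrow> \<exists>u y v z. w = u @ y # v \<and> sel (length v) x \<and> reach y x z \<and> f (u @ z # v) \<noteq> 0"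
proof (induction w arbitrary: f)
  case (Cons y w)
  consider "act sel x (\<lambda>v. f (y # v)) w \<noteq> 0" | "sel (length w) x" "brk y x (\<lambda>z. f (z # w)) \<noteq> 0"
    using Cons.prems by (cases "act sel x (\<lambda>v. f (y # v)) w = 0") (auto split: if_splits)
  thus ?case
  proof cases
    case 1
    then obtain u y' v z where "w = u @ y' # v" "sel (length v) x" "reach y' x z" "f (y # u @ z # v) \<noteq> 0"
      using Cons.IH by blast
    thus ?thesis by (intro exI[of _ "y # u"] exI[of _ y'] exI[of _ v] exI[of _ z]) simp
  next
    case 2
    then obtain z where "reach y x z" "f (z # w) \<noteq> 0" using bre_witness by blast
    thus ?thesis using 2 by (intro exI[of _ "[]"]) auto
  qed
qed simp

lemma del_witness:
  "del r f w \<noteq> 0 \<Longrightarrow> \<exists>u x s y t z. w = u @ x # s @ y # t \<and> r \<le> length (s @ y # t) \<and>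
      (r \<le> length t \<or> isQ x) \<and> reach y x z \<and> f (u @ s @ z # t) \<noteq> 0"
proof (induction w arbitrary: f)
  case (Cons x w)
  from Cons.prems have r: "r \<le> length w" by (auto split: if_splits)
  from Cons.prems consider "del r (\<lambda>v. f (x # v)) w \<noteq> 0" | "lie r x f w \<noteq> 0"
    by (cases "lie r x f w = 0") (auto split: if_splits)
  thus ?case
  proof cases
    case 1
    then obtain u x' s y t z where *: "w = u @ x' # s @ y # t" "r \<le> length (s @ y # t)"
      "r \<le> length t \<or> isQ x'" "reach y x' z" "f (x # u @ s @ z # t) \<noteq> 0"
      using Cons.IH by blast
    show ?thesis
      by (rule exI[of _ "x # u"], intro exI[of _ x'] exI[of _ s] exI[of _ y] exI[of _ t] exI[of _ z]) (use * in simp)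
  next
    case 2
    then obtain s y t z where *: "w = s @ y # t" "r \<le> length t \<or> isQ x" "reach y x z" "f (s @ z # t) \<noteq> 0"
      unfolding lie_def using act_witness by blast
    show ?thesis
      by (rule exI[of _ "[]"], intro exI[of _ x] exI[of _ s] exI[of _ y] exI[of _ t] exI[of _ z]) (use * r in simp)
  qed
qed simp

lemma ins_witness: "ins r x f w \<noteq> 0 \<Longrightarrow> \<exists>u v. w = u @ v \<and> f (u @ x # v) \<noteq> 0"
proof (induction w arbitrary: f)
  case (Cons y w)
  show ?case
  proof (cases "r \<le> length w")
    case True
    then obtain u v where "w = u @ v" "f (y # u @ x # v) \<noteq> 0"
      using Cons.IH[of "\<lambda>v. f (y # v)"] Cons.prems by auto
    thus ?thesis by (intro exI[of _ "y # u"] exI[of _ v]) auto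
  next
    case False
    hence "y # w = [] @ (y # w) \<and> f ([] @ x # (y # w)) \<noteq> 0" using Cons.prems by simp
    thus ?thesis by blast
  qed
qed simp

lemma act_words:
  assumes "\<And>v. v \<in> words n m \<Longrightarrow> f v = 0" "x \<in> ltrs n" "w \<in> words n m"
  shows "act sel x f w = 0"
proof (rule ccontr)
  assume "act sel x f w \<noteq> 0"
  then obtain u y v z where "w = u @ y # v" "reach y x z" "f (u @ z # v) \<noteq> 0"
    using act_witness by blast
  moreover from this have "u @ z # v \<in> words n m" using assms(2,3) by (auto simp: words_def reach_def)
  ultimately show False using assms(1) by blast
qed

lemma act_supp:
  assumes "supp_words n m f" "x \<in> ltrs n"
  shows "supp_words n m (act sel x f)"
  unfolding supp_words_def
proof (intro allI impI, rule ccontr)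
  fix w assume "act sel x f w \<noteq> 0" "w \<notin> words n m"
  then obtain u y v z where "w = u @ y # v" "reach y x z" "f (u @ z # v) \<noteq> 0"
    using act_witness by blast
  moreover from this have "u @ z # v \<in> words n m" using assms by (auto simp: supp_words_def)
  ultimately show False using assms(2) \<open>w \<notin> words n m\<close> by (auto simp: words_def reach_def)
qed

lemma del_words:
  assumes "\<And>v. v \<in> words n m \<Longrightarrow> f v = 0" "w \<in> words n (Suc m)"
  shows "del r f w = 0"
proof (rule ccontr)
  assume "del r f w \<noteq> 0"
  then obtain u x s y t z where "w = u @ x # s @ y # t" "reach y x z" "f (u @ s @ z # t) \<noteq> 0"
    using del_witness by blast
  moreover from this have "u @ s @ z # t \<in> words n m" using assms(2) by (auto simp: words_def reach_def)
  ultimately show False using assms(1) by blast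
qed

lemma del_words_cong:
  assumes "\<And>v. v \<in> words n m \<Longrightarrow> f v = g v" "w \<in> words n (Suc m)"
  shows "del r f w = del r g w"
  using del_words[of n m "\<lambda>v. f v - g v" w r] assms by (simp add: linop_diff[OF linop_del])

lemma cas_zeroI:
  "(\<And>a b. a \<in> coords n \<Longrightarrow> b \<in> coords n \<Longrightarrow> G (Quad a b) (Quad (dual a) (dual b)) = 0) \<Longrightarrow> casimir n G = 0"
  by (simp add: casimir_def)

lemma hom_words:
  assumes "\<And>v. v \<in> words n (Suc m) \<Longrightarrow> f v = 0" "w \<in> words n m"
  shows "homot n r f w = 0"
  unfolding homot_def
proof (rule cas_zeroI)
  fix a b assume ab: "a \<in> coords n" "b \<in> coords n"
  have "ins r (Quad (dual a) (dual b)) f v = 0" if v: "v \<in> words n m" for v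
  proof (rule ccontr)
    assume "ins r (Quad (dual a) (dual b)) f v \<noteq> 0"
    then obtain u t where "v = u @ t" "f (u @ Quad (dual a) (dual b) # t) \<noteq> 0" using ins_witness by blast
    moreover from this have "u @ Quad (dual a) (dual b) # t \<in> words n (Suc m)"
      using v ab by (auto simp: words_def)
    ultimately show False using assms(1) by blast
  qed
  thus "pact r (Quad a b) (ins r (Quad (dual a) (dual b)) f) w = 0"
    unfolding pact_def by (rule act_words[OF _ _ assms(2)]) (use ab in auto)
qed

lemma Omg_words:
  assumes "\<And>v. v \<in> words n m \<Longrightarrow> f v = 0" "w \<in> words n m"
  shows "cas_op n r f w = 0"
  unfolding cas_op_def pact_def by (intro cas_zeroI act_words) (use assms in auto)

lemma Omg_supp: "supp_words n m f \<Longrightarrow> supp_words n m (cas_op n r f)"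
proof -
  assume f: "supp_words n m f"
  have "supp_words n m (pact r (Quad a b) (pact r (Quad (dual a) (dual b)) f))"
    if "a \<in> coords n" "b \<in> coords n" for a b
    unfolding pact_def by (intro act_supp f) (use that in auto)
  thus ?thesis unfolding cas_op_def supp_words_def by (auto intro!: cas_zeroI)
qed

section \<open>Cochains symmetric in the entries of quadratic letters\<close>

definition symQ :: "(ltr list \<Rightarrow> real) \<Rightarrow> bool" where
  "symQ f \<longleftrightarrow> (\<forall>u a b v. f (u @ Quad a b # v) = f (u @ Quad b a # v))"

lemma symQD: "symQ f \<Longrightarrow> f (u @ Quad a b # v) = f (u @ Quad b a # v)"
  by (simp add: symQ_def)

lemma symQ_Cons: "symQ f \<Longrightarrow> symQ (\<lambda>v. f (y # v))"
  unfolding symQ_def by (metis append_Cons)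

lemma symQ_head: "symQ f \<Longrightarrow> f (Quad a b # v) = f (Quad b a # v)"
  using symQD[of f "[]"] by simp

lemma bre_swap_left: "(\<And>a b. F (Quad a b) = F (Quad b a)) \<Longrightarrow> brk (Quad a b) x F = brk (Quad b a) x F"
proof -
  assume F: "\<And>a b. F (Quad a b) = F (Quad b a)"
  show ?thesis
  proof (cases x)
    case (Quad c d)
    show ?thesis unfolding Quad
      using F[of c b] F[of d b] F[of a c] F[of a d] by simp
  qed auto
qed

lemma bre_swap_right: "brk y (Quad a b) F = brk y (Quad b a) F"
  by (cases y) auto

lemma act_swap: "sel = (\<lambda>i x. T i \<or> U i \<and> isQ x) \<Longrightarrow> act sel (Quad a b) f w = act sel (Quad b a) f w"
  by (induction w arbitrary: f) (auto simp: bre_swap_right[of _ a b])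

lemma lie_swap: "lie r (Quad a b) f w = lie r (Quad b a) f w"
  unfolding lie_def by (rule act_swap[where T = "\<lambda>i. r \<le> i" and U = "\<lambda>_. True"]) auto

lemma symQ_act: "symQ f \<Longrightarrow> symQ (act sel x f)"
  unfolding symQ_def[of "act sel x f"]
proof (intro allI)
  fix u a b v
  show "symQ f \<Longrightarrow> act sel x f (u @ Quad a b # v) = act sel x f (u @ Quad b a # v)"
  proof (induction u arbitrary: f)
    case Nil
    have "(\<lambda>v. f (Quad a b # v)) = (\<lambda>v. f (Quad b a # v))" using symQ_head[OF Nil] by blast
    moreover have "brk (Quad a b) x (\<lambda>z. f (z # v)) = brk (Quad b a) x (\<lambda>z. f (z # v))"
      by (rule bre_swap_left) (rule symQ_head[OF Nil])
    ultimately show ?case by simp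
  next
    case (Cons y u)
    have "brk y x (\<lambda>z. f (z # u @ Quad a b # v)) = brk y x (\<lambda>z. f (z # u @ Quad b a # v))"
      by (rule bre_cong) (use symQD[OF Cons.prems, of "_ # u"] in simp)
    thus ?case using Cons.IH[OF symQ_Cons[OF Cons.prems]] by simp
  qed
qed

lemma symQ_pact: "symQ f \<Longrightarrow> symQ (pact r x f)" and symQ_lie: "symQ f \<Longrightarrow> symQ (lie r x f)"
  by (simp_all add: pact_def lie_def symQ_act)

lemma symQ_del: "symQ f \<Longrightarrow> symQ (del r f)"
  unfolding symQ_def[of "del r f"]
proof (intro allI)
  fix u a b v
  show "symQ f \<Longrightarrow> del r f (u @ Quad a b # v) = del r f (u @ Quad b a # v)"
  proof (induction u arbitrary: f)
    case Nil
    have "(\<lambda>v. f (Quad a b # v)) = (\<lambda>v. f (Quad b a # v))" using symQ_head[OF Nil] by blast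
    thus ?case using lie_swap by simp
  next
    case (Cons y u)
    have "lie r y f (u @ Quad a b # v) = lie r y f (u @ Quad b a # v)"
      by (rule symQD[OF symQ_lie[OF Cons.prems]])
    thus ?case using Cons.IH[OF symQ_Cons[OF Cons.prems]] by simp
  qed
qed

lemma symQ_ins: "symQ f \<Longrightarrow> symQ (ins r x f)"
  unfolding symQ_def[of "ins r x f"]
proof (intro allI)
  fix u a b v
  show "symQ f \<Longrightarrow> ins r x f (u @ Quad a b # v) = ins r x f (u @ Quad b a # v)"
  proof (induction u arbitrary: f)
    case Nil
    have "(\<lambda>v. f (Quad a b # v)) = (\<lambda>v. f (Quad b a # v))" using symQ_head[OF Nil] by blast
    thus ?case using symQD[OF Nil, of "[x]" a b v] by simp
  next
    case (Cons y u)
    thus ?case using Cons.IH[OF symQ_Cons[OF Cons.prems]] symQD[OF Cons.prems, of "x # y # u"] by simp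
  qed
qed

lemma symQ_cas: "(\<And>x x'. symQ (F x x')) \<Longrightarrow> symQ (\<lambda>w. casimir n (\<lambda>x x'. F x x' w))"
  unfolding symQ_def by (auto intro!: cas_cong)

lemma symQ_hom: "symQ f \<Longrightarrow> symQ (homot n r f)"
proof -
  have "homot n r f = (\<lambda>w. casimir n (\<lambda>x x'. pact r x (ins r x' f) w))" by (intro ext) (simp add: homot_def)
  thus "symQ f \<Longrightarrow> symQ (homot n r f)" by (simp add: symQ_cas symQ_pact symQ_ins)
qed

lemma symQ_Omg: "symQ f \<Longrightarrow> symQ (cas_op n r f)"
proof -
  have "cas_op n r f = (\<lambda>w. casimir n (\<lambda>x x'. pact r x (pact r x' f) w))" by (intro ext) (simp add: cas_op_def)
  thus "symQ f \<Longrightarrow> symQ (cas_op n r f)" by (simp add: symQ_cas symQ_pact)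
qed

lemma symQ_comb: "symQ f \<Longrightarrow> symQ g \<Longrightarrow> symQ (\<lambda>w. a * f w + b * g w)"
  by (auto simp: symQ_def)

section \<open>Turning slot \<open>r\<close> into a coefficient slot\<close>

definition kindL :: "nat \<Rightarrow> ltr list \<Rightarrow> bool" where
  "kindL r w \<longleftrightarrow> r < length w \<and> \<not> isQ (rev w ! r)"

lemma kindL_replace: "(length v = r \<Longrightarrow> isQ y = isQ z) \<Longrightarrow> kindL r (u @ y # v) = kindL r (u @ z # v)"
  by (auto simp: kindL_def nth_append nth_Cons')

lemma kindL_delete: "r < length v \<Longrightarrow> kindL r (u @ x # v) = kindL r (u @ v)"
  by (auto simp: kindL_def nth_append)

lemma vanL_kindL: "vanL r f \<longleftrightarrow> (\<forall>w. kindL r w \<longrightarrow> f w = 0)"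
proof
  assume f: "vanL r f"
  show "\<forall>w. kindL r w \<longrightarrow> f w = 0"
  proof (intro allI impI)
    fix w assume w: "kindL r w"
    define u where "u = take (length w - Suc r) w"
    define v where "v = drop (length w - r) w"
    have "w = u @ w ! (length w - Suc r) # v" using w unfolding u_def v_def kindL_def
      by (metis Suc_diff_Suc append_take_drop_id Cons_nth_drop_Suc diff_less zero_less_Suc order_le_less_trans zero_le)
    moreover have "rev w ! r = w ! (length w - Suc r)" using w by (simp add: kindL_def rev_nth)
    moreover have "\<not> isQ (rev w ! r)" "length v = r" using w by (auto simp: kindL_def v_def)
    ultimately obtain a where "w = u @ Lin a # v" by (metis isQ.elims(3))
    thus "f w = 0" using f \<open>length v = r\<close> by (simp add: vanL_def)
  qed
qed (auto simp: vanL_def kindL_def nth_append)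

lemma vanL_pact: "vanL r f \<Longrightarrow> vanL r (pact r x f)"
  unfolding vanL_kindL
proof (intro allI impI, rule ccontr)
  fix w assume f: "\<forall>w. kindL r w \<longrightarrow> f w = 0" and w: "kindL r w" and "pact r x f w \<noteq> 0"
  then obtain u y v z where "w = u @ y # v" "length v < r" "f (u @ z # v) \<noteq> 0"
    unfolding pact_def using act_witness by blast
  moreover from this have "kindL r (u @ z # v)" using w kindL_replace[of v r y z u] by auto
  ultimately show False using f by blast
qed

lemma vanL_Omg: "vanL r f \<Longrightarrow> vanL r (cas_op n r f)"
  using vanL_pact[OF vanL_pact] unfolding vanL_def cas_op_def by (auto intro!: cas_zeroI)

text \<open>In \<open>D(r + 1)\<close> only quadratic letters act on slot \<open>r\<close>, and they
  preserve its kind; removed letters lie behind it. So the complex splits according to the kind of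
  slot \<open>r\<close>.\<close>

lemma del_Suc_kind:
  assumes "\<And>v. kindL r v = kindL r w \<Longrightarrow> f v = 0"
  shows "del (Suc r) f w = 0"
proof (rule ccontr)
  assume "del (Suc r) f w \<noteq> 0"
  then obtain u x s y t z where *: "w = u @ x # s @ y # t" "Suc r \<le> length (s @ y # t)"
      "Suc r \<le> length t \<or> isQ x" "reach y x z" "f (u @ s @ z # t) \<noteq> 0"
    using del_witness by blast
  have "kindL r (u @ s @ z # t) = kindL r ((u @ s) @ y # t)"
    using * kindL_replace[of t r z y "u @ s"] by (auto simp: reach_def)
  also have "\<dots> = kindL r w" using * kindL_delete[of r "s @ y # t" u x] by simp
  finally show False using assms * by blast
qed

lemma del_Suc_restrict:
  "del (Suc r) (\<lambda>v. if kindL r v = k then f v else 0) w = (if kindL r w = k then del (Suc r) f w else 0)"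
proof (cases "kindL r w = k")
  case True
  have "del (Suc r) (\<lambda>v. (if kindL r v = k then f v else 0) - f v) w = 0"
    by (rule del_Suc_kind) (use True in auto)
  thus ?thesis using True by (simp add: linop_diff[OF linop_del])
next
  case False
  have "del (Suc r) (\<lambda>v. if kindL r v = k then f v else 0) w = 0"
    by (rule del_Suc_kind) (use False in auto)
  thus ?thesis using False by simp
qed

lemma lie_Suc_Lin: "length v = r \<Longrightarrow> lie r x f (u @ Lin a # v) = lie (Suc r) x f (u @ Lin a # v)"
proof (induction u arbitrary: f)
  case Nil
  have "lie r x (\<lambda>w. f (Lin a # w)) v = lie (Suc r) x (\<lambda>w. f (Lin a # w)) v"
    by (cases x) (use Nil in \<open>auto simp: lie_Lin_short lie_eq_pact[of v r]\<close>)
  thus ?case using Nil by (cases x) (auto simp: lie_Cons)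
next
  case (Cons y u)
  thus ?case by (simp add: lie_Cons)
qed

text \<open>The coboundaries differ in translations acting on slot \<open>r\<close> and in the
  removal of slot \<open>r\<close>. If the slot holds a translation, the former vanishes because
  translations commute, the latter because translations act by zero on the slots below
  \<open>r\<close>.\<close>

lemma del_Suc_Lin: "length v = r \<Longrightarrow> del r f (u @ Lin a # v) = del (Suc r) f (u @ Lin a # v)"
proof (induction u arbitrary: f)
  case Nil
  thus ?case by (simp add: lie_Lin_short)
next
  case (Cons y u)
  thus ?case by (simp add: lie_Suc_Lin)
qed

lemma del_Suc_kindL: "kindL r w \<Longrightarrow> del r f w = del (Suc r) f w"
proof -
  assume w: "kindL r w"
  have "vanL r (\<lambda>w. del r f w - del (Suc r) f w)"
    unfolding vanL_def using del_Suc_Lin[of _ r f] by simp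
  thus ?thesis using w unfolding vanL_kindL by simp
qed

lemma lie_Suc_vanL: "vanL r f \<Longrightarrow> lie r x f w = lie (Suc r) x f w"
proof (induction w arbitrary: f)
  case (Cons y w)
  have "brk y x (\<lambda>z. f (z # w)) = 0" if "length w = r" "\<not> isQ x"
  proof -
    have "f (Lin a # w) = 0" for a using Cons.prems that unfolding vanL_def by (metis append_Nil)
    thus ?thesis using that by (cases x; cases y) auto
  qed
  moreover have "lie r x (\<lambda>v. f (y # v)) w = lie (Suc r) x (\<lambda>v. f (y # v)) w"
    by (rule Cons.IH) (rule vanL_Cons[OF Cons.prems])
  ultimately show ?case by (auto simp: lie_Cons le_Suc_eq not_less_eq_eq)
qed simp

text \<open>Translations acting on slot \<open>r\<close> put a translation there, where
  \<open>f\<close> vanishes. What is left is the removal of a quadratic letter from slot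
  \<open>r\<close>, an action on the coefficients, and \<open>f\<close> is invariant under
  it.\<close>

lemma del_Suc_vanL:
  assumes "vanL r f" "w \<in> words n (Suc m)"
    "\<And>a b v. a \<in> coords n \<Longrightarrow> b \<in> coords n \<Longrightarrow> v \<in> words n m \<Longrightarrow> pact r (Quad a b) f v = 0"
  shows "del r f w = del (Suc r) f w"
  using assms
proof (induction w arbitrary: f m)
  case (Cons y w)
  have yw: "y \<in> ltrs n" "w \<in> words n m" using Cons.prems(2) by (auto simp: words_def)
  consider "length w < r" | "length w = r" | "Suc r \<le> length w" by linarith
  thus ?case
  proof cases
    case 2
    have "lie r y f w = 0"
    proof (cases y)
      case (Lin a)
      thus ?thesis using 2 by (simp add: lie_Lin_short)
    next
      case (Quad a b)
      thus ?thesis using 2 yw Cons.prems(3)[of a b w] by (simp add: lie_eq_pact[of w r])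
    qed
    thus ?thesis using 2 by simp
  next
    case 3
    then obtain m' where m': "m = Suc m'" using yw by (cases m) (auto simp: words_def)
    have "del r (\<lambda>v. f (y # v)) w = del (Suc r) (\<lambda>v. f (y # v)) w"
    proof (rule Cons.IH[of _ m'])
      fix a b v assume *: "a \<in> coords n" "b \<in> coords n" "v \<in> words n m'"
      hence "y # v \<in> words n m" using yw m' by (auto simp: words_def)
      hence "pact r (Quad a b) f (y # v) = 0" using * Cons.prems(3) by blast
      moreover have "r \<le> length v" using * 3 yw m' by (auto simp: words_def)
      ultimately show "pact r (Quad a b) (\<lambda>v. f (y # v)) v = 0" by (simp add: pact_Cons)
    qed (use Cons.prems yw m' in \<open>auto intro: vanL_Cons\<close>)
    thus ?thesis using 3 lie_Suc_vanL[OF Cons.prems(1)] by simp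
  qed simp
qed simp

section \<open>The grading by the number of quadratic letters\<close>

primrec num_quad :: "nat \<Rightarrow> ltr list \<Rightarrow> nat" where
  "num_quad r [] = 0"
| "num_quad r (y # w) = num_quad r w + (if r \<le> length w \<and> isQ y then 1 else 0)"

lemma cnt_append: "r \<le> length v \<Longrightarrow> num_quad r (u @ v) = length (filter isQ u) + num_quad r v"
  by (induction u) auto

lemma cnt_replace: "isQ y = isQ z \<Longrightarrow> num_quad r (u @ y # v) = num_quad r (u @ z # v)"
  by (induction u) auto

lemma cnt_short: "length w \<le> r \<Longrightarrow> num_quad r w = 0"
  by (induction w) auto

text \<open>Removing a quadratic letter preserves the kind of the letter it acts on; removing a
  translation turns a quadratic letter into a translation. Either way exactly one quadratic letter
  is lost, so \<open>D(r)\<close> splits by degree minus this count.\<close>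

lemma del_cnt_witness:
  assumes "del r f w \<noteq> 0" "w \<in> words n (Suc m)"
  shows "\<exists>v. v \<in> words n m \<and> num_quad r w = Suc (num_quad r v) \<and> f v \<noteq> 0"
proof -
  obtain u x s y t z where *: "w = u @ x # s @ y # t" "r \<le> length (s @ y # t)"
      "r \<le> length t \<or> isQ x" "reach y x z" "f (u @ s @ z # t) \<noteq> 0"
    using del_witness[OF assms(1)] by blast
  have r: "r \<le> length (s @ z # t)" using * by simp
  have "num_quad r (s @ y # t) + (if isQ x then 1 else 0) = Suc (num_quad r (s @ z # t))"
  proof (cases "isQ x")
    case True
    thus ?thesis using * cnt_replace[of y z r s t] by (auto simp: reach_def)
  next
    case False
    thus ?thesis using * by (auto simp: reach_def cnt_append)
  qed
  hence "num_quad r w = Suc (num_quad r (u @ s @ z # t))"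
    using * cnt_append[OF r, of u] cnt_append[of r "x # s @ y # t" u] by (auto split: if_splits)
  moreover have "u @ s @ z # t \<in> words n m" using * assms(2) by (auto simp: words_def reach_def)
  ultimately show ?thesis using * by blast
qed

section \<open>Invariant theory of the symplectic algebra\<close>

definition altC :: "crd set \<Rightarrow> nat \<Rightarrow> (crd list \<Rightarrow> real) \<Rightarrow> bool" where
  "altC C p h \<longleftrightarrow> (\<forall>u y z s. set (u @ y # z # s) \<subseteq> C \<longrightarrow> length (u @ y # z # s) = p
      \<longrightarrow> h (u @ y # z # s) = - h (u @ z # y # s))"

lemma altCD: "altC C p h \<Longrightarrow> set (u @ y # z # s) \<subseteq> C \<Longrightarrow> length (u @ y # z # s) = p
  \<Longrightarrow> h (u @ y # z # s) = - h (u @ z # y # s)"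
  unfolding altC_def by blast

lemma altC_Cons:
  assumes h: "altC C (Suc p) h" and y: "y \<in> C"
  shows "altC C p (\<lambda>w. h (y # w))"
  unfolding altC_def
proof (intro allI impI)
  fix u x z s
  assume "set (u @ x # z # s) \<subseteq> C" "length (u @ x # z # s) = p"
  thus "h (y # u @ x # z # s) = - h (y # u @ z # x # s)"
    using altCD[OF h, of "y # u" x z s] y by simp
qed

text \<open>Only exchanges behind a prefix shorter than \<open>k\<close> are available, because the
  lemma is also applied inside an induction on \<open>k\<close>. They suffice to bring the second
  copy of \<open>y\<close> next to the first.\<close>

lemma alternating_repeat:
  assumes A: "\<And>u y z s. length u < k \<Longrightarrow> set (u @ y # z # s) \<subseteq> C \<Longrightarrow> length (u @ y # z # s) = p
      \<Longrightarrow> h (u @ y # z # s) = - h (u @ z # y # s)"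
    and "length t1 + length t2 < k" "set (t1 @ y # t2 @ y # t3) \<subseteq> C" "length (t1 @ y # t2 @ y # t3) = p"
  shows "h (t1 @ y # t2 @ y # t3) = (0 :: real)"
  using assms(2-)
proof (induction t2 arbitrary: t3 rule: rev_induct)
  case Nil
  thus ?case using A[of t1 y y t3] by simp
next
  case (snoc e t2)
  have "h ((t1 @ y # t2) @ e # y # t3) = - h ((t1 @ y # t2) @ y # e # t3)"
    by (rule A) (use snoc.prems in auto)
  moreover have "h (t1 @ y # t2 @ y # e # t3) = 0"
    by (rule snoc.IH) (use snoc.prems in auto)
  ultimately show ?case by simp
qed

lemma altC_not_distinct:
  assumes "altC C p h" "set w \<subseteq> C" "length w = p" "\<not> distinct w"
  shows "h w = 0"
proof -
  obtain t1 t2 t3 y where w: "w = t1 @ y # t2 @ y # t3" using not_distinct_decomp[OF assms(4)] by auto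
  show ?thesis unfolding w
  proof (rule alternating_repeat[where k = p and C = C and p = p])
    show "h (u @ y # z # s) = - h (u @ z # y # s)"
      if "set (u @ y # z # s) \<subseteq> C" "length (u @ y # z # s) = p" for u y z s
      using that by (rule altCD[OF assms(1)])
  qed (use assms(2,3) w in auto)
qed

definition omt :: "crd \<Rightarrow> crd \<Rightarrow> crd \<Rightarrow> (crd \<Rightarrow> real) \<Rightarrow> real" where
  "omt c d e F = om d e * F c + om c e * F d"

text \<open>The terms of the coboundary in which a letter \<open>e\<close> of the word is removed
  and acts on the letter \<open>Quad c d\<close> that follows the word.\<close>
primrec removal :: "crd \<Rightarrow> crd \<Rightarrow> (crd list \<Rightarrow> crd \<Rightarrow> real) \<Rightarrow> crd list \<Rightarrow> real" where
  "removal c d H [] = 0"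
| "removal c d H (e # t) = removal c d (\<lambda>u. H (e # u)) t + (-1) ^ length t * omt c d e (H t)"

lemma rel_add: "removal c d (\<lambda>u a. H u a + G u a) t = removal c d H t + removal c d G t"
  by (induction t arbitrary: H G) (auto simp: omt_def algebra_simps)

lemma rel_snoc: "removal c d H (t @ [v]) = omt c d v (H t) - removal c d (\<lambda>u. H (u @ [v])) t"
  by (induction t arbitrary: H) (auto simp: algebra_simps)

lemma rel_zero: "(\<And>u e v. t = u @ e # v \<Longrightarrow> omt c d e (H (u @ v)) = 0) \<Longrightarrow> removal c d H t = 0"
proof (induction t arbitrary: H)
  case (Cons e t)
  have "omt c d e (H t) = 0" using Cons.prems[of "[]" e t] by simp
  moreover have "removal c d (\<lambda>u. H (e # u)) t = 0"
    by (rule Cons.IH) (use Cons.prems[of "e # _"] in simp)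
  ultimately show ?case by simp
qed simp

text \<open>Induction on the prefix \<open>u\<close>, with \<open>P\<close> the symmetrisation in
  the two letters behind it. The prefix is lengthened by one letter chosen so that only one term of
  the relation survives; if no choice works, both letters already occur in \<open>u\<close>, and the
  repetition makes the values vanish.\<close>

lemma alternating_from_rel:
  assumes C: "\<And>c. dual c \<in> C \<longleftrightarrow> c \<in> C"
    and removal: "\<And>t v s c d. set (t @ v # s) \<subseteq> C \<Longrightarrow> c \<in> C \<Longrightarrow> d \<in> C \<Longrightarrow> length (t @ v # s) = p
      \<Longrightarrow> removal c d (\<lambda>u a. h (u @ a # v # s) + h (u @ v # a # s)) t = 0"
  shows "altC C p h"
proof -
  have "h (u @ y # z # s) = - h (u @ z # y # s)"
    if "set (u @ y # z # s) \<subseteq> C" "length (u @ y # z # s) = p" for u y z s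
    using that
  proof (induction "length u" arbitrary: u y z s rule: less_induct)
    case less
    define k where "k = length u"
    define P where "P = (\<lambda>u a b. h (u @ a # b # s) + h (u @ b # a # s))"
    have Psym: "P u a b = P u b a" for u a b by (simp add: P_def)
    have sC: "set s \<subseteq> C" and len: "length s + k + 2 = p" using less.prems by (auto simp: k_def)
    have rep: "h (t1 @ y # t2 @ y # t3) = 0"
      if "length t1 + length t2 < k" "set (t1 @ y # t2 @ y # t3) \<subseteq> C" "length (t1 @ y # t2 @ y # t3) = p" for t1 t2 t3 y
    proof (rule alternating_repeat[where k = k and C = C and p = p])
      show "h (u @ y # z # s) = - h (u @ z # y # s)"
        if "length u < k" "set (u @ y # z # s) \<subseteq> C" "length (u @ y # z # s) = p" for u y z s
        using that unfolding k_def by (rule less.hyps)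
    qed (use that in auto)
    have rep': "h (u @ y # z # s) = 0"
      if mem: "y \<in> set u" and u: "set u \<subseteq> C" "length u = k" and z: "z \<in> C" for u y z
    proof -
      obtain t1 t2 where "u = t1 @ y # t2" using split_list[OF mem] by auto
      thus ?thesis using rep[of t1 t2 y "z # s"] u z sC len by auto
    qed
    have rep'': "h (u @ y # z # s) = 0"
      if nd: "\<not> distinct u" and u: "set u \<subseteq> C" "length u = k" and yz: "y \<in> C" "z \<in> C" for u y z
    proof -
      obtain t1 t2 t3 x where "u = t1 @ x # t2 @ x # t3" using not_distinct_decomp[OF nd] by auto
      thus ?thesis using rep[of t1 t2 x "t3 @ y # z # s"] u yz sC len by auto
    qed
    have rel': "removal c d (\<lambda>u a. P u a v) (w @ [e]) = 0"
      if "set w \<subseteq> C" "length w = k" "e \<in> C" "v \<in> C" "c \<in> C" "d \<in> C" for w e v c d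
      unfolding P_def by (rule removal) (use that sC len in auto)
    have case1: "P w c v = 0"
      if w: "set w \<subseteq> C" "length w = k" and vc: "v \<in> C" "c \<in> C" and nin: "dual c \<notin> set w" for w c v
    proof -
      \<comment> \<open>\<open>Quad c c\<close> annihilates every letter except
        \<open>dual c\<close>, so only the appended letter contributes, namely
        \<open>2 * sg c * P w c v\<close>.\<close>
      have "removal c c (\<lambda>u a. P (u @ [dual c]) a v) w = 0"
        by (rule rel_zero) (use nin in \<open>auto simp: omt_def om_def\<close>)
      hence "omt c c (dual c) (\<lambda>a. P w a v) = 0"
        using rel'[of w "dual c" v c c] w vc C by (simp add: rel_snoc)
      thus ?thesis by (simp add: omt_def)
    qed
    have case3: "P w c v = 0"
      if w: "set w \<subseteq> C" "length w = k" and vc: "v \<in> C" "c \<in> C"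
        and c': "dual c \<in> set w" and v': "dual v \<in> set w" and nin: "v \<notin> set w" for w c v
    proof -
      let ?d = "dual v"
      \<comment> \<open>The appended letter is now \<open>v\<close> and the quadratic letter is
        \<open>Quad c (dual v)\<close>. A letter of \<open>w\<close> can contribute only through
        \<open>P\<close> at \<open>dual v\<close> and \<open>v\<close>, which vanishes by repetition
        or by the first case.\<close>
      have "removal c ?d (\<lambda>u a. P (u @ [v]) a v) w = 0"
      proof (rule rel_zero)
        fix t1 e t2 assume wt: "w = t1 @ e # t2"
        have ev: "e \<noteq> v" using nin wt by auto
        let ?u = "(t1 @ t2) @ [v]"
        have u: "set ?u \<subseteq> C" "length ?u = k" using w wt vc by auto
        have "P ?u ?d v = 0"
        proof (cases "?d \<in> set ?u")
          case True
          hence "h (?u @ ?d # v # s) = 0" by (rule rep') (use u vc in auto)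
          moreover have "h (?u @ v # ?d # s) = 0" by (rule rep') (use u vc C in auto)
          ultimately show ?thesis by (simp add: P_def)
        next
          case False
          thus ?thesis unfolding Psym[of _ ?d] using case1[of ?u ?d v] u vc C by (subst case1) auto
        qed
        thus "omt c ?d e (\<lambda>a. P (?u) a v) = 0" using ev by (auto simp: omt_def om_def)
      qed
      hence "omt c ?d v (\<lambda>a. P w a v) = 0"
        using rel'[of w v v c ?d] w vc C by (simp add: rel_snoc)
      moreover have "om c v = 0" using c' nin by (auto simp: om_def)
      ultimately show ?thesis by (simp add: omt_def)
    qed
    have "P u y z = 0"
    proof -
      have u: "set u \<subseteq> C" "length u = k" and yz: "y \<in> C" "z \<in> C" using less.prems by (auto simp: k_def)
      consider "dual y \<notin> set u" | "dual z \<notin> set u" | "dual y \<in> set u" "dual z \<in> set u" "z \<notin> set u"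
        | "dual y \<in> set u" "dual z \<in> set u" "y \<notin> set u" | "y \<in> set u" "z \<in> set u" by blast
      thus ?thesis
      proof cases
        case 1 thus ?thesis using case1[OF u] yz by simp
      next
        case 2 thus ?thesis using case1[OF u, of y z] yz by (simp add: Psym[of u y])
      next
        case 3 thus ?thesis using case3[OF u] yz by simp
      next
        case 4 thus ?thesis using case3[OF u, of y z] yz by (simp add: Psym[of u y])
      next
        case 5 thus ?thesis using rep'[of _ u] u yz by (simp add: P_def)
      qed
    qed
    thus ?case by (simp add: P_def)
  qed
  thus ?thesis unfolding altC_def by blast
qed

section \<open>Weights and invariant forms\<close>

primrec cder :: "crd \<Rightarrow> crd \<Rightarrow> (crd list \<Rightarrow> real) \<Rightarrow> crd list \<Rightarrow> real" where
  "cder a b h [] = 0"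
| "cder a b h (y # w) = cder a b (\<lambda>v. h (y # v)) w + omt a b y (\<lambda>z. h (z # w))"

lemma cder_zero:
  "(\<And>u e v. w = u @ e # v \<Longrightarrow> omt a b e (\<lambda>z. h (u @ z # v)) = 0) \<Longrightarrow> cder a b h w = 0"
proof (induction w arbitrary: h)
  case (Cons e w)
  have "omt a b e (\<lambda>z. h (z # w)) = 0" using Cons.prems[of "[]" e w] by simp
  moreover have "cder a b (\<lambda>v. h (e # v)) w = 0"
    by (rule Cons.IH) (use Cons.prems[of "e # _"] in simp)
  ultimately show ?case by simp
qed simp

lemma cder_words_zero:
  assumes "\<And>v. set v \<subseteq> C \<Longrightarrow> length v = length w \<Longrightarrow> h v = 0" "set w \<subseteq> C" "a \<in> C" "b \<in> C"
  shows "cder a b h w = 0"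
  by (rule cder_zero) (use assms in \<open>auto simp: omt_def\<close>)

lemma cder_add: "cder a b (\<lambda>v. f v + g v) w = cder a b f w + cder a b g w"
  by (induction w arbitrary: f g) (auto simp: omt_def algebra_simps)

lemma cder_scale: "cder a b (\<lambda>v. c * f v) w = c * cder a b f w"
  by (induction w arbitrary: f) (auto simp: omt_def algebra_simps)

text \<open>\<open>Quad c (dual c)\<close> lies in the Cartan subalgebra, hence acts diagonally on
  words.\<close>

lemma cder_weight:
  "cder c (dual c) h w = sg c * (real (count_list w (dual c)) - real (count_list w c)) * h w"
proof (induction w arbitrary: h)
  case (Cons y w)
  have "omt c (dual c) y (\<lambda>z. h (z # w)) = (if y = dual c then sg c * h (y # w) else 0) - (if y = c then sg c * h (y # w) else 0)"
    by (auto simp: omt_def om_def)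
  thus ?case unfolding cder.simps Cons.IH
    by (cases "y = c"; cases "y = dual c"; simp add: algebra_simps)
qed simp

lemma count_list_distinct: "distinct w \<Longrightarrow> count_list w c = (if c \<in> set w then 1 else 0)"
  by (induction w) auto

text \<open>A weight argument: under the Cartan element of \<open>a\<close> the letter
  \<open>Quad a a\<close> has weight two, up to the sign \<open>sg a\<close>, and a word without
  repetitions can compensate at most one. So the diagonal values vanish, and the other ones follow
  by polarisation.\<close>

lemma invariant_adjoint_form_zero:
  assumes alt: "\<And>e f. e \<in> coords n \<Longrightarrow> f \<in> coords n \<Longrightarrow> altC (coords n) p (B e f)"
    and sym: "\<And>e f w. B e f w = B f e w"
    and inv: "\<And>a b e f w. a \<in> coords n \<Longrightarrow> b \<in> coords n \<Longrightarrow> e \<in> coords n \<Longrightarrow> f \<in> coords n \<Longrightarrow>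
       set w \<subseteq> coords n \<Longrightarrow> length w = p \<Longrightarrow>
       cder a b (B e f) w + omt a b e (\<lambda>z. B z f w) + omt a b f (\<lambda>z. B e z w) = 0"
    and w: "set w \<subseteq> coords n" "length w = p" and ef: "e \<in> coords n" "f \<in> coords n"
  shows "B e f w = 0"
proof -
  have diag: "B a a w = 0" if a: "a \<in> coords n" and w: "set w \<subseteq> coords n" "length w = p" for a w
  proof (rule ccontr)
    assume nz: "B a a w \<noteq> 0"
    hence "distinct w" using altC_not_distinct[OF alt w] a by blast
    hence "count_list w (dual a) \<le> 1" by (simp add: count_list_distinct)
    moreover have "omt a (dual a) a (\<lambda>z. B z a w) = - sg a * B a a w" "omt a (dual a) a (\<lambda>z. B a z w) = - sg a * B a a w"
      by (simp_all add: omt_def)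
    hence "sg a * (real (count_list w (dual a)) - real (count_list w a) - 2) * B a a w = 0"
      using inv[of a "dual a" a a w] a w by (simp add: cder_weight algebra_simps)
    hence "real (count_list w (dual a)) = real (count_list w a) + 2" using nz by simp
    ultimately show False by linarith
  qed
  let ?a = e and ?b = f
  \<comment> \<open>\<open>Quad f (dual e)\<close> maps \<open>e\<close> to a multiple of
    \<open>f\<close>, plus a multiple of \<open>dual e\<close> only if \<open>f = dual e\<close>; in
    that case the two contributions add up instead of cancelling.\<close>
  have "cder ?b (dual ?a) (B ?a ?a) w = 0"
    by (rule cder_words_zero[where C = "coords n"]) (use diag w ef in auto)
  hence *: "omt ?b (dual ?a) ?a (\<lambda>z. B z ?a w) + omt ?b (dual ?a) ?a (\<lambda>z. B ?a z w) = 0"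
    using inv[of ?b "dual ?a" ?a ?a w] ef w by simp
  have **: "omt ?b (dual ?a) ?a (\<lambda>z. B z ?a w) = omt ?b (dual ?a) ?a (\<lambda>z. B ?a z w)"
    by (simp add: sym)
  have "omt ?b (dual ?a) ?a (\<lambda>z. B ?a z w) = 0" using * ** by simp
  hence "- sg ?a * B ?a ?b w + om ?b ?a * B ?a (dual ?a) w = 0" by (simp add: omt_def)
  moreover have "om ?b ?a * B ?a (dual ?a) w = (if ?b = dual ?a then - sg ?a else 0) * B ?a ?b w"
    by (cases "?b = dual ?a"; auto simp: om_def)
  ultimately show ?thesis by (cases "?b = dual ?a") simp_all
qed

lemma altC_move:
  "altC C p h \<Longrightarrow> set (u @ y # v) \<subseteq> C \<Longrightarrow> length (u @ y # v) = p \<Longrightarrow> h (y # u @ v) = (-1) ^ length u * h (u @ y # v)"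
proof (induction u arbitrary: v rule: rev_induct)
  case (snoc x u)
  have "h (u @ x # y # v) = - h (u @ y # x # v)"
    by (rule altCD[OF snoc.prems(1)]) (use snoc.prems in auto)
  moreover have "h (y # u @ x # v) = (-1) ^ length u * h (u @ y # x # v)"
    by (rule snoc.IH) (use snoc.prems in auto)
  ultimately show ?case by simp
qed simp

text \<open>Absolute values are enough, since the lemma only serves to transport vanishing; this
  avoids signs of permutations.\<close>

lemma altC_perm:
  "altC C p h \<Longrightarrow> set w \<subseteq> C \<Longrightarrow> length w = p \<Longrightarrow> distinct w \<Longrightarrow> distinct w' \<Longrightarrow> set w = set w'
    \<Longrightarrow> \<bar>h w\<bar> = \<bar>h w'\<bar>"
proof (induction w' arbitrary: h w p)
  case (Cons y w')
  then obtain u v where w: "w = u @ y # v" by (metis list.set_intros(1) split_list)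
  have "h (y # u @ v) = (-1) ^ length u * h w" unfolding w by (rule altC_move[OF Cons.prems(1)]) (use Cons.prems w in auto)
  hence *: "\<bar>h w\<bar> = \<bar>h (y # u @ v)\<bar>" by (simp add: abs_mult)
  have y: "y \<in> C" using Cons.prems by auto
  have p: "p = Suc (length (u @ v))" using Cons.prems w by simp
  have "set (u @ v) = set w'" using Cons.prems(4,5,6) w by auto
  hence "\<bar>h (y # u @ v)\<bar> = \<bar>h (y # w')\<bar>"
    using Cons.prems w y p altC_Cons[of C "length (u @ v)" h y] by (intro Cons.IH[of "length (u @ v)" "\<lambda>w. h (y # w)"]) auto
  thus ?case using * by simp
qed simp

primrec prs :: "nat list \<Rightarrow> crd list" where
  "prs [] = []"
| "prs (i # is) = Cx i # Cy i # prs is"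

lemma set_prs: "set (prs is) = Cx ` set is \<union> Cy ` set is"
  by (induction "is") auto

lemma length_prs [simp]: "length (prs is) = 2 * length is"
  by (induction "is") auto

lemma distinct_prs [simp]: "distinct (prs is) \<longleftrightarrow> distinct is"
  by (induction "is") (auto simp: set_prs)

lemma prs_coords: "set is \<subseteq> {1..n} \<Longrightarrow> set (prs is) \<subseteq> coords n"
  by (auto simp: set_prs coords_def)

text \<open>Weight zero forces a word with nonzero value to consist, up to order, of pairs
  \<open>Cx i\<close>, \<open>Cy i\<close>. Invariance allows one pair to be traded for another, so
  a single value decides about all of them.\<close>

lemma invariant_form_unique:
  assumes alt: "altC (coords n) p h"
    and inv: "\<And>a b w. a \<in> coords n \<Longrightarrow> b \<in> coords n \<Longrightarrow> set w \<subseteq> coords n \<Longrightarrow> length w = p \<Longrightarrow> cder a b h w = 0"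
    and zero: "\<And>k. p = 2 * k \<Longrightarrow> k \<le> n \<Longrightarrow> h (prs [1..<Suc k]) = 0"
    and w: "set w \<subseteq> coords n" "length w = p"
  shows "h w = 0"
proof (rule ccontr)
  assume nz: "h w \<noteq> 0"
  hence d: "distinct w" using altC_not_distinct[OF alt w] by blast
  have bal: "dual c \<in> set w \<longleftrightarrow> c \<in> set w" if "c \<in> coords n" for c
    using inv[of c "dual c" w] that w nz by (auto simp: cder_weight count_list_distinct[OF d] split: if_splits)
  define A where "A = {i. Cx i \<in> set w}"
  have "A = Cx -` set w" by (auto simp: A_def)
  hence fA: "finite A" by (simp add: finite_vimageI inj_on_def)
  have An: "A \<subseteq> {1..n}" using w by (auto simp: A_def coords_def)
  define ia where "ia = sorted_list_of_set A"
  have ia: "distinct ia" "set ia = A" using fA by (auto simp: ia_def)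
  have sw: "set w = set (prs ia)"
  proof -
    have "Cy i \<in> set w \<longleftrightarrow> i \<in> A" for i
    proof
      assume "Cy i \<in> set w"
      thus "i \<in> A" using bal[of "Cy i"] w by (auto simp: A_def)
    next
      assume "i \<in> A"
      thus "Cy i \<in> set w" using bal[of "Cx i"] w by (auto simp: A_def)
    qed
    moreover have "Cx i \<in> set w \<longleftrightarrow> i \<in> A" for i by (auto simp: A_def)
    ultimately have "c \<in> set w \<longleftrightarrow> c \<in> set (prs ia)" for c by (cases c) (auto simp: set_prs ia)
    thus ?thesis by blast
  qed
  have perm: "h (prs is) = 0 \<longleftrightarrow> h (prs js) = 0"
    if "distinct is" "distinct js" "set is = set js" "set is \<subseteq> {1..n}" "2 * length is = p" for "is" js
    using altC_perm[OF alt prs_coords, of "is" "prs js"] that by (auto simp: set_prs)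
  have swap: "h (prs (i # is)) = h (prs (j # is))"
    if "i \<noteq> j" "i \<notin> set is" "j \<notin> set is" "set (i # j # is) \<subseteq> {1..n}" "2 * length (i # is) = p" for i j "is"
  proof -
    have c: "Cx j \<in> coords n" "Cy i \<in> coords n" "Cx i \<in> coords n" "Cy j \<in> coords n" using that by (auto simp: coords_def)
    have "set (Cx i # Cy j # prs is) \<subseteq> coords n" using c prs_coords[of "is" n] that by auto
    \<comment> \<open>Applied to the mixed pair \<open>Cx i\<close>, \<open>Cy j\<close>, the letter
      \<open>Quad (Cx j) (Cy i)\<close> yields the pairs of index \<open>j\<close> and of index
      \<open>i\<close> with opposite signs.\<close>
    hence "cder (Cx j) (Cy i) h (Cx i # Cy j # prs is) = 0"
      using c that by (intro inv) auto
    moreover have "cder (Cx j) (Cy i) (\<lambda>v. h (Cx i # Cy j # v)) (prs is) = 0"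
    proof (rule cder_zero)
      fix u e v assume "prs is = u @ e # v"
      hence "e \<in> set (prs is)" by simp
      hence "e \<noteq> Cx i" "e \<noteq> Cy j" using that by (auto simp: set_prs)
      thus "omt (Cx j) (Cy i) e (\<lambda>z. h (Cx i # Cy j # u @ z # v)) = 0" by (auto simp: omt_def om_def)
    qed
    ultimately show ?thesis using that by (simp add: omt_def om_def)
  qed
  have conn: "h (prs is) = 0"
    if "h (prs js) = 0" "distinct is" "distinct js" "set is \<subseteq> {1..n}" "set js \<subseteq> {1..n}"
      "2 * length is = p" "2 * length js = p" for "is" js
    using that
  proof (induction "card (set is - set js)" arbitrary: "is" rule: less_induct)
    case less
    have eqc: "card (set is) = card (set js)" using less.prems by (simp add: distinct_card)
    show ?case
    proof (cases "set is \<subseteq> set js")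
      case True
      hence "set is = set js" using eqc by (simp add: card_subset_eq)
      thus ?thesis using perm[of "is" js] less.prems by simp
    next
      case False
      then obtain i where i: "i \<in> set is" "i \<notin> set js" by auto
      have "\<not> set js \<subseteq> set is" using i eqc by (metis List.finite_set card_subset_eq)
      then obtain j where j: "j \<in> set js" "j \<notin> set is" by auto
      define r where "r = remove1 i is"
      have r: "distinct (i # r)" "set (i # r) = set is" "length (i # r) = length is"
        using i less.prems length_pos_if_in_set[OF i(1)] by (auto simp: r_def length_remove1)
      have jr: "j \<notin> set r" "i \<noteq> j" using r j i by auto
      have "set (j # r) - set js \<subset> set is - set js" using r i j by auto
      hence "card (set (j # r) - set js) < card (set is - set js)" by (simp add: psubset_card_mono)
      hence "h (prs (j # r)) = 0"
        by (rule less.hyps) (use less.prems r j jr in auto)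
      moreover have "h (prs (i # r)) = h (prs (j # r))"
        by (rule swap) (use r jr less.prems j in auto)
      ultimately show ?thesis using perm[of "i # r" "is"] r less.prems by auto
    qed
  qed
  let ?k = "length ia"
  have lw: "length w = 2 * ?k" using d sw distinct_card[OF d] distinct_card[of "prs ia"] ia by simp
  have "?k \<le> n" using card_mono[OF _ An] ia distinct_card[of ia] by simp
  hence "h (prs [1..<Suc ?k]) = 0" using zero[of ?k] lw w by simp
  hence "h (prs ia) = 0"
    by (rule conn) (use ia An lw w \<open>?k \<le> n\<close> in \<open>auto simp del: upt_Suc\<close>)
  moreover have "\<bar>h w\<bar> = \<bar>h (prs ia)\<bar>"
    by (rule altC_perm[OF alt]) (use w d sw ia in auto)
  ultimately show False using nz by simp
qed

section \<open>Acyclicity away from the translations\<close>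

lemma lie_map_Lin: "lie r (Quad a b) f (map Lin w @ s)
    = cder a b (\<lambda>w. f (map Lin w @ s)) w + lie r (Quad a b) (\<lambda>v. f (map Lin w @ v)) s"
  by (induction w arbitrary: f) (auto simp: lie_Cons omt_def)

lemma lie_Lin_cnt0: "num_quad r s = 0 \<Longrightarrow> lie r (Lin e) f s = 0"
proof (induction s arbitrary: f)
  case (Cons y s)
  thus ?case by (cases y) (auto simp: lie_Cons split: if_splits)
qed simp

lemma lie_Lin_word: "num_quad r s = 0 \<Longrightarrow> r \<le> length s \<Longrightarrow>
   lie r (Lin e) f (map Lin t @ Quad c d # s) = - omt c d e (\<lambda>a. f (map Lin t @ Lin a # s))"
  by (induction t arbitrary: f) (auto simp: lie_Cons lie_Lin_cnt0 omt_def)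

lemma del_cnt0: "num_quad r w = 0 \<Longrightarrow> del r f w = 0"
proof (induction w arbitrary: f)
  case (Cons y w)
  thus ?case by (cases y) (auto simp: lie_Lin_cnt0 split: if_splits)
qed simp

text \<open>Either the quadratic letter is removed and acts on \<open>s\<close>, or a translation
  behind it is removed and acts on it. Every other term brackets two translations or lets a
  translation act on a coefficient slot.\<close>

lemma del_word:
  assumes s: "num_quad r s = 0" "r \<le> length s"
  shows "del r f (map Lin t @ Quad c d # s) = (-1) ^ (length s + 1) *
    (lie r (Quad c d) (\<lambda>v. f (map Lin t @ v)) s + removal c d (\<lambda>u a. f (map Lin u @ Lin a # s)) t)"
proof (induction t arbitrary: f)
  case Nil
  show ?case using s by (simp add: del_cnt0)
next
  case (Cons e t)
  have "del r f (map Lin (e # t) @ Quad c d # s) = del r (\<lambda>v. f (Lin e # v)) (map Lin t @ Quad c d # s)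
     + (-1) ^ (length t + length s) * (- omt c d e (\<lambda>a. f (map Lin t @ Lin a # s)))"
    using s lie_Lin_word[OF s, of e f t c d] by simp
  thus ?case unfolding Cons by (simp add: algebra_simps power_add)
qed

lemma pact_append: "r \<le> length v \<Longrightarrow> pact r x f (u @ v) = pact r x (\<lambda>v. f (u @ v)) v"
  by (induction u arbitrary: f) (auto simp: pact_Cons)

lemma cnt0_decomp: "num_quad r w = 0 \<Longrightarrow> r \<le> length w \<Longrightarrow> \<exists>u s. w = map Lin u @ s \<and> length s = r"
proof (induction w)
  case (Cons y w)
  show ?case
  proof (cases "length w < r")
    case True
    thus ?thesis using Cons.prems by (intro exI[of _ "[]"] exI[of _ "y # w"]) auto
  next
    case False
    then obtain u s where us: "w = map Lin u @ s" "length s = r" using Cons by (auto split: if_splits)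
    obtain a where "y = Lin a" using Cons.prems False by (cases y) auto
    thus ?thesis using us by (intro exI[of _ "a # u"] exI[of _ s]) auto
  qed
qed auto

lemma cnt_Lin [simp]: "num_quad r (map Lin u @ s) = num_quad r s"
  by (induction u) auto

text \<open>Evaluate the cocycle condition with \<open>Quad a b\<close> in the last slot: if the
  rest of the word has no quadratic letter from slot \<open>r\<close> on, only the removal of that
  last letter contributes.\<close>

lemma bottom_invariant:
  assumes r: "r \<le> m" and g0: "\<And>w. w \<in> words n m \<Longrightarrow> num_quad r w \<noteq> 0 \<Longrightarrow> g w = 0"
    and cyc: "\<And>w. w \<in> words n (Suc m) \<Longrightarrow> del r g w = 0"
    and ab: "a \<in> coords n" "b \<in> coords n" and w: "w \<in> words n m"
  shows "lie r (Quad a b) g w = 0"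
proof (cases "num_quad r w = 0")
  case True
  have xw: "Quad a b # w \<in> words n (Suc m)" using ab w by (simp add: words_def)
  have "del r (\<lambda>v. g (Quad a b # v)) w = 0" using True by (rule del_cnt0)
  thus ?thesis using cyc[OF xw] r w by (simp add: words_def)
next
  case False
  show ?thesis
  proof (rule ccontr)
    assume "lie r (Quad a b) g w \<noteq> 0"
    then obtain u y v z where *: "w = u @ y # v" "reach y (Quad a b) z" "g (u @ z # v) \<noteq> 0"
      unfolding lie_def using act_witness by blast
    have "num_quad r (u @ z # v) \<noteq> 0" using False * cnt_replace[of y z r u v] by (simp add: reach_def)
    moreover have "u @ z # v \<in> words n m" using w * ab by (auto simp: words_def reach_def)
    ultimately show False using g0 * by blast
  qed
qed

text \<open>Compare the cocycle condition at two words that differ by exchanging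
  \<open>Quad c d\<close> with a neighbouring translation \<open>v\<close>. The terms in which
  \<open>Quad c d\<close> acts cancel, and what remains is the relation asked for by
  \<open>alternating_from_rel\<close>.\<close>

lemma bottom_alternating:
  assumes r: "r \<le> m" and cyc: "\<And>w. w \<in> words n (Suc m) \<Longrightarrow> del r g w = 0"
    and s0: "s0 \<in> words n r"
  shows "altC (coords n) (m - r) (\<lambda>w. g (map Lin w @ s0))"
proof (rule alternating_from_rel)
  fix t v s c d
  assume C: "set (t @ v # s) \<subseteq> coords n" "c \<in> coords n" "d \<in> coords n" "length (t @ v # s) = m - r"
  let ?s = "map Lin s @ s0"
  have cs: "num_quad r ?s = 0" "r \<le> length ?s" using s0 by (auto simp: words_def cnt_short)
  have cs': "num_quad r (Lin v # ?s) = 0" "r \<le> length (Lin v # ?s)" using cs by auto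
  have "map Lin t @ Quad c d # Lin v # ?s \<in> words n (Suc m)"
    using C s0 r by (auto simp: words_def)
  hence "del r g (map Lin t @ Quad c d # Lin v # ?s) = 0" by (rule cyc)
  hence 1: "lie r (Quad c d) (\<lambda>v. g (map Lin t @ v)) (Lin v # ?s) + removal c d (\<lambda>u a. g (map Lin u @ Lin a # Lin v # ?s)) t = 0"
    unfolding del_word[OF cs'] by simp
  have "map Lin (t @ [v]) @ Quad c d # ?s \<in> words n (Suc m)"
    using C s0 r by (auto simp: words_def)
  hence "del r g (map Lin (t @ [v]) @ Quad c d # ?s) = 0" by (rule cyc)
  hence 2: "lie r (Quad c d) (\<lambda>w. g (map Lin (t @ [v]) @ w)) ?s + removal c d (\<lambda>u a. g (map Lin u @ Lin a # ?s)) (t @ [v]) = 0"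
    unfolding del_word[OF cs] by simp
  have "removal c d (\<lambda>u a. g (map Lin u @ Lin a # Lin v # ?s)) t + removal c d (\<lambda>u a. g (map Lin u @ Lin v # Lin a # ?s)) t = 0"
    using 1 2 by (simp add: lie_Cons rel_snoc omt_def)
  thus "removal c d (\<lambda>u a. g (map Lin (u @ a # v # s) @ s0) + g (map Lin (u @ v # a # s) @ s0)) t = 0"
    by (simp add: rel_add)
qed simp

text \<open>Since \<open>g\<close> vanishes if slot \<open>r\<close> is a translation, that slot
  carries an element of \<open>sp_n\<close>. Full invariance minus invariance in the first
  \<open>r\<close> slots leaves an invariant form in slot \<open>r\<close> and the translations
  behind it.\<close>

lemma bottom_zero:
  assumes r: "Suc r \<le> m" and g0: "\<And>w. w \<in> words n m \<Longrightarrow> num_quad (Suc r) w \<noteq> 0 \<Longrightarrow> g w = 0"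
    and cyc: "\<And>w. w \<in> words n (Suc m) \<Longrightarrow> del (Suc r) g w = 0"
    and sym: "symQ g" and van: "vanL r g"
    and pinv: "\<And>a b w. a \<in> coords n \<Longrightarrow> b \<in> coords n \<Longrightarrow> w \<in> words n m \<Longrightarrow> pact r (Quad a b) g w = 0"
    and w: "w \<in> words n m"
  shows "g w = 0"
proof (cases "num_quad (Suc r) w = 0")
  case True
  then obtain u s' where us: "w = map Lin u @ s'" "length s' = Suc r"
    using cnt0_decomp[of "Suc r" w] w r by (auto simp: words_def)
  then obtain y s where s': "s' = y # s" "length s = r" by (cases s') auto
  have u: "set u \<subseteq> coords n" "length u = m - Suc r" and y: "y \<in> ltrs n" and s: "set s \<subseteq> ltrs n"
    using w us s' by (auto simp: words_def)
  show ?thesis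
  proof (cases y)
    case (Lin a)
    thus ?thesis using van us s' by (simp add: vanL_def)
  next
    case (Quad e f)
    have "g (map Lin u @ Quad e f # s) = 0"
    proof (rule invariant_adjoint_form_zero[where n = n and p = "m - Suc r" and B = "\<lambda>e f w. g (map Lin w @ Quad e f # s)"])
      show "altC (coords n) (m - Suc r) (\<lambda>w. g (map Lin w @ Quad e f # s))"
        if "e \<in> coords n" "f \<in> coords n" for e f
        by (rule bottom_alternating[OF r cyc]) (use that s s' in \<open>auto simp: words_def\<close>)
      show "g (map Lin w @ Quad e f # s) = g (map Lin w @ Quad f e # s)" for e f w
        by (rule symQD[OF sym])
      fix a b e f v
      assume *: "a \<in> coords n" "b \<in> coords n" "e \<in> coords n" "f \<in> coords n" "set v \<subseteq> coords n" "length v = m - Suc r"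
      have W: "map Lin v @ Quad e f # s \<in> words n m" using * s s' r by (auto simp: words_def)
      have "lie (Suc r) (Quad a b) g (map Lin v @ Quad e f # s) = 0"
        by (rule bottom_invariant[OF r g0 cyc _ _ W]) (use * in auto)
      moreover have "pact r (Quad a b) g (map Lin v @ Quad e f # s) = 0"
        using pinv W * by blast
      hence "lie (Suc r) (Quad a b) (\<lambda>w. g (map Lin v @ Quad e f # w)) s = 0"
        using pact_append[of r s "Quad a b" g "map Lin v @ [Quad e f]"] s' lie_eq_pact[of s r "Quad a b" "Suc r"] by simp
      ultimately show "cder a b (\<lambda>w. g (map Lin w @ Quad e f # s)) v
          + omt a b e (\<lambda>z. g (map Lin v @ Quad z f # s)) + omt a b f (\<lambda>z. g (map Lin v @ Quad e z # s)) = 0"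
        by (simp add: lie_map_Lin lie_Cons omt_def)
    qed (use u y Quad in auto)
    thus ?thesis using us s' Quad by simp
  qed
qed (use g0 w in blast)

lemma kindL_Cons: "kindL r (y # w) \<longleftrightarrow> (if length w = r then \<not> isQ y else kindL r w)"
  by (auto simp: kindL_def nth_append)

lemma cnt_Suc: "num_quad r w = num_quad (Suc r) w + (if r < length w \<and> \<not> kindL r w then 1 else 0)"
proof (induction w)
  case (Cons y w)
  have "kindL r w \<Longrightarrow> r < length w" by (simp add: kindL_def)
  thus ?case using Cons by (auto simp: kindL_Cons cnt_short split: if_splits)
qed simp

lemma pact_cnt_zero:
  assumes "\<And>v. num_quad j v = num_quad j w \<Longrightarrow> f v = 0"
  shows "pact r (Quad a b) f w = 0"
proof (rule ccontr)
  assume "pact r (Quad a b) f w \<noteq> 0"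
  then obtain u y v z where *: "w = u @ y # v" "reach y (Quad a b) z" "f (u @ z # v) \<noteq> 0"
    unfolding pact_def using act_witness by blast
  moreover have "num_quad j (u @ z # v) = num_quad j w" using * cnt_replace[of y z j u v] by (simp add: reach_def)
  ultimately show False using assms by blast
qed

lemma symQ_restrict:
  assumes "symQ f" "\<And>u a b v. P (u @ Quad a b # v) = P (u @ Quad b a # v)"
  shows "symQ (\<lambda>w. if P w then f w else 0)"
  unfolding symQ_def using assms(2) symQD[OF assms(1)] by presburger

lemma words_swap: "u @ Quad a b # v \<in> words n m \<longleftrightarrow> u @ Quad b a # v \<in> words n m"
  by (auto simp: words_def)

lemma symQ_words: "symQ f \<Longrightarrow> symQ (\<lambda>w. if w \<in> words n m then f w else 0)"
  by (erule symQ_restrict) (rule words_swap)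

lemma kindL_swap: "kindL r (u @ Quad a b # v) = kindL r (u @ Quad b a # v)"
  by (rule kindL_replace) simp

text \<open>The coboundary of the bottom part lives on words with one quadratic letter from slot
  \<open>r\<close> on, that of the rest on words with at least two, so neither can cancel the
  other.\<close>

lemma del_bottom:
  assumes cyc: "\<And>w. w \<in> words n (Suc m) \<Longrightarrow> del r g w = 0" and w: "w \<in> words n (Suc m)"
  shows "del r (\<lambda>w. if num_quad r w = 0 then g w else 0) w = 0"
proof (rule ccontr)
  let ?g = "\<lambda>w. if num_quad r w = 0 then g w else 0"
  assume nz: "del r ?g w \<noteq> 0"
  then obtain v where "num_quad r w = Suc (num_quad r v)" "?g v \<noteq> 0"
    using del_cnt_witness[OF nz w] by blast
  hence 1: "num_quad r w = 1" by (simp split: if_splits)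
  have "del r (\<lambda>w. g w - ?g w) w \<noteq> 0"
    using nz cyc[OF w] by (simp add: linop_diff[OF linop_del])
  then obtain v where "num_quad r w = Suc (num_quad r v)" "g v - ?g v \<noteq> 0"
    using del_cnt_witness[OF _ w] by blast
  thus False using 1 by (simp split: if_splits)
qed

lemma Omg_vanish:
  assumes "\<And>a b v. a \<in> coords n \<Longrightarrow> b \<in> coords n \<Longrightarrow> v \<in> words n m \<Longrightarrow> pact r (Quad a b) f v = 0" "w \<in> words n m"
  shows "cas_op n r f w = 0"
  unfolding cas_op_def
proof (rule cas_zeroI)
  fix a b assume ab: "a \<in> coords n" "b \<in> coords n"
  show "pact r (Quad a b) (pact r (Quad (dual a) (dual b)) f) w = 0"
    unfolding pact_def[of r] by (rule act_words[OF _ _ assms(2)]) (use assms(1) ab in \<open>auto simp: pact_def\<close>)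
qed

lemma subsp_Collect_symQ:
  assumes "\<And>f g a b. P f \<Longrightarrow> P g \<Longrightarrow> P (\<lambda>w. a * f w + b * g w)" "P (\<lambda>_. 0)"
  shows "subsp {f. supp_words n m f \<and> symQ f \<and> P f}"
  using assms by (auto simp: subsp_def supp_words_def symQ_comb) (simp add: symQ_def)

theorem del_exact:
  assumes "symQ f" "\<And>w. w \<in> words n (Suc m) \<Longrightarrow> del r f w = 0"
    "\<And>w. w \<in> words n m \<Longrightarrow> num_quad r w = 0 \<Longrightarrow> f w = 0"
  shows "\<exists>k. symQ k \<and> (\<forall>w\<in>words n m. f w = del r k w)"
  using assms
proof (induction "m - r" arbitrary: r f rule: less_induct)
  case less
  note sym = less.prems(1) and cyc = less.prems(2) and bot = less.prems(3)
  show ?case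
  proof (cases "r < m")
    case False
    \<comment> \<open>A word of length at most \<open>r\<close> has no quadratic letter from slot
      \<open>r\<close> on, so the hypothesis on \<open>f\<close> already gives
      \<open>f w = 0\<close>.\<close>
    have "f w = del r (\<lambda>_. 0) w" if "w \<in> words n m" for w
      using that False bot[OF that] by (simp add: words_def cnt_short)
    thus ?thesis by (intro exI[of _ "\<lambda>_. 0"]) (simp add: symQ_def)
  next
    case True
    then obtain m' where m': "m = Suc m'" by (cases m) auto
    have IH: "\<exists>k. symQ k \<and> (\<forall>w\<in>words n m. f w = del (Suc r) k w)"
      if "symQ f" "\<And>w. w \<in> words n (Suc m) \<Longrightarrow> del (Suc r) f w = 0"
        "\<And>w. w \<in> words n m \<Longrightarrow> num_quad (Suc r) w = 0 \<Longrightarrow> f w = 0" for f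
      by (rule less.hyps) (use that True in auto)

    \<comment> \<open>Cochains vanishing when slot \<open>r\<close> is a translation form a
      subcomplex of \<open>D(r)\<close>. \<open>f0\<close> represents \<open>f\<close> in the
      quotient, which is the corresponding summand of \<open>D(r + 1)\<close>.\<close>
    define f0 where "f0 = (\<lambda>w. if kindL r w = True then f w else 0)"
    have "\<exists>k. symQ k \<and> (\<forall>w\<in>words n m. f0 w = del (Suc r) k w)"
    proof (rule IH)
      show "symQ f0" unfolding f0_def by (rule symQ_restrict[OF sym]) (simp add: kindL_swap)
      fix w assume w: "w \<in> words n (Suc m)"
      show "del (Suc r) f0 w = 0" unfolding f0_def del_Suc_restrict
        using cyc[OF w] del_Suc_kindL[of r w f] by simp
    next
      fix w assume w: "w \<in> words n m" "num_quad (Suc r) w = 0"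
      show "f0 w = 0" using bot[OF w(1)] w(2) cnt_Suc[of r w] by (auto simp: f0_def)
    qed
    then obtain k where k: "symQ k" "\<And>w. w \<in> words n m \<Longrightarrow> f0 w = del (Suc r) k w" by blast
    define k' where "k' = (\<lambda>w. if kindL r w = True then k w else 0)"
    have symk': "symQ k'" unfolding k'_def by (rule symQ_restrict[OF k(1)]) (simp add: kindL_swap)
    \<comment> \<open>Cutting off outside \<open>words n m\<close> puts the cochain into a
      finite-dimensional space, as the Casimir splitting demands.\<close>
    define f' where "f' = (\<lambda>w. if w \<in> words n m then f w - del r k' w else 0)"

    let ?K = "{f. supp_words n m f \<and> symQ f \<and> (\<forall>w\<in>words n (Suc m). del r f w = 0) \<and> vanL r f}"
    have f'K: "f' \<in> ?K"
    proof (intro CollectI conjI ballI)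
      show "supp_words n m f'" by (simp add: supp_words_def f'_def)
      show "symQ f'" unfolding f'_def
        by (rule symQ_words) (use symQ_comb[OF sym symQ_del[OF symk'], of 1 "-1" r] in simp)
      show "vanL r f'" unfolding vanL_kindL
      proof (intro allI impI)
        fix w assume w: "kindL r w"
        have "del r k' w = f w" if "w \<in> words n m"
          using w that k(2)[OF that] del_Suc_kindL[OF w, of k'] unfolding k'_def del_Suc_restrict f0_def by simp
        thus "f' w = 0" by (simp add: f'_def)
      qed
      fix w assume w: "w \<in> words n (Suc m)"
      have "del r f' w = del r (\<lambda>w. f w - del r k' w) w"
        by (rule del_words_cong[OF _ w]) (simp add: f'_def)
      thus "del r f' w = 0" using cyc[OF w] by (simp add: linop_diff[OF linop_del] del_del)
    qed
    have subK: "subsp ?K"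
      by (rule subsp_Collect_symQ)
         (auto simp: linop_add[OF linop_del] linop_scale[OF linop_del] linop_zero[OF linop_del] vanL_def)
    have OK: "cas_op n r g \<in> ?K" if "g \<in> ?K" for g
    proof -
      have "del r (cas_op n r g) w = 0" if w: "w \<in> words n (Suc m)" for w
      proof -
        have "del r (cas_op n r g) w = cas_op n r (del r g) w"
          by (rule del_Omg) (use w in \<open>auto simp: words_def\<close>)
        thus ?thesis using Omg_words[OF _ w] \<open>g \<in> ?K\<close> by auto
      qed
      thus ?thesis using that by (simp add: Omg_supp symQ_Omg vanL_Omg)
    qed
    obtain g where g: "g \<in> ?K" "(\<lambda>w. f' w - cas_op n r g w) \<in> ?K"
      "\<And>a b w. a \<in> coords n \<Longrightarrow> b \<in> coords n \<Longrightarrow> w \<in> words n m \<Longrightarrow> pact r (Quad a b) (\<lambda>w. f' w - cas_op n r g w) w = 0"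
      by (rule Omg_decomposition[OF subK _ OK f'K]) auto
    define g1 where "g1 = (\<lambda>w. f' w - cas_op n r g w)"
    have symg1: "symQ g1" and vang1: "vanL r g1" and cycg1: "\<And>w. w \<in> words n (Suc m) \<Longrightarrow> del r g1 w = 0"
      using g(2) unfolding g1_def by auto
    have pg1: "pact r (Quad a b) g1 w = 0" if "a \<in> coords n" "b \<in> coords n" "w \<in> words n m" for a b w
      using g(3)[OF that] by (simp add: g1_def)
    \<comment> \<open>Since \<open>g\<close> is a cocycle, one of the two terms of the homotopy
      formula drops out.\<close>
    have Og: "cas_op n r g w = (-1) ^ (r + 1) * del r (homot n r g) w" if w: "w \<in> words n m" for w
    proof -
      have "homot n r (del r g) w = 0" by (rule hom_words[OF _ w]) (use g(1) in auto)
      moreover have "del r (homot n r g) w + homot n r (del r g) w = (-1) ^ (r + 1) * cas_op n r g w"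
        by (rule hom_homotopy) (use w True g(1) in \<open>auto simp: words_def\<close>)
      ultimately have "del r (homot n r g) w = (-1) ^ (r + 1) * cas_op n r g w" by simp
      hence "(-1) ^ (r + 1) * del r (homot n r g) w = ((-1) ^ (r + 1) * (-1) ^ (r + 1)) * cas_op n r g w" by simp
      thus ?thesis by (simp flip: power_add)
    qed

    have cycg1': "del (Suc r) g1 w = 0" if w: "w \<in> words n (Suc m)" for w
      using cycg1[OF w] del_Suc_vanL[OF vang1 w pg1] by simp
    \<comment> \<open>The induction hypothesis asks that \<open>g1\<close> have no bottom part in
      \<open>D(r + 1)\<close>; this part is isolated and shown to be zero.\<close>
    define g2 where "g2 = (\<lambda>w. if num_quad (Suc r) w = 0 then g1 w else 0)"
    have g2zero: "g2 w = 0" if w: "w \<in> words n m" for w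
    proof (rule bottom_zero[where r = r and m = m and n = n])
      show "symQ g2" unfolding g2_def
        by (rule symQ_restrict[OF symg1], rule arg_cong[where f = "\<lambda>x. x = 0"], rule cnt_replace) simp
      show "vanL r g2" using vang1 by (auto simp: vanL_def g2_def)
      show "del (Suc r) g2 w = 0" if w: "w \<in> words n (Suc m)" for w
        unfolding g2_def using cycg1' w by (rule del_bottom)
      show "pact r (Quad a b) g2 w = 0" if "a \<in> coords n" "b \<in> coords n" "w \<in> words n m" for a b w
      proof (cases "num_quad (Suc r) w = 0")
        case True
        have "pact r (Quad a b) (\<lambda>w. g1 w - g2 w) w = 0"
          by (rule pact_cnt_zero[where j = "Suc r"]) (use True in \<open>simp add: g2_def\<close>)
        thus ?thesis using pg1[OF that] by (simp add: linop_diff[OF linop_pact])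
      next
        case False
        show ?thesis by (rule pact_cnt_zero[where j = "Suc r"]) (use False in \<open>simp add: g2_def\<close>)
      qed
    qed (use w True in \<open>auto simp: g2_def\<close>)
    have "\<exists>k. symQ k \<and> (\<forall>w\<in>words n m. g1 w = del (Suc r) k w)"
    proof (rule IH[OF symg1 cycg1'])
      fix w assume "w \<in> words n m" "num_quad (Suc r) w = 0"
      thus "g1 w = 0" using g2zero[of w] by (simp add: g2_def)
    qed
    then obtain k2 where k2: "symQ k2" "\<And>w. w \<in> words n m \<Longrightarrow> g1 w = del (Suc r) k2 w" by blast

    define k3 where "k3 = (\<lambda>w. if w \<in> words n m' then (if kindL r w = False then k2 w else 0) else 0)"
    let ?K' = "{f. supp_words n m' f \<and> symQ f \<and> vanL r f}"
    have k3K: "k3 \<in> ?K'"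
    proof (intro CollectI conjI)
      show "supp_words n m' k3" by (simp add: supp_words_def k3_def)
      show "vanL r k3" unfolding vanL_kindL by (simp add: k3_def)
      have "symQ (\<lambda>w. if kindL r w = False then k2 w else 0)"
        by (rule symQ_restrict[OF k2(1)]) (simp add: kindL_swap)
      thus "symQ k3" unfolding k3_def by (rule symQ_words)
    qed
    have delk3: "del (Suc r) k3 w = g1 w" if w: "w \<in> words n m" for w
    proof -
      have "del (Suc r) k3 w = del (Suc r) (\<lambda>w. if kindL r w = False then k2 w else 0) w"
        by (rule del_words_cong[of n m']) (use w m' in \<open>auto simp: k3_def\<close>)
      also have "\<dots> = (if kindL r w = False then g1 w else 0)"
        unfolding del_Suc_restrict using k2(2)[OF w] by simp
      also have "\<dots> = g1 w" using vang1 unfolding vanL_kindL by auto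
      finally show ?thesis .
    qed
    have subK': "subsp ?K'" by (rule subsp_Collect_symQ) (auto simp: vanL_def)
    have OK': "cas_op n r g \<in> ?K'" if "g \<in> ?K'" for g
      using that by (simp add: Omg_supp symQ_Omg vanL_Omg)
    obtain k4 where k4: "k4 \<in> ?K'" "(\<lambda>w. k3 w - cas_op n r k4 w) \<in> ?K'"
      "\<And>a b w. a \<in> coords n \<Longrightarrow> b \<in> coords n \<Longrightarrow> w \<in> words n m' \<Longrightarrow> pact r (Quad a b) (\<lambda>w. k3 w - cas_op n r k4 w) w = 0"
      by (rule Omg_decomposition[OF subK' _ OK' k3K]) auto
    define k0 where "k0 = (\<lambda>w. k3 w - cas_op n r k4 w)"
    have pk0: "pact r (Quad a b) k0 w = 0" if "a \<in> coords n" "b \<in> coords n" "w \<in> words n m'" for a b w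
      using k4(3)[OF that] by (simp add: k0_def)
    have symk0: "symQ k0" and vank0: "vanL r k0" using k4(2) unfolding k0_def by auto
    define q where "q = del (Suc r) k4"
    have sub: "set w \<subseteq> ltrs n" if "w \<in> words n m" for w using that by (simp add: words_def)
    have delk0: "del (Suc r) k0 w = g1 w - cas_op n r q w" if w: "w \<in> words n m" for w
      using delk3[OF w] del_Omg[of r "Suc r" w n k4] sub[OF w]
      by (simp add: k0_def linop_diff[OF linop_del] q_def)
    \<comment> \<open>Apply the Casimir operator to \<open>delk0\<close>: it kills \<open>g1\<close>
      as well as the coboundary of the invariant \<open>k0\<close>, hence the second Casimir image
      of \<open>q\<close> is zero, and by symmetry already the first. So \<open>k0\<close> is still
      a primitive of \<open>g1\<close>.\<close>
    have "cas_op n r (cas_op n r q) w = 0" if w: "w \<in> words n m" for w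
    proof -
      have "cas_op n r (del (Suc r) k0) w = del (Suc r) (cas_op n r k0) w"
        using del_Omg[of r "Suc r" w n k0] sub[OF w] by simp
      also have "\<dots> = 0" by (rule del_words[of n m']) (use Omg_vanish[OF pk0] w m' in auto)
      finally have "cas_op n r (\<lambda>w. g1 w - cas_op n r q w) w = 0"
        using Omg_words[of n m "\<lambda>w. del (Suc r) k0 w - (g1 w - cas_op n r q w)" w r] w delk0
        by (simp add: linop_diff[OF linop_Omg])
      thus ?thesis using Omg_vanish[OF pg1 w] by (simp add: linop_diff[OF linop_Omg])
    qed
    hence "cas_op n r q w = 0" if "w \<in> words n m" for w using Omg_Omg_zero that by blast
    hence g1k0: "g1 w = del r k0 w" if w: "w \<in> words n m" for w
      using delk0[OF w] w del_Suc_vanL[OF vank0, of w n m'] pk0 m' by simp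

    let ?k = "\<lambda>w. (k0 w + (-1) ^ (r + 1) * homot n r g w) + k' w"
    have "symQ ?k"
    proof -
      have "symQ (homot n r g)" using g(1) by (simp add: symQ_hom)
      hence "symQ (\<lambda>w. 1 * k0 w + (-1) ^ (r + 1) * homot n r g w)" by (rule symQ_comb[OF symk0])
      hence "symQ (\<lambda>w. 1 * (1 * k0 w + (-1) ^ (r + 1) * homot n r g w) + 1 * k' w)" using symk' by (rule symQ_comb)
      thus ?thesis by simp
    qed
    moreover have "f w = del r ?k w" if w: "w \<in> words n m" for w
    proof -
      have "f w = g1 w + cas_op n r g w + del r k' w" using w by (simp add: g1_def f'_def)
      thus ?thesis unfolding linop_add[OF linop_del] linop_scale[OF linop_del] Og[OF w] g1k0[OF w] .
    qed
    ultimately show ?thesis by blast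
  qed
qed

section \<open>Transfer to the basis of labels\<close>

fun lab :: "ltr \<Rightarrow> bl" where
  "lab (Lin (Cx i)) = DX i"
| "lab (Lin (Cy i)) = DY i"
| "lab (Quad (Cx i) (Cx j)) = (if i = j then YdX i else if i < j then YYdX i j else YYdX j i)"
| "lab (Quad (Cy i) (Cy j)) = (if i = j then XdY i else if i < j then XXdY i j else XXdY j i)"
| "lab (Quad (Cx j) (Cy i)) = S i j"
| "lab (Quad (Cy i) (Cx j)) = S i j"

text \<open>The ratio between the field of a letter and that of its label: squares count twice
  because both summands coincide, and two \<open>Cy\<close> entries give a minus sign because
  \<open>sg (Cy i) = -1\<close>.\<close>

fun scal :: "ltr \<Rightarrow> real" where
  "scal (Lin c) = 1"
| "scal (Quad (Cx i) (Cx j)) = (if i = j then 2 else 1)"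
| "scal (Quad (Cy i) (Cy j)) = (if i = j then -2 else -1)"
| "scal (Quad (Cx j) (Cy i)) = 1"
| "scal (Quad (Cy i) (Cx j)) = 1"

fun vec :: "ltr \<Rightarrow> avf" where
  "vec (Lin a) k v = ind (k = a \<and> v = None)"
| "vec (Quad a b) k v = (case v of None \<Rightarrow> 0 | Some c \<Rightarrow> om b c * ind (k = a) + om a c * ind (k = b))"

fun rep :: "bl \<Rightarrow> ltr" where
  "rep (DX i) = Lin (Cx i)"
| "rep (DY i) = Lin (Cy i)"
| "rep (YdX i) = Quad (Cx i) (Cx i)"
| "rep (XdY i) = Quad (Cy i) (Cy i)"
| "rep (YYdX i j) = Quad (Cx i) (Cx j)"
| "rep (XXdY i j) = Quad (Cy i) (Cy j)"
| "rep (S i j) = Quad (Cy i) (Cx j)"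

lemma sc_nz [simp]: "scal l \<noteq> 0"
  by (cases l rule: scal.cases) auto

lemma vec_field: "vec l k v = scal l * field (lab l) k v"
  by (cases l rule: lab.cases; cases v) (auto simp: ind_def om_def)

lemma lab_basis: "l \<in> ltrs n \<Longrightarrow> lab l \<in> basis n"
  by (cases l rule: lab.cases) (auto simp: basis_def coords_def)

lemma rep_ltrs: "l \<in> basis n \<Longrightarrow> rep l \<in> ltrs n" and lab_rep: "l \<in> basis n \<Longrightarrow> lab (rep l) = l"
  by (auto simp: basis_def coords_def)

lemma sc_swap: "scal (Quad a b) = scal (Quad b a)" and lab_swap: "lab (Quad a b) = lab (Quad b a)"
  by (cases a; cases b; auto)+

lemma sc_rep_lab: "scal (rep (lab l)) = scal l"
  by (cases l rule: lab.cases) auto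

lemma finite_basis [simp]: "finite (basis n)"
proof -
  have "basis n \<subseteq> lab ` ltrs n"
  proof
    fix l assume "l \<in> basis n"
    thus "l \<in> lab ` ltrs n" using rep_ltrs lab_rep by (metis image_eqI)
  qed
  thus ?thesis by (rule finite_subset) simp
qed

text \<open>A matrix entry that singles out one basis field.\<close>
fun key :: "bl \<Rightarrow> crd \<times> crd option" where
  "key (XdY k) = (Cy k, Some (Cx k))"
| "key (YdX k) = (Cx k, Some (Cy k))"
| "key (XXdY i j) = (Cy j, Some (Cx i))"
| "key (YYdX i j) = (Cx j, Some (Cy i))"
| "key (S i j) = (Cy i, Some (Cy j))"
| "key (DX i) = (Cx i, None)"
| "key (DY i) = (Cy i, None)"

lemma field_key: "l \<in> basis n \<Longrightarrow> l' \<in> basis n \<Longrightarrow> field l (fst (key l')) (snd (key l')) = ind (l = l')"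
  by (cases l; cases l') (auto simp: basis_def ind_def)

text \<open>The entries selected by \<open>key\<close> recover the coefficients from the field, so
  the definite description in \<open>coord\<close> denotes any expansion that can be
  exhibited.\<close>

lemma coord_eq:
  assumes "\<And>l. l \<notin> basis n \<Longrightarrow> a l = 0" "\<And>k v. V k v = (\<Sum>l\<in>basis n. a l * field l k v)"
  shows "coord n V = a"
  unfolding coord_def
proof (rule the_equality)
  have val: "b l = V (fst (key l)) (snd (key l))"
    if "\<forall>k v. V k v = (\<Sum>l\<in>basis n. b l * field l k v)" "l \<in> basis n" for b l
  proof -
    have "V (fst (key l)) (snd (key l)) = (\<Sum>l'\<in>basis n. b l' * ind (l' = l))"
      using that by (auto intro!: sum.cong simp: field_key)
    also have "\<dots> = (\<Sum>l'\<in>basis n. if l' = l then b l else 0)"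
      by (rule sum.cong) (auto simp: ind_def)
    finally show ?thesis using that by simp
  qed
  fix b assume b: "(\<forall>l. l \<notin> basis n \<longrightarrow> b l = 0) \<and> (\<forall>k v. V k v = (\<Sum>l\<in>basis n. b l * field l k v))"
  show "b = a"
  proof
    fix l show "b l = a l"
      using b assms val[of b l] val[of a l] by (cases "l \<in> basis n") auto
  qed
qed (use assms in blast)

lemma sum_ind: "c \<in> coords n \<Longrightarrow> (\<Sum>j\<in>coords n. ind (j = c) * X j) = X c"
proof -
  assume c: "c \<in> coords n"
  have "(\<Sum>j\<in>coords n. ind (j = c) * X j) = (\<Sum>j\<in>coords n. if j = c then X c else 0)"
    by (rule sum.cong) (auto simp: ind_def)
  thus ?thesis using c by simp
qed

text \<open>This fixes the sign convention of \<open>brk\<close>: its first argument is the first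
  argument of the bracket of vector fields.\<close>

lemma bracket_vec:
  assumes "y \<in> ltrs n" "x \<in> ltrs n"
  shows "vf_bracket n (vec y) (vec x) k v = brk y x (\<lambda>z. vec z k v)"
proof (cases y)
  case (Lin c)
  show ?thesis
  proof (cases x)
    case (Lin d)
    thus ?thesis using \<open>y = Lin c\<close> by (simp add: vf_bracket_def ind_def)
  next
    case (Quad a b)
    have "vf_bracket n (vec y) (vec x) k v
       = (\<Sum>j\<in>coords n. ind (j = c) * (ind (v = None) * (om b j * ind (k = a) + om a j * ind (k = b))))"
      unfolding vf_bracket_def Lin Quad by (intro sum.cong refl) (auto simp: ind_def)
    also have "\<dots> = ind (v = None) * (om b c * ind (k = a) + om a c * ind (k = b))"
      by (rule sum_ind) (use assms Lin in auto)
    finally show ?thesis unfolding Lin Quad by (auto simp: ind_def)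
  qed
next
  case Q: (Quad c d)
  show ?thesis
  proof (cases x)
    case (Lin a)
    have "vf_bracket n (vec y) (vec x) k v
       = (\<Sum>j\<in>coords n. ind (j = a) * (- (ind (v = None) * (om d j * ind (k = c) + om c j * ind (k = d)))))"
      unfolding vf_bracket_def Lin Q by (intro sum.cong refl) (auto simp: ind_def)
    also have "\<dots> = - (ind (v = None) * (om d a * ind (k = c) + om c a * ind (k = d)))"
      by (rule sum_ind) (use assms Lin in auto)
    finally show ?thesis unfolding Lin Q by (auto simp: ind_def)
  next
    case (Quad a b)
    show ?thesis
    proof (cases v)
      case None
      thus ?thesis unfolding Q Quad by (simp add: vf_bracket_def)
    next
      case (Some e)
      have co: "a \<in> coords n" "b \<in> coords n" "c \<in> coords n" "d \<in> coords n" using assms Q Quad by auto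
      have "vf_bracket n (vec y) (vec x) k v
        = (\<Sum>j\<in>coords n. ind (j = c) * (om d e * (om b j * ind (k = a) + om a j * ind (k = b))))
        + (\<Sum>j\<in>coords n. ind (j = d) * (om c e * (om b j * ind (k = a) + om a j * ind (k = b))))
        - (\<Sum>j\<in>coords n. ind (j = a) * (om b e * (om d j * ind (k = c) + om c j * ind (k = d))))
        - (\<Sum>j\<in>coords n. ind (j = b) * (om a e * (om d j * ind (k = c) + om c j * ind (k = d))))"
        unfolding vf_bracket_def Q Quad Some sum.distrib[symmetric] sum_subtractf[symmetric]
        by (intro sum.cong refl) (simp add: algebra_simps)
      thus ?thesis unfolding co[THEN sum_ind] unfolding Q Quad Some
        by (simp add: algebra_simps om_antisym[of a c] om_antisym[of a d] om_antisym[of b c] om_antisym[of b d])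
    qed
  qed
qed

lemma bre_cong_ltrs:
  assumes "y \<in> ltrs n" "x \<in> ltrs n" "\<And>z. z \<in> ltrs n \<Longrightarrow> F z = G z"
  shows "brk y x F = brk y x G"
  using assms by (cases y; cases x) auto

lemma sum_basis_ind: "(\<Sum>l\<in>basis n. ind (l' = l) * H l) = (if l' \<in> basis n then H l' else 0)"
proof -
  have "(\<Sum>l\<in>basis n. ind (l' = l) * H l) = (\<Sum>l\<in>basis n. if l' = l then H l' else 0)"
    by (rule sum.cong) (auto simp: ind_def)
  thus ?thesis by simp
qed

lemma br_eq:
  assumes y: "y \<in> ltrs n" and x: "x \<in> ltrs n"
  shows "br n (lab y) (lab x) = (\<lambda>l. brk y x (\<lambda>z. scal z * ind (lab z = l)) / (scal y * scal x))" (is "_ = ?a")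
  unfolding br_def
proof (rule coord_eq)
  fix l assume l: "l \<notin> basis n"
  have "brk y x (\<lambda>z. scal z * ind (lab z = l)) = brk y x (\<lambda>z. 0)"
    by (rule bre_cong_ltrs[OF y x]) (use l lab_basis in \<open>auto simp: ind_def\<close>)
  thus "?a l = 0" by simp
next
  fix k v
  have "scal y * scal x * vf_bracket n (field (lab y)) (field (lab x)) k v = vf_bracket n (vec y) (vec x) k v"
    by (simp add: vf_bracket_def vec_field sum_distrib_left algebra_simps)
  also have "\<dots> = brk y x (\<lambda>z. \<Sum>l\<in>basis n. scal z * (ind (lab z = l) * field l k v))"
    unfolding bracket_vec[OF y x] sum_distrib_left[symmetric] sum_basis_ind
    by (rule bre_cong_ltrs[OF y x]) (simp add: vec_field lab_basis)
  also have "\<dots> = (\<Sum>l\<in>basis n. field l k v * brk y x (\<lambda>z. scal z * ind (lab z = l)))"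
    unfolding bre_sum by (intro sum.cong refl) (simp add: bre_scale[symmetric] algebra_simps)
  finally have "vf_bracket n (field (lab y)) (field (lab x)) k v
     = (\<Sum>l\<in>basis n. field l k v * brk y x (\<lambda>z. scal z * ind (lab z = l))) / (scal y * scal x)"
    by (simp add: field_simps)
  thus "vf_bracket n (field (lab y)) (field (lab x)) k v = (\<Sum>l\<in>basis n. ?a l * field l k v)"
    by (simp add: sum_divide_distrib algebra_simps)
qed

lemma br_sum:
  assumes y: "y \<in> ltrs n" and x: "x \<in> ltrs n"
  shows "(\<Sum>l\<in>basis n. br n (lab y) (lab x) l * G l) * (scal y * scal x) = brk y x (\<lambda>z. scal z * G (lab z))"
proof -
  have "(\<Sum>l\<in>basis n. br n (lab y) (lab x) l * G l) * (scal y * scal x)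
    = (\<Sum>l\<in>basis n. brk y x (\<lambda>z. scal z * (ind (lab z = l) * G l)))"
    unfolding br_eq[OF y x] sum_distrib_right
  proof (intro sum.cong refl)
    fix l
    have "brk y x (\<lambda>z. scal z * (ind (lab z = l) * G l)) = brk y x (\<lambda>z. G l * (scal z * ind (lab z = l)))"
      by (simp add: mult_ac)
    thus "brk y x (\<lambda>z. scal z * ind (lab z = l)) / (scal y * scal x) * G l * (scal y * scal x)
      = brk y x (\<lambda>z. scal z * (ind (lab z = l) * G l))" by (simp add: bre_scale)
  qed
  also have "\<dots> = brk y x (\<lambda>z. \<Sum>l\<in>basis n. scal z * (ind (lab z = l) * G l))"
    unfolding bre_sum ..
  also have "\<dots> = brk y x (\<lambda>z. scal z * G (lab z))"
    unfolding sum_distrib_left[symmetric] sum_basis_ind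
    by (rule bre_cong_ltrs[OF y x]) (simp add: lab_basis)
  finally show ?thesis .
qed

lemma br_supp: "y \<in> basis n \<Longrightarrow> x \<in> basis n \<Longrightarrow> l \<notin> basis n \<Longrightarrow> br n y x l = 0"
proof -
  assume yx: "y \<in> basis n" "x \<in> basis n" and l: "l \<notin> basis n"
  have "brk (rep y) (rep x) (\<lambda>z. scal z * ind (lab z = l)) = brk (rep y) (rep x) (\<lambda>z. 0)"
    by (rule bre_cong_ltrs[of _ n]) (use yx rep_ltrs l lab_basis in \<open>auto simp: ind_def\<close>)
  thus ?thesis using br_eq[of "rep y" n "rep x"] yx by (simp add: rep_ltrs lab_rep)
qed

lemma finite_tuples [simp]: "finite (tuples n m)"
proof -
  have "tuples n m = {ls. set ls \<subseteq> basis n \<and> length ls = m}" by (auto simp: tuples_def)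
  thus ?thesis using finite_lists_length_eq[OF finite_basis, of n m] by (simp only:)
qed

section \<open>The coboundary on words of labels\<close>

definition brsum :: "nat \<Rightarrow> bl \<Rightarrow> (bl list \<Rightarrow> real) \<Rightarrow> bl list \<Rightarrow> real" where
  "brsum n x f ls = (\<Sum>i<length ls. \<Sum>l\<in>basis n. br n (ls ! i) x l * f (ls[i := l]))"

definition codS :: "nat \<Rightarrow> (bl list \<Rightarrow> real) \<Rightarrow> bl list \<Rightarrow> real" where
  "codS n f ls = (\<Sum>j<length ls. \<Sum>i<j. (-1) ^ (j + 1) *
      (\<Sum>l\<in>basis n. br n (ls ! i) (ls ! j) l * f ((remove_at j ls)[i := l])))"

lemma length_remove_at: "j < length ls \<Longrightarrow> length (remove_at j ls) = length ls - 1"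
  by (simp add: remove_at_def)

lemma set_remove_at: "set (remove_at j ls) \<subseteq> set ls"
  unfolding remove_at_def by (auto dest: in_set_takeD in_set_dropD)

text \<open>For given \<open>i\<close> and \<open>j\<close> the basis tensors that contribute are
  those obtained from the shortened word by overwriting entry \<open>i\<close>; as
  \<open>i < j\<close>, deleting position \<open>j\<close> does not move entry
  \<open>i\<close>.\<close>

lemma cod_codS:
  assumes ls: "ls \<in> tuples n (Suc m)"
  shows "cod n m f ls = codS n f ls"
proof -
  have len: "length ls = Suc m" and sub: "set ls \<subseteq> basis n" using ls by (auto simp: tuples_def)
  have "(\<Sum>gs\<in>tuples n m. f gs * (if length gs + 1 = length ls \<and> (\<forall>p<length gs. p \<noteq> i \<longrightarrow> gs ! p = remove_at j ls ! p)
         then br n (ls ! i) (ls ! j) (gs ! i) else 0))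
     = (\<Sum>l\<in>basis n. br n (ls ! i) (ls ! j) l * f ((remove_at j ls)[i := l]))"
    if ij: "i < j" "j < length ls" for i j
  proof -
    let ?r = "remove_at j ls"
    have r: "length ?r = m" "set ?r \<subseteq> basis n" using ij len sub length_remove_at[of j ls] set_remove_at[of j ls] by auto
    have im: "i < m" using ij len by simp
    let ?T = "{gs \<in> tuples n m. \<forall>p<length gs. p \<noteq> i \<longrightarrow> gs ! p = ?r ! p}"
    have T: "?T = (\<lambda>l. ?r[i := l]) ` basis n"
    proof (intro equalityI subsetI)
      fix gs assume gs: "gs \<in> ?T"
      hence "gs = ?r[i := gs ! i]"
        using r im by (intro nth_equalityI) (auto simp: tuples_def nth_list_update)
      moreover have "gs ! i \<in> basis n" using gs im by (auto simp: tuples_def)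
      ultimately show "gs \<in> (\<lambda>l. ?r[i := l]) ` basis n" by blast
    next
      fix gs assume "gs \<in> (\<lambda>l. ?r[i := l]) ` basis n"
      then obtain l where "l \<in> basis n" "gs = ?r[i := l]" by blast
      thus "gs \<in> ?T" using r set_update_subset_insert[of ?r i l] by (auto simp: tuples_def)
    qed
    have inj: "inj_on (\<lambda>l. ?r[i := l]) (basis n)"
      using r im by (auto simp: inj_on_def dest: arg_cong[where f = "\<lambda>gs. gs ! i"])
    have "(\<Sum>gs\<in>tuples n m. f gs * (if length gs + 1 = length ls \<and> (\<forall>p<length gs. p \<noteq> i \<longrightarrow> gs ! p = ?r ! p)
         then br n (ls ! i) (ls ! j) (gs ! i) else 0))
      = (\<Sum>gs\<in>?T. f gs * br n (ls ! i) (ls ! j) (gs ! i))"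
      by (rule sum.mono_neutral_cong_right[OF finite_tuples]) (auto simp: len tuples_def)
    also have "\<dots> = (\<Sum>l\<in>basis n. br n (ls ! i) (ls ! j) l * f (?r[i := l]))"
      unfolding T using r im by (subst sum.reindex[OF inj]) (simp add: mult.commute)
    finally show ?thesis .
  qed
  note inner = this
  have "cod n m f ls = (\<Sum>gs\<in>tuples n m. f gs * dbasis n ls gs)"
    using ls by (simp add: cod_def)
  also have "\<dots> = (\<Sum>gs\<in>tuples n m. \<Sum>j<length ls. \<Sum>i<j. (-1) ^ (j + 1) * (f gs * (if length gs + 1 = length ls \<and> (\<forall>p<length gs. p \<noteq> i \<longrightarrow> gs ! p = remove_at j ls ! p)
         then br n (ls ! i) (ls ! j) (gs ! i) else 0)))"
    unfolding dbasis_def sum_distrib_left by (intro sum.cong refl) (simp only: ac_simps)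
  also have "\<dots> = (\<Sum>j<length ls. \<Sum>i<j. \<Sum>gs\<in>tuples n m. (-1) ^ (j + 1) * (f gs * (if length gs + 1 = length ls \<and> (\<forall>p<length gs. p \<noteq> i \<longrightarrow> gs ! p = remove_at j ls ! p)
         then br n (ls ! i) (ls ! j) (gs ! i) else 0)))"
    by (subst sum.swap, intro sum.cong refl, subst sum.swap, rule refl)
  also have "\<dots> = codS n f ls"
    unfolding codS_def sum_distrib_left[symmetric, of "(-1) ^ _" _ "tuples n m"]
    by (intro sum.cong refl arg_cong2[where f = "(*)"] inner) auto
  finally show ?thesis .
qed

lemma brsum_snoc: "brsum n x f (ls @ [y]) = brsum n x (\<lambda>v. f (v @ [y])) ls + (\<Sum>l\<in>basis n. br n y x l * f (ls @ [l]))"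
  unfolding brsum_def by (simp add: nth_append list_update_append)

lemma codS_snoc: "codS n f (ls @ [x]) = codS n (\<lambda>v. f (v @ [x])) ls + (-1) ^ (length ls + 1) * brsum n x f ls"
proof -
  have "remove_at j (ls @ [x]) = remove_at j ls @ [x]" if "j < length ls" for j
    using that by (simp add: remove_at_def)
  moreover have "i < length (remove_at j ls)" if "j < length ls" "i < j" for i j
    using that by (simp add: length_remove_at)
  ultimately have "codS n f (ls @ [x]) = codS n (\<lambda>v. f (v @ [x])) ls
     + (\<Sum>i<length ls. (-1) ^ (length ls + 1) * (\<Sum>l\<in>basis n. br n (ls ! i) x l * f ((remove_at (length ls) (ls @ [x]))[i := l])))"
    unfolding codS_def by (simp add: nth_append list_update_append)
  moreover have "remove_at (length ls) (ls @ [x]) = ls" by (simp add: remove_at_def)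
  ultimately show ?thesis by (simp add: brsum_def sum_distrib_left)
qed

definition scl :: "ltr list \<Rightarrow> real" where "scl w = prod_list (map scal w)"

lemma scl_simps [simp]: "scl [] = 1" "scl (y # w) = scal y * scl w" "scl w \<noteq> 0"
  by (auto simp: scl_def prod_list_zero_iff)

text \<open>The pullback of a cochain to letters: \<open>rev\<close> because words begin with the
  last slot, \<open>scl\<close> because a letter stands for a multiple of a basis field and cochains
  are multilinear.\<close>

definition raw :: "(bl list \<Rightarrow> real) \<Rightarrow> ltr list \<Rightarrow> real" where
  "raw f w = scl w * f (rev (map lab w))"

lemma raw_Cons: "raw f (y # w) = scal y * raw (\<lambda>v. f (v @ [lab y])) w"
  by (simp add: raw_def)

lemma lie_raw:
  assumes x: "x \<in> ltrs n"
  shows "set w \<subseteq> ltrs n \<Longrightarrow> lie 0 x (raw f) w = scal x * raw (brsum n (lab x) f) w"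
proof (induction w arbitrary: f)
  case Nil
  show ?case by (simp add: raw_def brsum_def)
next
  case (Cons y w)
  have y: "y \<in> ltrs n" using Cons.prems by simp
  have 1: "lie 0 x (\<lambda>v. raw f (y # v)) w = scal y * (scal x * raw (brsum n (lab x) (\<lambda>v. f (v @ [lab y]))) w)"
    unfolding raw_Cons linop_scale[OF linop_lie] using Cons by simp
  have "brk y x (\<lambda>z. raw f (z # w)) = brk y x (\<lambda>z. scal z * (scl w * f (rev (map lab w) @ [lab z])))"
    by (simp add: raw_def algebra_simps)
  also have "\<dots> = (\<Sum>l\<in>basis n. br n (lab y) (lab x) l * (scl w * f (rev (map lab w) @ [l]))) * (scal y * scal x)"
    by (rule br_sum[OF y x, symmetric])
  finally show ?case unfolding lie_Cons 1
    by (simp add: raw_def brsum_snoc algebra_simps sum_distrib_left)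
qed

lemma del_raw: "set w \<subseteq> ltrs n \<Longrightarrow> del 0 (raw f) w = raw (codS n f) w"
proof (induction w arbitrary: f)
  case Nil
  show ?case by (simp add: raw_def codS_def)
next
  case (Cons x w)
  have "del 0 (\<lambda>v. raw f (x # v)) w = scal x * raw (codS n (\<lambda>v. f (v @ [lab x]))) w"
    unfolding raw_Cons linop_scale[OF linop_del] using Cons by simp
  moreover have "lie 0 x (raw f) w = scal x * raw (brsum n (lab x) f) w"
    by (rule lie_raw) (use Cons.prems in auto)
  moreover have "del 0 (raw f) (x # w) = del 0 (\<lambda>v. raw f (x # v)) w + (-1) ^ (length w + 1) * lie 0 x (raw f) w"
    by simp
  ultimately have "del 0 (raw f) (x # w) = scal x * raw (codS n (\<lambda>v. f (v @ [lab x]))) w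
      + (-1) ^ (length w + 1) * (scal x * raw (brsum n (lab x) f) w)" by (simp only:)
  also have "\<dots> = raw (codS n f) (x # w)" by (simp add: raw_def codS_snoc algebra_simps)
  finally show ?case .
qed

lemma words_tuples: "w \<in> words n m \<Longrightarrow> rev (map lab w) \<in> tuples n m"
  by (auto simp: words_def tuples_def lab_basis)

lemma tuples_words: "ls \<in> tuples n m \<Longrightarrow> \<exists>w\<in>words n m. rev (map lab w) = ls"
proof -
  assume ls: "ls \<in> tuples n m"
  have "map (\<lambda>l. lab (rep l)) ls = map (\<lambda>l. l) ls"
    by (rule map_cong) (use ls lab_rep in \<open>auto simp: tuples_def\<close>)
  thus ?thesis using ls
    by (intro bexI[of _ "rev (map rep ls)"]) (auto simp: words_def tuples_def rep_ltrs rev_map comp_def)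
qed

lemma raw_words_eq: "(\<And>w. w \<in> words n m \<Longrightarrow> raw f w = raw g w) \<Longrightarrow> ls \<in> tuples n m \<Longrightarrow> f ls = g ls"
  using tuples_words[of ls n m] by (fastforce simp: raw_def)

lemma del_raw_cod: "w \<in> words n (Suc m) \<Longrightarrow> del 0 (raw f) w = raw (cod n m f) w"
  using del_raw[of w n f] cod_codS[OF words_tuples, of w n m f] by (simp add: words_def raw_def)

lemma symQ_raw: "symQ (raw f)"
proof -
  have "raw f (u @ Quad a b # v) = raw f (u @ Quad b a # v)" for u a b v
    by (simp add: raw_def scl_def sc_swap[of a b] lab_swap[of a b])
  thus ?thesis by (simp add: symQ_def)
qed

lemma symQ_rep_lab: "symQ k \<Longrightarrow> k (map (\<lambda>l. rep (lab l)) w) = k w"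
proof (induction w arbitrary: k)
  case (Cons y w)
  have "rep (lab y) = y \<or> (\<exists>a b. y = Quad a b \<and> rep (lab y) = Quad b a)"
    by (cases y rule: lab.cases) auto
  hence "k (rep (lab y) # map (\<lambda>l. rep (lab l)) w) = k (y # map (\<lambda>l. rep (lab l)) w)"
    using symQ_head[OF Cons.prems] by auto
  thus ?case using Cons.IH[OF symQ_Cons[OF Cons.prems]] by simp
qed simp

text \<open>Two letters with the same label differ at most by the order of their entries, so a
  symmetric cochain is determined by its values at the representatives \<open>rep l\<close> and
  descends to labels.\<close>

lemma raw_surj:
  assumes k: "symQ k"
  obtains f where "f \<in> chains n m" "\<And>w. w \<in> words n m \<Longrightarrow> raw f w = k w"
proof
  let ?f = "\<lambda>ls. if ls \<in> tuples n m then k (rev (map rep ls)) / scl (map rep ls) else 0"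
  show "?f \<in> chains n m" by (simp add: chains_def)
  fix w assume w: "w \<in> words n m"
  have "scl (map rep (rev (map lab w))) = scl w"
    by (simp add: scl_def rev_map[symmetric] comp_def sc_rep_lab)
  moreover have "k (rev (map rep (rev (map lab w)))) = k w"
    using symQ_rep_lab[OF k, of w] by (simp add: rev_map[symmetric] comp_def)
  ultimately show "raw ?f w = k w" using words_tuples[OF w] by (simp add: raw_def)
qed

section \<open>Powers of the symplectic form\<close>

text \<open>Position 0 goes to the second factor, which creates one inversion with every position of
  the first factor.\<close>

lemma shuffle_sign_Suc: "finite B \<Longrightarrow> shuffle_sign (Suc N) (Suc ` B) = (-1) ^ card B * shuffle_sign N B"
proof -
  assume B: "finite B"
  let ?D = "{(s, t). s \<in> B \<and> t \<in> {0..<N} - B \<and> t < s}"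
  have "{(s, t). s \<in> Suc ` B \<and> t \<in> {0..<Suc N} - Suc ` B \<and> t < s}
     = map_prod Suc Suc ` ?D \<union> (\<lambda>s. (Suc s, 0)) ` B" (is "?L = ?R")
  proof (intro equalityI subsetI)
    fix z assume "z \<in> ?L"
    then obtain s t where z: "z = (Suc s, t)" "s \<in> B" "t < Suc N" "t \<notin> Suc ` B" "t < Suc s" by auto
    show "z \<in> ?R"
    proof (cases t)
      case (Suc t')
      hence "(s, t') \<in> ?D" using z by auto
      thus ?thesis using z Suc by force
    qed (use z in auto)
  qed auto
  moreover have "finite ?D"
    by (rule finite_subset[of _ "B \<times> {0..<N}"]) (use B in auto)
  moreover have "card ((\<lambda>s. (Suc s, 0 :: nat)) ` B) = card B"
    by (rule card_image) (auto simp: inj_on_def)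
  moreover have "card (map_prod Suc Suc ` ?D) = card ?D"
    by (rule card_image) (auto simp: inj_on_def)
  moreover have "map_prod Suc Suc ` ?D \<inter> (\<lambda>s. (Suc s, 0)) ` B = {}" by auto
  ultimately have "card {(s, t). s \<in> Suc ` B \<and> t \<in> {0..<Suc N} - Suc ` B \<and> t < s} = card ?D + card B"
    using B by (simp only: card_Un_disjoint finite_imageI)
  thus ?thesis unfolding shuffle_sign_def by (simp add: power_add)
qed

lemma shuffle_sign_insert: "shuffle_sign (Suc N) (insert 0 (Suc ` B)) = shuffle_sign N B"
proof -
  let ?D = "{(s, t). s \<in> B \<and> t \<in> {0..<N} - B \<and> t < s}"
  have "{(s, t). s \<in> insert 0 (Suc ` B) \<and> t \<in> {0..<Suc N} - insert 0 (Suc ` B) \<and> t < s}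
     = map_prod Suc Suc ` ?D" (is "?L = ?R")
  proof (intro equalityI subsetI)
    fix z assume "z \<in> ?L"
    then obtain s t where z: "z = (Suc s, Suc t)" "s \<in> B" "t < N" "t \<notin> B" "t < s"
      by (auto simp: gr0_conv_Suc image_iff)
    thus "z \<in> ?R" by force
  qed auto
  moreover have "card (map_prod Suc Suc ` ?D) = card ?D"
    by (rule card_image) (auto simp: inj_on_def)
  ultimately show ?thesis unfolding shuffle_sign_def by simp
qed

text \<open>Contraction with the first entry is an antiderivation of the shuffle product. This
  replaces sums over subsets of positions by induction on words; the cases \<open>p = 0\<close> and
  \<open>q = 0\<close> are split off because \<open>p - 1\<close> and \<open>q - 1\<close> are
  truncated.\<close>

lemma shuf_Cons:
  assumes len: "Suc (length u) = p + q"
  shows "shuf p q f g (x # u) = (if p = 0 then 0 else shuf (p - 1) q (\<lambda>v. f (x # v)) g u)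
     + (-1) ^ p * (if q = 0 then 0 else shuf p (q - 1) f (\<lambda>v. g (x # v)) u)"
proof -
  let ?N = "length u"
  define T where "T = (\<lambda>A. shuffle_sign (Suc ?N) A * f (nths (x # u) A) * g (nths (x # u) ({0..<Suc ?N} - A)))"
  define P where "P = (\<lambda>p. {B. B \<subseteq> {0..<?N} \<and> card B = p})"
  have fin: "finite (P p)" for p unfolding P_def by (rule finite_subset[of _ "Pow {0..<?N}"]) auto
  have finB: "finite B" if "B \<in> P p" for B p using that finite_subset[of B "{0..<?N}"] by (auto simp: P_def)
  let ?A1 = "(\<lambda>B. insert 0 (Suc ` B)) ` (if p = 0 then {} else P (p - 1))" and ?A0 = "(\<lambda>B. Suc ` B) ` P p"
  have split: "{A. A \<subseteq> {0..<Suc ?N} \<and> card A = p} = ?A1 \<union> ?A0" (is "?L = _")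
  proof (intro equalityI subsetI)
    fix A assume "A \<in> ?L"
    hence A: "A \<subseteq> {0..<Suc ?N}" "card A = p" by auto
    define B where "B = {j. Suc j \<in> A}"
    have B: "B \<subseteq> {0..<?N}" using A by (auto simp: B_def)
    hence fB: "finite B" by (rule finite_subset) simp
    have "s \<in> A \<Longrightarrow> s \<noteq> 0 \<Longrightarrow> s \<in> Suc ` B" for s by (cases s) (auto simp: B_def)
    hence "A = Suc ` B \<or> A = insert 0 (Suc ` B)" by (auto simp: B_def)
    thus "A \<in> ?A1 \<union> ?A0"
    proof
      assume AB: "A = Suc ` B"
      hence "card B = p" using A by (simp add: card_image)
      thus ?thesis using AB B by (auto simp: P_def)
    next
      assume AB: "A = insert 0 (Suc ` B)"
      hence "Suc (card B) = p" using A fB by (simp add: card_image)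
      thus ?thesis using AB B by (auto simp: P_def)
    qed
  next
    fix A assume "A \<in> ?A1 \<union> ?A0"
    thus "A \<in> ?L"
    proof
      assume "A \<in> ?A1"
      then obtain B where "p \<noteq> 0" "A = insert 0 (Suc ` B)" "B \<in> P (p - 1)" by (auto split: if_splits)
      thus ?thesis using finB[of B "p - 1"] by (auto simp: P_def card_image)
    next
      assume "A \<in> ?A0"
      thus ?thesis by (auto simp: P_def card_image)
    qed
  qed
  have inj1: "inj_on (\<lambda>B. insert 0 (Suc ` B)) X" for X
  proof (rule inj_onI)
    fix A B :: "nat set" assume "insert 0 (Suc ` A) = insert 0 (Suc ` B)"
    hence "Suc ` A = Suc ` B" by (metis Diff_insert_absorb image_iff nat.distinct(1))
    thus "A = B" by (simp add: inj_image_eq_iff)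
  qed
  have inj0: "inj_on (\<lambda>B. Suc ` B) X" for X by (auto simp: inj_on_def inj_image_eq_iff)
  have c1: "{j. Suc j \<in> {0..<Suc ?N} - insert 0 (Suc ` B)} = {0..<?N} - B"
    and c0: "{j. Suc j \<in> {0..<Suc ?N} - Suc ` B} = {0..<?N} - B"
    and c2: "{j. Suc j \<in> insert 0 (Suc ` B)} = B" "{j. Suc j \<in> Suc ` B} = B" for B
    by auto
  have T1: "T (insert 0 (Suc ` B)) = shuffle_sign ?N B * f (x # nths u B) * g (nths u ({0..<?N} - B))" for B
    unfolding T_def nths_Cons c1 c2 shuffle_sign_insert by simp
  have T0: "T (Suc ` B) = (-1) ^ p * (shuffle_sign ?N B * f (nths u B) * g (x # nths u ({0..<?N} - B)))"
    if "B \<in> P p" for B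
    unfolding T_def nths_Cons c0 c2 using shuffle_sign_Suc[OF finB[OF that], of ?N] that by (auto simp: P_def)
  have "shuf p q f g (x # u) = sum T (?A1 \<union> ?A0)"
    unfolding shuf_def T_def split[symmetric] using len by simp
  also have "\<dots> = sum T ?A1 + sum T ?A0"
    by (rule sum.union_disjoint) (use fin in auto)
  also have "sum T ?A1 = (if p = 0 then 0 else shuf (p - 1) q (\<lambda>v. f (x # v)) g u)"
  proof (cases p)
    case (Suc p')
    have "sum T ?A1 = (\<Sum>B\<in>P p'. T (insert 0 (Suc ` B)))"
      using sum.reindex[OF inj1, of T "P p'"] Suc by (simp add: comp_def)
    thus ?thesis using Suc len unfolding T1 shuf_def P_def by simp
  qed simp
  also have "sum T ?A0 = (-1) ^ p * (if q = 0 then 0 else shuf p (q - 1) f (\<lambda>v. g (x # v)) u)"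
  proof -
    have "sum T ?A0 = (\<Sum>B\<in>P p. T (Suc ` B))"
      using sum.reindex[OF inj0, of T "P p"] by (simp add: comp_def)
    also have "\<dots> = (-1) ^ p * (\<Sum>B\<in>P p. shuffle_sign ?N B * f (nths u B) * g (x # nths u ({0..<?N} - B)))"
      unfolding sum_distrib_left by (intro sum.cong refl T0)
    finally have *: "sum T ?A0 = (-1) ^ p * (\<Sum>B\<in>P p. shuffle_sign ?N B * f (nths u B) * g (x # nths u ({0..<?N} - B)))" .
    show ?thesis
    proof (cases q)
      case 0
      have "card B \<noteq> p" if "B \<subseteq> {0..<?N}" for B
        using card_mono[OF _ that] 0 len by simp
      hence "P p = {}" by (auto simp: P_def)
      thus ?thesis using * 0 by simp
    next
      case (Suc q')
      hence "?N = p + q'" using len by simp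
      hence "(\<Sum>B\<in>P p. shuffle_sign ?N B * f (nths u B) * g (x # nths u ({0..<?N} - B)))
        = shuf p q' f (\<lambda>v. g (x # v)) u" by (simp add: P_def shuf_def)
      thus ?thesis using Suc * by simp
    qed
  qed
  finally show ?thesis .
qed

lemma shuf_length: "length u \<noteq> p + q \<Longrightarrow> shuf p q f g u = 0"
  by (simp add: shuf_def)

lemma shuf_add_left: "shuf p q (\<lambda>v. f v + f' v) g u = shuf p q f g u + shuf p q f' g u"
  and shuf_add_right: "shuf p q f (\<lambda>v. g v + g' v) u = shuf p q f g u + shuf p q f g' u"
  and shuf_scale_left: "shuf p q (\<lambda>v. c * f v) g u = c * shuf p q f g u"
  and shuf_scale_right: "shuf p q f (\<lambda>v. c * g v) u = c * shuf p q f g u"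
  by (auto simp: shuf_def algebra_simps sum.distrib sum_distrib_left)

lemma shuf_minus_left: "shuf p q (\<lambda>v. - f v) g u = - shuf p q f g u"
  and shuf_minus_right: "shuf p q f (\<lambda>v. - g v) u = - shuf p q f g u"
  using shuf_scale_left[of p q "-1"] shuf_scale_right[of p q f "-1"] by simp_all

lemma shuf_zero_left: "shuf p q (\<lambda>v. 0) g u = 0" and shuf_zero_right: "shuf p q f (\<lambda>v. 0) u = 0"
  by (simp_all add: shuf_def)

section \<open>Alternation of shuffle products\<close>

definition altB :: "(bl list \<Rightarrow> real) \<Rightarrow> bool" where
  "altB f \<longleftrightarrow> (\<forall>u y z s. f (u @ y # z # s) = - f (u @ z # y # s))"

lemma altBD: "altB f \<Longrightarrow> f (u @ y # z # s) = - f (u @ z # y # s)"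
  unfolding altB_def by blast

lemma altB_Cons: "altB f \<Longrightarrow> altB (\<lambda>v. f (x # v))"
  unfolding altB_def by (metis append_Cons)

text \<open>Contract with \<open>y\<close> and then with \<open>z\<close>: the terms giving one
  letter to each factor have opposite signs in the two orders, the others are covered by the
  alternation of \<open>f\<close> or of \<open>g\<close>.\<close>

lemma altB_shuf: "altB f \<Longrightarrow> altB g \<Longrightarrow> altB (shuf p q f g)"
  unfolding altB_def[of "shuf p q f g"]
proof (intro allI)
  fix u y z s
  show "altB f \<Longrightarrow> altB g \<Longrightarrow> shuf p q f g (u @ y # z # s) = - shuf p q f g (u @ z # y # s)"
  proof (induction u arbitrary: p q f g)
    case Nil
    show ?case
    proof (cases "length s + 2 = p + q")
      case False
      thus ?thesis by (simp add: shuf_length)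
    next
      case True
      have e: "(\<lambda>v. h (y # z # v)) = (\<lambda>v. - h (z # y # v))" if "altB h" for h
        using altBD[OF that, of "[]" y z] by auto
      have e2: "shuf p q (\<lambda>v. h (y # z # v)) k s = - shuf p q (\<lambda>v. h (z # y # v)) k s"
        "shuf p q k (\<lambda>v. h (y # z # v)) s = - shuf p q k (\<lambda>v. h (z # y # v)) s" if "altB h" for h k p q
        unfolding e[OF that] shuf_minus_left shuf_minus_right by simp_all
      consider "p = 0" | "p = 1" | p' where "p = Suc (Suc p')" by (metis One_nat_def not0_implies_Suc)
      thus ?thesis
      proof cases
        case 1
        then obtain q' where q: "q = Suc (Suc q')" using True by (metis add_2_eq_Suc' add_0)
        show ?thesis using True 1 q by (simp add: shuf_Cons e2(2)[OF Nil(2)])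
      next
        case 2
        then obtain q' where q: "q = Suc q'" using True by auto
        show ?thesis using True 2 q by (cases q') (simp_all add: shuf_Cons e2(2)[OF Nil(2)])
      next
        case 3
        show ?thesis
        proof (cases q)
          case 0
          show ?thesis using True 3 0 by (simp add: shuf_Cons e2(1)[OF Nil(1)])
        next
          case (Suc q')
          show ?thesis using True 3 Suc
            by (cases q') (simp_all add: shuf_Cons e2(1)[OF Nil(1)] e2(2)[OF Nil(2)] algebra_simps)
        qed
      qed
    qed
  next
    case (Cons x u)
    show ?case
    proof (cases "length (x # u @ y # z # s) = p + q")
      case True
      have "shuf (p - 1) q (\<lambda>v. f (x # v)) g (u @ y # z # s) = - shuf (p - 1) q (\<lambda>v. f (x # v)) g (u @ z # y # s)"
        "shuf p (q - 1) f (\<lambda>v. g (x # v)) (u @ y # z # s) = - shuf p (q - 1) f (\<lambda>v. g (x # v)) (u @ z # y # s)"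
        by (rule Cons.IH; use Cons.prems in \<open>auto intro: altB_Cons\<close>)+
      thus ?thesis using True by (cases "p = 0"; simp add: shuf_Cons)
    qed (simp add: shuf_length)
  qed
qed

section \<open>Invariance of the powers under \<open>sp_n\<close>\<close>

fun vl :: "crd \<Rightarrow> bl" where
  "vl (Cx i) = DX i"
| "vl (Cy i) = DY i"

lemma lab_Lin: "lab (Lin c) = vl c"
  by (cases c) auto

lemma vl_inj [simp]: "vl c = vl d \<longleftrightarrow> c = d"
  by (cases c; cases d) auto

text \<open>The action of \<open>Quad a b\<close> on translation labels, extended by zero to the
  labels of \<open>sp_n\<close>. The powers of \<open>omega\<close> live on translation labels, and
  with this extension \<open>derB\<close> is still a derivation of the shuffle product.\<close>

fun brB :: "crd \<Rightarrow> crd \<Rightarrow> bl \<Rightarrow> (bl \<Rightarrow> real) \<Rightarrow> real" where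
  "brB a b (DX i) F = omt a b (Cx i) (\<lambda>z. F (vl z))"
| "brB a b (DY i) F = omt a b (Cy i) (\<lambda>z. F (vl z))"
| "brB a b _ F = 0"

lemma brB_vl: "brB a b (vl c) F = omt a b c (\<lambda>z. F (vl z))"
  by (cases c) auto

lemma brB_cases: "(\<exists>c. l = vl c) \<or> (\<forall>F. brB a b l F = 0)"
  by (cases l) (auto intro: exI[of _ "Cx _"] exI[of _ "Cy _"])

lemma brB_add: "brB a b l (\<lambda>z. F z + G z) = brB a b l F + brB a b l G"
  by (cases l) (auto simp: omt_def algebra_simps)

lemma brB_scale: "brB a b l (\<lambda>z. c * F z) = c * brB a b l F"
  by (cases l) (auto simp: omt_def algebra_simps)

primrec derB :: "crd \<Rightarrow> crd \<Rightarrow> (bl list \<Rightarrow> real) \<Rightarrow> bl list \<Rightarrow> real" where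
  "derB a b f [] = 0"
| "derB a b f (y # w) = derB a b (\<lambda>v. f (y # v)) w + brB a b y (\<lambda>z. f (z # w))"

lemma derB_cong: "(\<And>v. length v = length w \<Longrightarrow> f v = g v) \<Longrightarrow> derB a b f w = derB a b g w"
proof (induction w arbitrary: f g)
  case (Cons y w)
  have "derB a b (\<lambda>v. f (y # v)) w = derB a b (\<lambda>v. g (y # v)) w"
    by (rule Cons.IH) (simp add: Cons.prems)
  moreover have "(\<lambda>z. f (z # w)) = (\<lambda>z. g (z # w))" using Cons.prems by auto
  ultimately show ?case by simp
qed simp

lemma derB_add: "derB a b (\<lambda>v. f v + g v) w = derB a b f w + derB a b g w"
  by (induction w arbitrary: f g) (auto simp: brB_add)

lemma derB_scale: "derB a b (\<lambda>v. c * f v) w = c * derB a b f w"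
  by (induction w arbitrary: f) (auto simp: brB_scale algebra_simps)

lemma derB_zero: "derB a b (\<lambda>v. 0) w = 0"
  using derB_scale[of a b 0 "\<lambda>v. 0" w] by simp

lemma brB_shuf_left: "brB a b y (\<lambda>z. shuf p q (f z) g u) = shuf p q (\<lambda>v. brB a b y (\<lambda>z. f z v)) g u"
  by (cases y) (simp_all add: omt_def shuf_add_left shuf_scale_left shuf_zero_left)

lemma brB_shuf_right: "brB a b y (\<lambda>z. shuf p q f (g z) u) = shuf p q f (\<lambda>v. brB a b y (\<lambda>z. g z v)) u"
  by (cases y) (simp_all add: omt_def shuf_add_right shuf_scale_right shuf_zero_right)

lemma derB_shuf: "derB a b (shuf p q f g) u = shuf p q (derB a b f) g u + shuf p q f (derB a b g) u"
proof (induction u arbitrary: p q f g)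
  case Nil
  show ?case by (cases "p = 0 \<and> q = 0") (auto simp: shuf_def)
next
  case (Cons y u)
  show ?case
  proof (cases "Suc (length u) = p + q")
    case False
    have "derB a b (shuf p q f g) (y # u) = derB a b (\<lambda>v. 0) (y # u)"
      by (rule derB_cong) (use False in \<open>simp add: shuf_length\<close>)
    thus ?thesis using False by (simp add: shuf_length derB_zero del: derB.simps)
  next
    case True
    let ?A = "\<lambda>z v. if p = 0 then 0 else shuf (p - 1) q (\<lambda>v. f (z # v)) g v"
    let ?B = "\<lambda>z v. if q = 0 then 0 else shuf p (q - 1) f (\<lambda>v. g (z # v)) v"
    have e: "shuf p q f g (z # v) = ?A z v + (-1) ^ p * ?B z v" if "length v = length u" for z v
      using True that by (intro shuf_Cons) simp
    have 1: "derB a b (\<lambda>v. shuf p q f g (y # v)) u = derB a b (?A y) u + (-1) ^ p * derB a b (?B y) u"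
      unfolding derB_scale[symmetric] derB_add[symmetric] by (rule derB_cong) (rule e)
    have 2: "brB a b y (\<lambda>z. shuf p q f g (z # u)) = brB a b y (\<lambda>z. ?A z u) + (-1) ^ p * brB a b y (\<lambda>z. ?B z u)"
      unfolding brB_scale[symmetric] brB_add[symmetric] using e[of u] by simp
    have A: "derB a b (?A y) u + brB a b y (\<lambda>z. ?A z u)
      = (if p = 0 then 0 else shuf (p - 1) q (\<lambda>v. derB a b f (y # v)) g u + shuf (p - 1) q (\<lambda>v. f (y # v)) (derB a b g) u)"
      using brB_scale[of a b y 0 "\<lambda>_. 0"]
      by (simp add: Cons.IH brB_shuf_left shuf_add_left derB_zero)
    have B: "derB a b (?B y) u + brB a b y (\<lambda>z. ?B z u)
      = (if q = 0 then 0 else shuf p (q - 1) (derB a b f) (\<lambda>v. g (y # v)) u + shuf p (q - 1) f (\<lambda>v. derB a b g (y # v)) u)"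
      using brB_scale[of a b y 0 "\<lambda>_. 0"]
      by (simp add: Cons.IH brB_shuf_right shuf_add_right derB_zero)
    have "derB a b (shuf p q f g) (y # u)
      = (derB a b (?A y) u + brB a b y (\<lambda>z. ?A z u)) + (-1) ^ p * (derB a b (?B y) u + brB a b y (\<lambda>z. ?B z u))"
      unfolding derB.simps 1 2 by (simp only: algebra_simps)
    also have "\<dots> = shuf p q (derB a b f) g (y # u) + shuf p q f (derB a b g) (y # u)"
      unfolding A B using True by (simp add: shuf_Cons algebra_simps)
    finally show ?thesis .
  qed
qed

lemma derB_snoc: "derB a b f (w @ [y]) = derB a b (\<lambda>v. f (v @ [y])) w + brB a b y (\<lambda>z. f (w @ [z]))"
  by (induction w arbitrary: f) auto

lemma cder_rev_vl: "cder a b (\<lambda>w. f (rev (map vl w))) w = derB a b f (rev (map vl w))"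
  by (induction w arbitrary: f) (auto simp: derB_snoc brB_vl)

lemma omega_pair: "omega n [vl c, vl d] = (if c \<in> coords n then om c d else 0)"
proof (cases c)
  case (Cx i)
  have "omega n [vl c, vl d] = (\<Sum>j\<in>{1..n}. if j = i then om c d else 0)"
    unfolding omega_def Cx by (rule sum.cong) (cases d; auto simp: ind_def om_def)+
  thus ?thesis using Cx by (auto simp: coords_def)
next
  case (Cy i)
  have "omega n [vl c, vl d] = (\<Sum>j\<in>{1..n}. if j = i then om c d else 0)"
    unfolding omega_def Cy by (rule sum.cong) (cases d; auto simp: ind_def om_def)+
  thus ?thesis using Cy by (auto simp: coords_def)
qed

lemma omega_nz: "omega n ls \<noteq> 0 \<Longrightarrow> \<exists>c d. ls = [vl c, vl d] \<and> c \<in> coords n \<and> d = dual c"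
proof -
  assume nz: "omega n ls \<noteq> 0"
  then obtain i where i: "i \<in> {1..n}" "ind (ls = [DX i, DY i]) - ind (ls = [DY i, DX i]) \<noteq> 0"
    unfolding omega_def by (meson sum.neutral)
  hence "ls = [DX i, DY i] \<or> ls = [DY i, DX i]" by (auto simp: ind_def split: if_splits)
  hence "ls = [vl (Cx i), vl (Cy i)] \<or> ls = [vl (Cy i), vl (Cx i)]" by simp
  moreover have "Cx i \<in> coords n" "Cy i \<in> coords n" using i by (auto simp: coords_def)
  ultimately show ?thesis by (metis dual.simps)
qed

lemma omega_length: "length ls \<noteq> 2 \<Longrightarrow> omega n ls = 0"
  using omega_nz[of n ls] by force

lemma altB_omega: "altB (omega n)"
proof -
  have "omega n (u @ y # z # s) = - omega n (u @ z # y # s)" for u y z s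
  proof (cases "u = [] \<and> s = []")
    case True
    thus ?thesis unfolding omega_def sum_negf[symmetric] by (intro sum.cong refl) (auto simp: ind_def)
  next
    case False
    hence "length (u @ y # z # s) \<noteq> 2" "length (u @ z # y # s) \<noteq> 2" by auto
    thus ?thesis by (simp add: omega_length)
  qed
  thus ?thesis unfolding altB_def by blast
qed

lemma derB_omega:
  assumes ab: "a \<in> coords n" "b \<in> coords n"
  shows "derB a b (omega n) ls = 0"
proof (cases "length ls = 2")
  case False
  have "derB a b (omega n) ls = derB a b (\<lambda>v. 0) ls"
    by (rule derB_cong) (use False in \<open>simp add: omega_length\<close>)
  thus ?thesis by (simp add: derB_zero)
next
  case True
  then obtain l1 l2 where ls: "ls = [l1, l2]" by (auto simp: numeral_2_eq_2 length_Suc_conv)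
  have 1: "derB a b (omega n) ls = brB a b l1 (\<lambda>z. omega n [z, l2]) + brB a b l2 (\<lambda>z. omega n [l1, z])"
    by (simp add: ls)
  have o1: "\<exists>c. l = vl c" if "omega n [l, l'] \<noteq> 0" for l l' using omega_nz[OF that] by auto
  have o2: "\<exists>c. l' = vl c" if "omega n [l, l'] \<noteq> 0" for l l' using omega_nz[OF that] by auto
  show ?thesis
  proof (cases "(\<exists>c. l1 = vl c) \<and> (\<exists>d. l2 = vl d)")
    case True
    then obtain c d where cd: "l1 = vl c" "l2 = vl d" by auto
    have "omega n [vl c', vl x] = om c' x" "omega n [vl x, vl c'] = om x c'" if "x \<in> coords n" for c' x
      using that by (auto simp: omega_pair om_def)
    thus ?thesis unfolding 1 cd brB_vl omt_def using ab
      by (simp add: om_antisym[of c a] om_antisym[of c b])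
  next
    case False
    have "brB a b l1 (\<lambda>z. omega n [z, l2]) = 0"
    proof (cases "\<exists>d. l2 = vl d")
      case True
      thus ?thesis using False brB_cases[of l1 a b] by blast
    next
      case no: False
      have "omega n [z, l2] = 0" for z using o2[of z l2] no by blast
      hence "(\<lambda>z. omega n [z, l2]) = (\<lambda>z. 0 * 0)" by simp
      thus ?thesis using brB_scale[of a b l1 0 "\<lambda>_. 0"] by simp
    qed
    moreover have "brB a b l2 (\<lambda>z. omega n [l1, z]) = 0"
    proof (cases "\<exists>d. l1 = vl d")
      case True
      thus ?thesis using False brB_cases[of l2 a b] by blast
    next
      case no: False
      have "omega n [l1, z] = 0" for z using o1[of l1 z] no by blast
      hence "(\<lambda>z. omega n [l1, z]) = (\<lambda>z. 0 * 0)" by simp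
      thus ?thesis using brB_scale[of a b l2 0 "\<lambda>_. 0"] by simp
    qed
    ultimately show ?thesis using 1 by simp
  qed
qed

lemma wpow_length: "length ls \<noteq> 2 * k \<Longrightarrow> wpow w k ls = 0"
  by (cases k) (auto simp: unit_t_def ind_def shuf_length)

lemma altB_wpow: "altB (wpow (omega n) k)"
proof (induction k)
  case 0
  show ?case by (simp add: altB_def unit_t_def ind_def)
next
  case (Suc k)
  thus ?case by (simp add: altB_shuf altB_omega)
qed

lemma derB_wpow:
  assumes ab: "a \<in> coords n" "b \<in> coords n"
  shows "derB a b (wpow (omega n) k) ls = 0"
proof (induction k arbitrary: ls)
  case 0
  show ?case
  proof (cases ls)
    case (Cons y w)
    have "derB a b unit_t ls = derB a b (\<lambda>v. 0) ls"
      by (rule derB_cong) (use Cons in \<open>auto simp: unit_t_def ind_def\<close>)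
    thus ?thesis by (simp add: derB_zero)
  qed simp
next
  case (Suc k)
  have "derB a b (omega n) = (\<lambda>_. 0)" "derB a b (wpow (omega n) k) = (\<lambda>_. 0)"
    using derB_omega[OF ab] Suc by auto
  thus ?case by (simp add: derB_shuf shuf_zero_left shuf_zero_right)
qed

lemma shuf_supp:
  "shuf p q f g u \<noteq> 0 \<Longrightarrow> (\<And>v. f v \<noteq> 0 \<Longrightarrow> set v \<subseteq> X) \<Longrightarrow> (\<And>v. g v \<noteq> 0 \<Longrightarrow> set v \<subseteq> X) \<Longrightarrow> set u \<subseteq> X"
proof (induction u arbitrary: p q f g)
  case (Cons x u)
  have len: "Suc (length u) = p + q" using Cons.prems(1) shuf_length[of "x # u"] by fastforce
  let ?A = "shuf (p - 1) q (\<lambda>v. f (x # v)) g u" and ?B = "shuf p (q - 1) f (\<lambda>v. g (x # v)) u"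
  from Cons.prems(1) have AB: "?A \<noteq> 0 \<or> ?B \<noteq> 0" unfolding shuf_Cons[OF len] by (auto split: if_splits)
  hence x: "x \<in> X"
  proof
    assume A: "?A \<noteq> 0"
    have "\<exists>v. f (x # v) \<noteq> 0"
    proof (rule ccontr)
      assume "\<nexists>v. f (x # v) \<noteq> 0"
      hence "(\<lambda>v. f (x # v)) = (\<lambda>v. 0)" by auto
      thus False using A shuf_zero_left by metis
    qed
    thus ?thesis using Cons.prems(2) by force
  next
    assume B: "?B \<noteq> 0"
    have "\<exists>v. g (x # v) \<noteq> 0"
    proof (rule ccontr)
      assume "\<nexists>v. g (x # v) \<noteq> 0"
      hence "(\<lambda>v. g (x # v)) = (\<lambda>v. 0)" by auto
      thus False using B shuf_zero_right by metis
    qed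
    thus ?thesis using Cons.prems(3) by force
  qed
  from AB have "set u \<subseteq> X"
  proof
    assume "?A \<noteq> 0"
    thus ?thesis by (rule Cons.IH) (use Cons.prems(2)[of "x # _"] Cons.prems(3) in auto)
  next
    assume "?B \<noteq> 0"
    thus ?thesis by (rule Cons.IH) (use Cons.prems(2) Cons.prems(3)[of "x # _"] in auto)
  qed
  thus ?case using x by simp
qed simp

lemma wpow_supp: "wpow (omega n) k ls \<noteq> 0 \<Longrightarrow> set ls \<subseteq> vl ` coords n"
proof (induction k arbitrary: ls)
  case 0
  thus ?case by (auto simp: unit_t_def ind_def split: if_splits)
next
  case (Suc k)
  have "set v \<subseteq> vl ` coords n" if "omega n v \<noteq> 0" for v
    using omega_nz[OF that] by auto
  thus ?case using Suc shuf_supp[of 2 "2 * k" "omega n" "wpow (omega n) k" ls "vl ` coords n"] by auto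
qed

lemma shuf_0: "length s = q \<Longrightarrow> shuf 0 q f g s = f [] * g s"
proof (induction s arbitrary: q g)
  case Nil
  have "{A. A = {} \<and> card A = 0} = {{} :: nat set}" by auto
  thus ?case using Nil by (simp add: shuf_def shuffle_sign_def)
next
  case (Cons x s)
  thus ?case by (auto simp: shuf_Cons)
qed

lemma shuf_1_zero: "(\<And>l. l \<in> set s \<Longrightarrow> f [l] = 0) \<Longrightarrow> shuf 1 q f g s = 0"
proof (induction s arbitrary: q g)
  case Nil
  show ?case by (simp add: shuf_length)
next
  case (Cons x s)
  show ?case
  proof (cases "Suc (length s) = 1 + q")
    case True
    have "shuf 0 q (\<lambda>v. f (x # v)) g s = 0" using True Cons.prems[of x] by (simp add: shuf_0)
    thus ?thesis using Cons True by (simp add: shuf_Cons)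
  qed (simp add: shuf_length)
qed

section \<open>Nonvanishing of the powers\<close>

primrec prB :: "nat list \<Rightarrow> bl list" where
  "prB [] = []"
| "prB (i # is) = DY i # DX i # prB is"

lemma length_prB [simp]: "length (prB is) = 2 * length is"
  by (induction "is") auto

lemma set_prB: "set (prB is) = DX ` set is \<union> DY ` set is"
  by (induction "is") auto

text \<open>\<open>omega\<close> pairs \<open>DY i\<close> with \<open>DX i\<close> only, so among
  the two-element sets of positions just the \<open>length is\<close> adjacent pairs count. Each
  contributes the value \<open>-1\<close> of \<open>omega\<close>, and moving an adjacent pair to
  the front costs no sign.\<close>

lemma shuf_omega_prB:
  "distinct is \<Longrightarrow> set is \<subseteq> {1..n} \<Longrightarrow> q + 2 = 2 * length is \<Longrightarrow>
   (\<And>i. i \<in> set is \<Longrightarrow> f (prB (remove1 i is)) = c) \<Longrightarrow>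
   shuf 2 q (omega n) f (prB is) = - real (length is) * c"
proof (induction "is" arbitrary: f q)
  case (Cons i js)
  have i: "i \<in> {1..n}" "i \<notin> set js" using Cons.prems by auto
  have q: "q = 2 * length js" using Cons.prems(3) by simp
  have om1: "omega n [DY i, DX i] = -1"
    using omega_pair[of n "Cy i" "Cx i"] i by (auto simp: om_def coords_def)
  have omy: "omega n [DY i, l] = 0" if "l \<noteq> DX i" for l
    using omega_nz[of n "[DY i, l]"] that vl_inj[of "Cy i"] by (metis dual.simps(2) list.inject vl.simps)
  have omx: "omega n [DX i, l] = 0" if "l \<noteq> DY i" for l
    using omega_nz[of n "[DX i, l]"] that vl_inj[of "Cx i"] by (metis dual.simps(1) list.inject vl.simps)
  have s1: "shuf 1 q' (\<lambda>v. omega n (DY i # v)) g (prB js) = 0" for q' g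
  proof (rule shuf_1_zero)
    fix l assume "l \<in> set (prB js)"
    hence "l \<noteq> DX i" using i by (auto simp: set_prB)
    thus "omega n [DY i, l] = 0" by (rule omy)
  qed
  have s1': "shuf 1 q' (\<lambda>v. omega n (DX i # v)) g (prB js) = 0" for q' g
  proof (rule shuf_1_zero)
    fix l assume "l \<in> set (prB js)"
    hence "l \<noteq> DY i" using i by (auto simp: set_prB)
    thus "omega n [DX i, l] = 0" by (rule omx)
  qed
  have s0: "shuf 0 q (\<lambda>v. omega n (DY i # DX i # v)) f (prB js) = - c"
    using Cons.prems(4)[of i] by (simp add: shuf_0 q om1)
  have s2: "shuf 2 (q - 2) (omega n) (\<lambda>v. f (DY i # DX i # v)) (prB js) = - real (length js) * c" if "js \<noteq> []"
  proof (rule Cons.IH)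
    show "q - 2 + 2 = 2 * length js" using q that by (cases js) auto
    fix j assume "j \<in> set js"
    thus "f (DY i # DX i # prB (remove1 j js)) = c" using Cons.prems(4)[of j] i by auto
  qed (use Cons.prems in auto)
  have "shuf 2 q (omega n) f (prB (i # js)) =
     shuf 1 q (\<lambda>v. omega n (DY i # v)) f (DX i # prB js)
     + (if q = 0 then 0 else shuf 2 (q - 1) (omega n) (\<lambda>v. f (DY i # v)) (DX i # prB js))"
    using q by (simp add: shuf_Cons)
  also have "shuf 1 q (\<lambda>v. omega n (DY i # v)) f (DX i # prB js) = - c"
    using q s0 s1 s1' by (simp add: shuf_Cons)
  also have "(if q = 0 then 0 else shuf 2 (q - 1) (omega n) (\<lambda>v. f (DY i # v)) (DX i # prB js)) = - real (length js) * c"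
  proof (cases "q = 0")
    case True
    thus ?thesis using q by simp
  next
    case False
    hence "js \<noteq> []" "q - 1 \<noteq> 0" "q - 1 - 1 = q - 2" using q by (cases js; auto)+
    thus ?thesis using False q s1 s1' s2 by (simp add: shuf_Cons)
  qed
  finally show ?case by (simp add: algebra_simps)
qed simp

lemma wpow_prB: "distinct is \<Longrightarrow> set is \<subseteq> {1..n} \<Longrightarrow> length is = k \<Longrightarrow> wpow (omega n) k (prB is) = (-1) ^ k * fact k"
proof (induction k arbitrary: "is")
  case 0
  thus ?case by (simp add: unit_t_def ind_def)
next
  case (Suc k)
  have "shuf 2 (2 * k) (omega n) (wpow (omega n) k) (prB is) = - real (length is) * ((-1) ^ k * fact k)"
  proof (rule shuf_omega_prB)
    fix i assume "i \<in> set is"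
    thus "wpow (omega n) k (prB (remove1 i is)) = (-1) ^ k * fact k"
      using Suc.prems by (intro Suc.IH) (auto simp: length_remove1)
  qed (use Suc.prems in auto)
  thus ?case using Suc.prems by (simp add: algebra_simps)
qed

lemma rev_vl_prs: "rev (map vl (prs is)) = prB (rev is)"
proof (induction "is")
  case (Cons i js)
  have "prB (u @ v) = prB u @ prB v" for u v by (induction u) auto
  thus ?case using Cons by simp
qed simp

section \<open>The Leibniz (co)homology\<close>

text \<open>A removed letter leaves its image at the place of the quadratic letter. By alternation
  the image can be moved back to where the removed letter was, and the sign in
  \<open>removal\<close> is the cost of that move.\<close>

lemma rel_eq_cder:
  "altC C p h \<Longrightarrow> set (t @ s) \<subseteq> C \<Longrightarrow> c \<in> C \<Longrightarrow> d \<in> C \<Longrightarrow> length (t @ s) = p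
    \<Longrightarrow> removal c d (\<lambda>u a. h (u @ a # s)) t = cder c d (\<lambda>v. h (v @ s)) t"
proof (induction t arbitrary: h p)
  case (Cons e t)
  have p: "p = Suc (length (t @ s))" using Cons.prems by simp
  have "h (a # t @ s) = (-1) ^ length t * h (t @ a # s)" if "a \<in> C" for a
    by (rule altC_move[OF Cons.prems(1)]) (use Cons.prems that in auto)
  hence "omt c d e (\<lambda>z. h (z # t @ s)) = (-1) ^ length t * omt c d e (\<lambda>a. h (t @ a # s))"
    using Cons.prems by (simp add: omt_def algebra_simps)
  moreover have "removal c d (\<lambda>u a. h (e # u @ a # s)) t = cder c d (\<lambda>v. h (e # v @ s)) t"
    by (rule Cons.IH[OF altC_Cons]) (use Cons.prems p in auto)
  ultimately show ?case by simp
qed simp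

lemma cder_append: "cder c d h (t @ s) = cder c d (\<lambda>v. h (v @ s)) t + cder c d (\<lambda>v. h (t @ v)) s"
  by (induction t arbitrary: h) auto

lemma cnt_one: "num_quad 0 w = 1 \<Longrightarrow> \<exists>t c d s. w = map Lin t @ Quad c d # map Lin s"
proof (induction w)
  case (Cons y w)
  show ?case
  proof (cases y)
    case (Lin a)
    then obtain t c d s where "w = map Lin t @ Quad c d # map Lin s" using Cons by auto
    thus ?thesis using Lin by (intro exI[of _ "a # t"]) auto
  next
    case (Quad c d)
    hence "num_quad 0 w = 0" using Cons.prems by simp
    then obtain s where "w = map Lin s" using cnt0_decomp[of 0 w] by auto
    thus ?thesis using Quad by (intro exI[of _ "[]"]) auto
  qed
qed simp

text \<open>By the grading only words with a single quadratic letter matter. There, thanks to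
  alternation, the terms of the coboundary add up to the action of that letter on the whole
  remaining word.\<close>

lemma invariant_alternating_cocycle:
  assumes g0: "\<And>w. w \<in> words n m \<Longrightarrow> num_quad 0 w \<noteq> 0 \<Longrightarrow> g w = 0"
    and alt: "altC (coords n) m (\<lambda>w. g (map Lin w))"
    and inv: "\<And>a b w. a \<in> coords n \<Longrightarrow> b \<in> coords n \<Longrightarrow> cder a b (\<lambda>w. g (map Lin w)) w = 0"
    and w: "w \<in> words n (Suc m)"
  shows "del 0 g w = 0"
proof (rule ccontr)
  assume nz: "del 0 g w \<noteq> 0"
  then obtain v where "v \<in> words n m" "num_quad 0 w = Suc (num_quad 0 v)" "g v \<noteq> 0"
    using del_cnt_witness[OF nz w] by blast
  hence "num_quad 0 w = 1" using g0 by auto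
  then obtain t c d s where ws: "w = map Lin t @ Quad c d # map Lin s" using cnt_one by blast
  have C: "set (t @ s) \<subseteq> coords n" "c \<in> coords n" "d \<in> coords n" "length (t @ s) = m"
    using w ws by (auto simp: words_def)
  have s0: "num_quad 0 (map Lin s) = 0" using cnt_Lin[of 0 s "[]"] by simp
  let ?h = "\<lambda>w. g (map Lin w)"
  have "lie 0 (Quad c d) (\<lambda>v. g (map Lin t @ v)) (map Lin s) = cder c d (\<lambda>v. ?h (t @ v)) s"
    using lie_map_Lin[of 0 c d "\<lambda>v. g (map Lin t @ v)" s "[]"] by simp
  moreover have "removal c d (\<lambda>u a. g (map Lin u @ Lin a # map Lin s)) t = cder c d (\<lambda>v. ?h (v @ s)) t"
    using rel_eq_cder[OF alt C(1) C(2,3,4)] by simp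
  ultimately have "del 0 g w = (-1) ^ (length s + 1) * cder c d ?h (t @ s)"
    unfolding ws using del_word[OF s0, of g t c d] by (simp add: cder_append algebra_simps)
  thus False using nz inv C by simp
qed

lemma raw_map_Lin: "raw f (map Lin w) = f (rev (map vl w))"
proof -
  have "scl (map Lin w) = 1" by (induction w) auto
  moreover have "map lab (map Lin w) = map vl w" by (simp add: lab_Lin)
  ultimately show ?thesis by (simp only: raw_def mult_1)
qed

lemma raw_wpow_Lin: "altC (coords n) m (\<lambda>w. raw (wpow (omega n) k) (map Lin w))"
  unfolding altC_def raw_map_Lin
proof (intro allI impI)
  fix u y z s
  show "wpow (omega n) k (rev (map vl (u @ y # z # s))) = - wpow (omega n) k (rev (map vl (u @ z # y # s)))"
    using altBD[OF altB_wpow, of n k "rev (map vl s)" "vl z" "vl y" "rev (map vl u)"] by simp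
qed

lemma cder_raw_wpow:
  "a \<in> coords n \<Longrightarrow> b \<in> coords n \<Longrightarrow> cder a b (\<lambda>w. raw (wpow (omega n) k) (map Lin w)) w = 0"
  unfolding raw_map_Lin cder_rev_vl by (rule derB_wpow)

lemma lab_eq_vl: "lab y = vl c \<Longrightarrow> y = Lin c"
  by (cases y rule: lab.cases; cases c) (auto split: if_splits)

lemma raw_wpow_Quad: "num_quad 0 w \<noteq> 0 \<Longrightarrow> raw (wpow (omega n) k) w = 0"
proof (rule ccontr)
  assume "raw (wpow (omega n) k) w \<noteq> 0"
  hence "set (rev (map lab w)) \<subseteq> vl ` coords n" by (intro wpow_supp[of n k]) (auto simp: raw_def)
  hence "lab y \<in> vl ` coords n" if "y \<in> set w" for y using that by auto
  hence "\<exists>c. y = Lin c" if "y \<in> set w" for y using that lab_eq_vl by blast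
  hence "num_quad 0 w = 0" by (induction w) fastforce+
  moreover assume "num_quad 0 w \<noteq> 0"
  ultimately show False by simp
qed

lemma vl_basis: "c \<in> coords n \<Longrightarrow> vl c \<in> basis n"
  using lab_basis[of "Lin c" n] by (simp add: lab_Lin)

lemma wpow_chain: "wpow (omega n) k \<in> chains n (2 * k)"
  unfolding chains_def
proof (intro CollectI allI impI, rule ccontr)
  fix ls assume "ls \<notin> tuples n (2 * k)" and nz: "wpow (omega n) k ls \<noteq> 0"
  moreover have "length ls = 2 * k" using nz wpow_length by metis
  moreover have "set ls \<subseteq> basis n" using wpow_supp[OF nz] vl_basis by auto
  ultimately show False by (simp add: tuples_def)
qed

lemma wpow_cocycle: "cod n (2 * k) (wpow (omega n) k) = zf"
proof
  fix ls
  show "cod n (2 * k) (wpow (omega n) k) ls = zf ls"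
  proof (cases "ls \<in> tuples n (Suc (2 * k))")
    case True
    thus ?thesis
    proof (rule raw_words_eq[rotated])
      fix w assume w: "w \<in> words n (Suc (2 * k))"
      have "del 0 (raw (wpow (omega n) k)) w = 0"
        by (rule invariant_alternating_cocycle[OF raw_wpow_Quad raw_wpow_Lin cder_raw_wpow w])
      thus "raw (cod n (2 * k) (wpow (omega n) k)) w = raw zf w"
        using del_raw_cod[OF w, of "wpow (omega n) k"] by (simp add: raw_def zf_def)
    qed
  qed (simp add: cod_def zf_def)
qed

lemma br_vl: "c \<in> coords n \<Longrightarrow> d \<in> coords n \<Longrightarrow> br n (vl c) (vl d) l = 0"
  using br_eq[of "Lin c" n "Lin d"] by (simp add: lab_Lin)

text \<open>The powers are supported on words of translations, and translations commute.\<close>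

lemma wpow_cycle: "bd n m (wpow (omega n) k) = zf"
proof
  fix gs
  have "wpow (omega n) k ls * dbasis n ls gs = 0" for ls
  proof (cases "wpow (omega n) k ls = 0")
    case False
    have "br n (ls ! i) (ls ! j) l = 0" if "j < length ls" "i < j" for i j l
    proof -
      have "ls ! i \<in> vl ` coords n" "ls ! j \<in> vl ` coords n"
        using that wpow_supp[OF False] by (auto simp: subset_iff)
      thus ?thesis by (auto simp: br_vl)
    qed
    hence "dbasis n ls gs = 0" unfolding dbasis_def by (intro sum.neutral ballI) auto
    thus ?thesis by simp
  qed simp
  thus "bd n m (wpow (omega n) k) gs = zf gs" unfolding bd_def zf_def by (intro sum.neutral ballI)
qed

section \<open>Duality between chains and cochains\<close>

lemma cod_bd: "(\<Sum>ls\<in>tuples n (Suc m). cod n m f ls * t ls) = (\<Sum>gs\<in>tuples n m. f gs * bd n (Suc m) t gs)"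
proof -
  have "(\<Sum>ls\<in>tuples n (Suc m). cod n m f ls * t ls) = (\<Sum>ls\<in>tuples n (Suc m). \<Sum>gs\<in>tuples n m. f gs * (t ls * dbasis n ls gs))"
    by (simp add: cod_def sum_distrib_right sum_distrib_left algebra_simps)
  thus ?thesis by (subst (asm) sum.swap) (simp add: bd_def sum_distrib_left)
qed

lemma dbasis_supp:
  assumes ls: "ls \<in> tuples n (Suc m)" and nz: "dbasis n ls gs \<noteq> 0"
  shows "gs \<in> tuples n m"
proof -
  obtain i j where ij: "i < j" "j < length ls" and g: "length gs + 1 = length ls"
      "\<forall>p<length gs. p \<noteq> i \<longrightarrow> gs ! p = remove_at j ls ! p" and b: "br n (ls ! i) (ls ! j) (gs ! i) \<noteq> 0"
  proof (rule ccontr)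
    assume "\<not> thesis"
    hence "dbasis n ls gs = 0" unfolding dbasis_def using that by (intro sum.neutral ballI) auto
    thus False using nz by simp
  qed
  have l: "length ls = Suc m" "set ls \<subseteq> basis n" using ls by (auto simp: tuples_def)
  have "gs ! p \<in> basis n" if p: "p < length gs" for p
  proof (cases "p = i")
    case True
    have "ls ! i \<in> basis n" "ls ! j \<in> basis n" using ij l by (auto simp: subset_iff)
    thus ?thesis using True b br_supp by blast
  next
    case False
    have "p < length (remove_at j ls)" using p g(1) l ij by (simp add: length_remove_at)
    hence "remove_at j ls ! p \<in> basis n" using set_remove_at[of j ls] l nth_mem by blast
    thus ?thesis using g(2) p False by simp
  qed
  thus ?thesis using g l by (auto simp: tuples_def in_set_conv_nth)
qed

lemma bd_chain: "bd n (Suc m) t \<in> chains n m"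
  unfolding chains_def bd_def using dbasis_supp[of _ n m] by (auto intro!: sum.neutral)

lemma cod_cod: "cod n (Suc m) (cod n m f) = zf"
proof
  fix ls
  show "cod n (Suc m) (cod n m f) ls = zf ls"
  proof (cases "ls \<in> tuples n (Suc (Suc m))")
    case True
    thus ?thesis
    proof (rule raw_words_eq[rotated])
      fix w assume w: "w \<in> words n (Suc (Suc m))"
      have "del 0 (raw (cod n m f)) w = del 0 (del 0 (raw f)) w"
        by (rule del_words_cong[OF _ w]) (simp add: del_raw_cod)
      thus "raw (cod n (Suc m) (cod n m f)) w = raw zf w"
        using del_raw_cod[OF w, of "cod n m f"] by (simp add: del_del raw_def zf_def)
    qed
  qed (simp add: cod_def zf_def)
qed

lemma bd_add: "bd n m (\<lambda>l. a * s l + b * t l) gs = a * bd n m s gs + b * bd n m t gs"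
  by (simp add: bd_def algebra_simps sum.distrib sum_distrib_left)

lemma cod_add: "cod n m (\<lambda>l. a * s l + b * t l) gs = a * cod n m s gs + b * cod n m t gs"
  by (simp add: cod_def algebra_simps sum.distrib sum_distrib_left)

lemma Lam_cases:
  assumes "a \<in> Lam w m"
  obtains c k where "m = 2 * k" "a = (\<lambda>l. c * wpow w k l)" | "a = zf"
  using assms by (auto simp: Lam_def)

lemma Lam_chain: "a \<in> Lam (omega n) m \<Longrightarrow> a \<in> chains n m"
  by (erule Lam_cases) (use wpow_chain in \<open>auto simp: chains_def zf_def\<close>)

lemma Lam_bd: "a \<in> Lam (omega n) m \<Longrightarrow> bd n m a = zf"
proof (erule Lam_cases)
  fix c k assume "a = (\<lambda>l. c * wpow (omega n) k l)"
  thus "bd n m a = zf" using bd_add[of n m c "wpow (omega n) k" 0 zf] by (auto simp: wpow_cycle zf_def)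
qed (simp add: bd_def zf_def)

lemma Lam_cod: "a \<in> Lam (omega n) m \<Longrightarrow> cod n m a = zf"
proof (erule Lam_cases)
  fix c k assume "m = 2 * k" "a = (\<lambda>l. c * wpow (omega n) k l)"
  thus "cod n m a = zf" using cod_add[of n m c "wpow (omega n) k" 0 zf] wpow_cocycle[of n k] by (auto simp: zf_def)
qed (auto simp: cod_def zf_def)

lemma chain_square_zero:
  assumes "a \<in> chains n m" "(\<Sum>l\<in>tuples n m. a l * a l) = 0"
  shows "a = zf"
proof
  fix l
  have "\<forall>l\<in>tuples n m. a l * a l = 0" using assms(2) by (subst (asm) sum_nonneg_eq_0_iff) auto
  thus "a l = zf l" using assms(1) by (cases "l \<in> tuples n m") (auto simp: chains_def zf_def)
qed

text \<open>A chain that is at once a cycle and a coboundary is orthogonal to itself.\<close>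

lemma Lam_coboundary:
  assumes a: "a \<in> Lam (omega n) m" "a \<in> coboundaries n m"
  shows "a = zf"
proof (cases m)
  case 0
  thus ?thesis using a by simp
next
  case (Suc m')
  then obtain k where k: "a = cod n m' k" using a by auto
  have "(\<Sum>l\<in>tuples n m. a l * a l) = (\<Sum>gs\<in>tuples n m'. k gs * bd n m a gs)"
    using cod_bd[of n m' k a] k Suc by simp
  thus ?thesis using chain_square_zero[OF Lam_chain[OF a(1)]] Lam_bd[OF a(1)] by (simp add: zf_def)
qed

lemma Lam_boundary:
  assumes a: "a \<in> Lam (omega n) m" "a \<in> boundaries n m"
  shows "a = zf"
proof -
  obtain t where t: "a = bd n (Suc m) t" using a by (auto simp: boundaries_def)
  have "(\<Sum>l\<in>tuples n m. a l * a l) = (\<Sum>ls\<in>tuples n (Suc m). cod n m a ls * t ls)"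
    using cod_bd[of n m a t] t by simp
  thus ?thesis using chain_square_zero[OF Lam_chain[OF a(1)]] Lam_cod[OF a(1)] by (simp add: zf_def)
qed

lemma bottom_multiple:
  assumes z: "z \<in> cocycles n m"
  shows "\<exists>a\<in>Lam (omega n) m. \<forall>w\<in>words n m. num_quad 0 w = 0 \<longrightarrow> raw z w = raw a w"
proof -
  define g where "g = (\<lambda>w. if num_quad 0 w = 0 then raw z w else 0)"
  have cyc: "del 0 (raw z) w = 0" if "w \<in> words n (Suc m)" for w
    using that z del_raw_cod[OF that, of z] by (simp add: cocycles_def raw_def zf_def)
  have gcyc: "del 0 g w = 0" if "w \<in> words n (Suc m)" for w
    unfolding g_def using cyc that by (rule del_bottom)
  have cntL: "num_quad 0 (map Lin v) = 0" for v using cnt_Lin[of 0 v "[]"] by simp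
  define h where "h = (\<lambda>v. raw z (map Lin v))"
  have hg: "g (map Lin v) = h v" for v by (simp add: g_def h_def cntL)
  have alt: "altC (coords n) m h"
    using bottom_alternating[of 0 m n g "[]"] gcyc by (simp add: hg words_def)
  have inv: "cder a b h v = 0" if "a \<in> coords n" "b \<in> coords n" "set v \<subseteq> coords n" "length v = m" for a b v
  proof -
    have "map Lin v \<in> words n m" using that by (auto simp: words_def)
    hence "lie 0 (Quad a b) g (map Lin v) = 0"
      by (intro bottom_invariant[OF _ _ gcyc]) (use that in \<open>auto simp: g_def\<close>)
    thus ?thesis using lie_map_Lin[of 0 a b g v "[]"] by (simp add: hg)
  qed
  have reduce: "\<exists>a\<in>Lam (omega n) m. \<forall>w\<in>words n m. num_quad 0 w = 0 \<longrightarrow> raw z w = raw a w"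
    if a: "a \<in> Lam (omega n) m" "\<And>v. set v \<subseteq> coords n \<Longrightarrow> length v = m \<Longrightarrow> h v = raw a (map Lin v)" for a
  proof (intro bexI[OF _ a(1)] ballI impI)
    fix w assume w: "w \<in> words n m" "num_quad 0 w = 0"
    then obtain v where v: "w = map Lin v" using cnt0_decomp[of 0 w] by auto
    have "set v \<subseteq> coords n" "length v = m" using w v by (auto simp: words_def)
    thus "raw z w = raw a w" using a(2)[of v] by (simp add: v h_def)
  qed
  show ?thesis
  proof (cases "\<exists>k. m = 2 * k \<and> k \<le> n")
    case True
    then obtain k where k: "m = 2 * k" "k \<le> n" by auto
    define W where "W = wpow (omega n) k"
    have "raw W (map Lin (prs [1..<Suc k])) = (-1) ^ k * fact k"
      unfolding raw_map_Lin rev_vl_prs W_def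
      by (rule wpow_prB) (use k in \<open>auto simp del: upt_Suc\<close>)
    hence nz: "raw W (map Lin (prs [1..<Suc k])) \<noteq> 0" by simp
    \<comment> \<open>The factor is forced by the standard word; dividing is possible because the
      power takes the value \<open>(-1) ^ k * fact k\<close> there.\<close>
    define c where "c = h (prs [1..<Suc k]) / raw W (map Lin (prs [1..<Suc k]))"
    have "h v + (- c) * raw W (map Lin v) = 0" if v: "set v \<subseteq> coords n" "length v = m" for v
    proof (rule invariant_form_unique[OF _ _ _ v])
      show "altC (coords n) m (\<lambda>v. h v + (- c) * raw W (map Lin v))"
        unfolding altC_def
      proof (intro allI impI)
        fix u y z s assume *: "set (u @ y # z # s) \<subseteq> coords n" "length (u @ y # z # s) = m"
        show "h (u @ y # z # s) + (- c) * raw W (map Lin (u @ y # z # s))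
          = - (h (u @ z # y # s) + (- c) * raw W (map Lin (u @ z # y # s)))"
          unfolding altCD[OF alt *] W_def altCD[OF raw_wpow_Lin *] by simp
      qed
      show "cder a b (\<lambda>v. h v + (- c) * raw W (map Lin v)) v = 0"
        if "a \<in> coords n" "b \<in> coords n" "set v \<subseteq> coords n" "length v = m" for a b v
        unfolding cder_add cder_scale W_def using inv[OF that] cder_raw_wpow[OF that(1,2)] by simp
      show "h (prs [1..<Suc k']) + (- c) * raw W (map Lin (prs [1..<Suc k'])) = 0" if "m = 2 * k'" for k'
        using that k nz by (simp add: c_def del: upt_Suc)
    qed
    hence "h v = raw (\<lambda>l. c * W l) (map Lin v)" if "set v \<subseteq> coords n" "length v = m" for v
      using that by (simp add: raw_def)
    thus ?thesis using k by (intro reduce[of "\<lambda>l. c * W l"]) (auto simp: Lam_def W_def)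
  next
    case False
    \<comment> \<open>In odd degree, or in degree above \<open>2 * n\<close>, no standard word
      exists, so the uniqueness lemma forces \<open>h\<close> to vanish.\<close>
    have "h v = 0" if "set v \<subseteq> coords n" "length v = m" for v
      by (rule invariant_form_unique[OF alt inv _ that]) (use False in auto)
    thus ?thesis by (intro reduce[of zf]) (auto simp: Lam_def raw_def zf_def)
  qed
qed

lemma cocycle_representative:
  assumes z: "z \<in> cocycles n m"
  shows "\<exists>a\<in>Lam (omega n) m. (\<lambda>l. z l - a l) \<in> coboundaries n m"
proof -
  obtain a where a: "a \<in> Lam (omega n) m" "\<And>w. w \<in> words n m \<Longrightarrow> num_quad 0 w = 0 \<Longrightarrow> raw z w = raw a w"
    using bottom_multiple[OF z] by blast
  have ch: "z \<in> chains n m" "a \<in> chains n m" using z Lam_chain[OF a(1)] by (auto simp: cocycles_def)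
  let ?y = "\<lambda>l. z l - a l"
  have yraw: "raw ?y w = raw z w - raw a w" for w by (simp add: raw_def algebra_simps)
  have cody: "cod n m ?y ls = 0" for ls
    using cod_add[of n m 1 z "-1" a ls] z Lam_cod[OF a(1)] by (simp add: cocycles_def zf_def)
  have ex: "\<exists>k. symQ k \<and> (\<forall>w\<in>words n m. raw ?y w = del 0 k w)"
  proof (rule del_exact[OF symQ_raw])
    fix w assume "w \<in> words n (Suc m)"
    thus "del 0 (raw ?y) w = 0" using del_raw_cod[of w n m ?y] by (simp add: raw_def cody)
  next
    fix w assume "w \<in> words n m" "num_quad 0 w = 0"
    thus "raw ?y w = 0" using a(2) by (simp add: yraw)
  qed
  then obtain k where k: "symQ k" "\<And>w. w \<in> words n m \<Longrightarrow> raw ?y w = del 0 k w" by blast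
  show ?thesis
  proof (cases m)
    case 0
    \<comment> \<open>In degree 0 the only coboundary is \<open>zf\<close>, so the difference itself
      has to vanish; it does, because \<open>del 0 k []\<close> is zero.\<close>
    have "?y l = 0" for l
    proof (cases "l \<in> tuples n m")
      case True
      show ?thesis
        by (rule raw_words_eq[OF _ True, of ?y "\<lambda>_. 0"]) (use k(2) 0 in \<open>auto simp: words_def raw_def\<close>)
    qed (use ch in \<open>auto simp: chains_def\<close>)
    thus ?thesis using a(1) 0 by (intro bexI[OF _ a(1)]) (auto simp: zf_def)
  next
    case (Suc m')
    obtain f where f: "f \<in> chains n m'" "\<And>w. w \<in> words n m' \<Longrightarrow> raw f w = k w"
      using raw_surj[OF k(1)] by blast
    have "?y = cod n m' f"
    proof
      fix l show "?y l = cod n m' f l"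
      proof (cases "l \<in> tuples n m")
        case True
        show ?thesis
        proof (rule raw_words_eq[OF _ True])
          fix w assume w: "w \<in> words n m"
          hence "del 0 k w = del 0 (raw f) w"
            using del_words_cong[of n m' k "raw f" w 0] f(2) Suc by simp
          thus "raw ?y w = raw (cod n m' f) w" using k(2)[OF w] del_raw_cod[of w n m' f] w Suc by simp
        qed
      qed (use ch Suc in \<open>auto simp: chains_def cod_def\<close>)
    qed
    thus ?thesis using a(1) f(1) Suc by (intro bexI[OF _ a(1)]) auto
  qed
qed

text \<open>A Hodge argument. Subtracting from \<open>z\<close> its projection \<open>u\<close> to
  the boundaries leaves a cocycle \<open>z'\<close>, to which the result on cocycles applies. The
  resulting coboundary \<open>y\<close> is orthogonal to the cycles \<open>z\<close> and
  \<open>a\<close> and to the boundary \<open>u\<close>, hence to itself.\<close>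

lemma cycle_representative:
  assumes z: "z \<in> cycles n m"
  shows "\<exists>a\<in>Lam (omega n) m. (\<lambda>l. z l - a l) \<in> boundaries n m"
proof -
  have zc: "z \<in> chains n m" and bdz: "bd n m z = zf" using z by (auto simp: cycles_def)
  let ?U = "boundaries n m"
  have sub: "subsp ?U"
    unfolding subsp_def boundaries_def
  proof (intro conjI ballI allI)
    show "(\<lambda>_. 0) \<in> bd n (Suc m) ` chains n (Suc m)"
      by (rule image_eqI[of _ _ zf]) (auto simp: bd_def zf_def chains_def)
    fix f g a b assume "f \<in> bd n (Suc m) ` chains n (Suc m)" "g \<in> bd n (Suc m) ` chains n (Suc m)"
    then obtain s t where "s \<in> chains n (Suc m)" "t \<in> chains n (Suc m)" "f = bd n (Suc m) s" "g = bd n (Suc m) t" by auto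
    thus "(\<lambda>w. a * f w + b * g w) \<in> bd n (Suc m) ` chains n (Suc m)"
      by (intro image_eqI[of _ _ "\<lambda>l. a * s l + b * t l"]) (auto simp: bd_add chains_def)
  qed
  have supp: "u l = 0" if "u \<in> ?U" "l \<notin> tuples n m" for u l
    using that bd_chain[of n m] by (auto simp: boundaries_def chains_def)
  obtain u where u: "u \<in> ?U" "\<And>v. v \<in> ?U \<Longrightarrow> (\<Sum>l\<in>tuples n m. (z l - u l) * v l) = 0"
    using orthogonal_projection[of "tuples n m" ?U z] finite_tuples sub supp by blast
  obtain t where t: "t \<in> chains n (Suc m)" "u = bd n (Suc m) t" using u(1) by (auto simp: boundaries_def)
  define z' where "z' = (\<lambda>l. z l - u l)"
  have z'c: "z' \<in> chains n m" using zc supp[OF u(1)] by (auto simp: z'_def chains_def)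
  have "cod n m z' ls = 0" for ls
  proof (cases "ls \<in> tuples n (Suc m)")
    case True
    \<comment> \<open>Orthogonality to the boundary of a single basis tensor is, by duality, the
      vanishing of one value of the coboundary of \<open>z'\<close>.\<close>
    define e where "e = (\<lambda>l. if l = ls then 1 else 0 :: real)"
    have "bd n (Suc m) e \<in> ?U" unfolding boundaries_def using True by (auto simp: chains_def e_def)
    hence "(\<Sum>l\<in>tuples n (Suc m). cod n m z' l * e l) = 0"
      unfolding cod_bd using u(2) by (simp add: z'_def)
    thus ?thesis using True by (simp add: e_def if_distrib cong: if_cong)
  qed (simp add: cod_def)
  hence "z' \<in> cocycles n m" using z'c by (auto simp: cocycles_def zf_def)
  then obtain a where a: "a \<in> Lam (omega n) m" "(\<lambda>l. z' l - a l) \<in> coboundaries n m"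
    using cocycle_representative by blast
  define y where "y = (\<lambda>l. z' l - a l)"
  have yc: "y \<in> chains n m" using z'c Lam_chain[OF a(1)] by (auto simp: y_def chains_def)
  have "y = zf"
  proof (cases m)
    case 0
    thus ?thesis using a(2) by (simp add: y_def)
  next
    case (Suc m')
    then obtain k where k: "y = cod n m' k" using a(2) by (auto simp: y_def)
    have 1: "(\<Sum>l\<in>tuples n m. y l * z l) = 0" and 2: "(\<Sum>l\<in>tuples n m. y l * a l) = 0"
      unfolding k Suc cod_bd using bdz Lam_bd[OF a(1)] Suc by (simp_all add: zf_def)
    have 3: "(\<Sum>l\<in>tuples n m. y l * u l) = 0"
      unfolding t(2) cod_bd[symmetric] unfolding k Suc cod_cod by (simp add: zf_def)
    have "(\<Sum>l\<in>tuples n m. y l * y l) = (\<Sum>l\<in>tuples n m. y l * z l - y l * u l - y l * a l)"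
      by (intro sum.cong refl) (simp add: y_def z'_def algebra_simps)
    also have "\<dots> = 0" unfolding sum_subtractf 1 2 3 by simp
    finally show ?thesis by (rule chain_square_zero[OF yc])
  qed
  hence "z l - a l = u l" for l by (auto simp: y_def z'_def zf_def fun_eq_iff) (metis diff_eq_eq add.commute)
  hence "(\<lambda>l. z l - a l) = u" by blast
  thus ?thesis using a(1) u(1) by auto
qed

theorem theorem4p3:
  fixes n :: nat
  assumes "n \<ge> 1"
  shows "(\<forall>m. \<exists>f. iso_onto_quot (Lam (omega n) m) (cycles n m) (boundaries n m) f)
       \<and> (\<exists>F. (\<forall>m. iso_onto_quot (Lam (omega_star n) m) (cocycles n m) (coboundaries n m) (F m))
             \<and> (\<forall>p q a b. a \<in> Lam (omega_star n) p \<longrightarrow> b \<in> Lam (omega_star n) q \<longrightarrow>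
                   (\<lambda>l. F (p + q) (shuf p q a b) l - shuf p q (F p a) (F q b) l)
                     \<in> coboundaries n (p + q)))"
proof -
  have os: "omega_star n = omega n" by (simp add: omega_star_def omega_def)
  \<comment> \<open>With identity maps on representatives the defect of multiplicativity is exactly
    the zero cochain.\<close>
  have zero: "(\<lambda>_. 0) \<in> coboundaries n m" for m
  proof (cases m)
    case (Suc m')
    have "(\<lambda>_. 0) = cod n m' zf" by (auto simp: cod_def zf_def)
    thus ?thesis using Suc by (auto simp: chains_def zf_def)
  qed (simp add: zf_def)
  have 1: "iso_onto_quot (Lam (omega n) m) (cycles n m) (boundaries n m) (\<lambda>x. x)" for m
    unfolding iso_onto_quot_def
    using cycle_representative Lam_boundary Lam_chain Lam_bd by (auto simp: cycles_def)
  have 2: "iso_onto_quot (Lam (omega n) m) (cocycles n m) (coboundaries n m) (\<lambda>x. x)" for m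
    unfolding iso_onto_quot_def
    using cocycle_representative Lam_coboundary Lam_chain Lam_cod by (auto simp: cocycles_def)
  show ?thesis unfolding os
    by (intro conjI allI exI[of _ "\<lambda>x. x"] 1 exI[of _ "\<lambda>m x. x"] 2 impI) (simp add: zero)
qed

end
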